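(* Let $q=2^r$, $m\ge1$, let $a,b\in\mathbb{F}_q$ with $a\neq b$, let $\gamma$ be a primitive element of $\mathbb{F}_q$, let $\beta\in\mathbb{F}_{q^m}$ and $c=\mathrm{tr}(\beta)$. For $\beta'\in\mathbb{F}_{q^m}$ let $N_{m,3}(\beta')$ be the number of rational places of the function field $\mathbb{F}_{q^m}(x,y_a,y_b)$ defined by $y_a^q-y_a=x+a(\beta'+x^3)$, $y_b^q-y_b=x+b(\beta'+x^3)$, and $N_{m,3}=N_{m,3}(0)$. (1) If $r$ is odd, $N_{m,3}-(q^m+1)$ equals: $-2(q-1)q^{(m+2)/2}$ if $m\equiv0\pmod 8$; $(q-1)q^{(m+1)/2}$ if $m\equiv\pm1\pmod8$; $(q-1)q^{(m+2)/2}$ if $m\equiv\pm2\pmod8$; $-(q-1)q^{(m+1)/2}$ if $m\equiv\pm3\pmod8$; $0$ if $m\equiv4\pmod8$. (2) If $r$ is even, $N_{m,3}-(q^m+1)$ equals: $-2(q-1)q^{(m+2)/2}$ if $m\equiv0\pmod{12}$; $(q-1)q^{(m+1)/2}$ if $m\equiv\pm1,\pm5\pmod{12}$; $(q-1)q^{(m+2)/2}$ if $m\equiv\pm2\pmod{12}$; $-(q-1)q^{(m+1)/2}$ if $m\equiv\pm3\pmod{12}$; $0$ if $m\equiv\pm4\pmod{12}$; $-(q-1)q^{(m+2)/2}$ if $m\equiv6\pmod{12}$. (3) If $r$ is even and $c\neq0$, write $s=r/2$. Then $N_{m,3}(\beta)-(q^m+1)$ equals, according to $m\bmod 12$ (first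 value for $c\in\langle\gamma^3\rangle$, second for $c\notin\langle\gamma^3\rangle$): $m\equiv0$: $2q^{(m+2)/2}$, $2q^{(m+2)/2}$; $m\equiv\pm1,\pm5$: $-q^{(m+1)/2}$, $-q^{(m+1)/2}$; $m\equiv\pm2$: $-q^{(m+2)/2}$, $-q^{(m+2)/2}$; $m\equiv\pm3$: $(1-(-1)^s2\sqrt q)q^{(m+1)/2}$, $(1+(-1)^s\sqrt q)q^{(m+1)/2}$; $m\equiv\pm4$: $(-1)^s2q^{(m+3)/2}$, $(-1)^{s+1}q^{(m+3)/2}$; $m\equiv6$: $(1-(-1)^s2\sqrt q)q^{(m+2)/2}$, $(1+(-1)^s\sqrt q)q^{(m+2)/2}$.
   Context: $\mathrm{tr}$ denotes the trace map $\mathbb{F}_{q^m}\to\mathbb{F}_q$; $\langle\gamma^3\rangle$ is the subgroup of $\mathbb{F}_q^*$ generated by $\gamma^3$ (the nonzero cubes). *)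

theory Defs
  imports Complex_Main "HOL-Library.FuncSet"
begin

text \<open>
  All fields are subsets of one ambient field, given as a type of class \<open>field\<close>.  Nothing else
  is assumed about the ambient field.
\<close>

definition is_subring :: "'f::field set \<Rightarrow> bool" where
  "is_subring R \<longleftrightarrow> 1 \<in> R \<and> (\<forall>x\<in>R. \<forall>y\<in>R. x - y \<in> R \<and> x * y \<in> R)"

definition is_subfield :: "'f::field set \<Rightarrow> bool" where
  "is_subfield L \<longleftrightarrow> is_subring L \<and> (\<forall>x\<in>L. inverse x \<in> L)"

definition transcendental_over :: "'f::field set \<Rightarrow> 'f \<Rightarrow> bool" where
  "transcendental_over K x \<longleftrightarrow>
     (\<forall>n (u :: nat \<Rightarrow> 'f). (\<forall>i\<le>n. u i \<in> K) \<and> (\<Sum>i\<le>n. u i * x ^ i) = 0 \<longrightarrow> (\<forall>i\<le>n. u i = 0))"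

definition adjoin :: "'f::field set \<Rightarrow> 'f set \<Rightarrow> 'f set" where
  "adjoin K S = is_subfield hull (K \<union> S)"

text \<open>The subgroup of the multiplicative group generated by \<open>g\<close> (for \<open>g \<noteq> 0\<close>).\<close>

definition cyclic_subgroup :: "'f::field \<Rightarrow> 'f set" where
  "cyclic_subgroup g = range (\<lambda>i::int. g powi i)"

text \<open>
  This set contains \<open>0\<close> if \<open>g = 0\<close>, so the following condition forces \<open>g \<noteq> 0\<close>; it also forces
  \<open>g \<in> k\<close>.
\<close>

definition primitive_element :: "'f::field set \<Rightarrow> 'f \<Rightarrow> bool" where
  "primitive_element k g \<longleftrightarrow> cyclic_subgroup g = k - {0}"

text \<open>The trace from the field with \<open>q ^ m\<close> elements to its subfield with \<open>q\<close> elements.\<close>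

definition ff_trace :: "nat \<Rightarrow> nat \<Rightarrow> 'f::field \<Rightarrow> 'f" where
  "ff_trace q m z = (\<Sum>i<m. z ^ (q ^ i))"

text \<open>
  Places of a function field \<open>F\<close> with constant field \<open>K\<close>, in the sense of Stichtenoth: a place is
  the maximal ideal, that is, the set of non-units, of a valuation ring of \<open>F / K\<close>.
\<close>

definition valuation_ring :: "'f::field set \<Rightarrow> 'f set \<Rightarrow> 'f set \<Rightarrow> bool" where
  "valuation_ring K F R \<longleftrightarrow>
     is_subring R \<and> K \<subset> R \<and> R \<subset> F \<and> (\<forall>z\<in>F. z \<noteq> 0 \<longrightarrow> z \<in> R \<or> inverse z \<in> R)"

definition nonunits :: "'f::field set \<Rightarrow> 'f set" where
  "nonunits R = {z \<in> R. \<not> (\<exists>w\<in>R. z * w = 1)}"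

text \<open>
  \<open>residue_basis K R P B\<close>: the residue classes modulo \<open>P\<close> of the elements of \<open>B\<close> form a
  finite \<open>K\<close>-basis of \<open>R / P\<close>.  The degree of a place is the \<open>K\<close>-dimension of its residue field;
  it is a relation here, so that it does not presuppose finiteness of the dimension.
\<close>

definition residue_basis :: "'f::field set \<Rightarrow> 'f set \<Rightarrow> 'f set \<Rightarrow> 'f set \<Rightarrow> bool" where
  "residue_basis K R P B \<longleftrightarrow>
     finite B \<and> B \<subseteq> R \<and> (\<forall>z\<in>R. \<exists>!u. u \<in> B \<rightarrow>\<^sub>E K \<and> z - (\<Sum>b\<in>B. u b * b) \<in> P)"

definition has_place_degree :: "'f::field set \<Rightarrow> 'f set \<Rightarrow> 'f set \<Rightarrow> nat \<Rightarrow> bool" where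
  "has_place_degree K R P n \<longleftrightarrow> (\<exists>B. residue_basis K R P B \<and> card B = n)"

definition rational_places :: "'f::field set \<Rightarrow> 'f set \<Rightarrow> 'f set set" where
  "rational_places K F =
     {P. \<exists>R. valuation_ring K F R \<and> P = nonunits R \<and> has_place_degree K R P 1}"

text \<open>
  \<open>F\<close> is the function field \<open>K(x, y, z)\<close> with \<open>y\<close> and \<open>z\<close> playing the roles of \<open>y\<^sub>a\<close> and \<open>y\<^sub>b\<close>.
  For \<open>a \<noteq> b\<close> in the subfield with \<open>q\<close> elements, \<open>q\<close> a power of \<open>2\<close>, such an \<open>F\<close> is unique up to
  isomorphism over \<open>K\<close>: it is Galois over \<open>K(x)\<close> of degree \<open>q\<^sup>2\<close>.  It exists inside every
  algebraically closed ambient field that contains an element transcendental over \<open>K\<close>.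
\<close>

definition is_curve_field ::
  "nat \<Rightarrow> 'f::field set \<Rightarrow> 'f \<Rightarrow> 'f \<Rightarrow> 'f \<Rightarrow> 'f set \<Rightarrow> bool" where
  "is_curve_field q K a b \<beta> F \<longleftrightarrow>
     (\<exists>x y z. transcendental_over K x \<and>
        y ^ q - y = x + a * (\<beta> + x ^ 3) \<and>
        z ^ q - z = x + b * (\<beta> + x ^ 3) \<and>
        F = adjoin K {x, y, z})"

end

theory Submission
  imports Defs "HOL-Computational_Algebra.Polynomial" "HOL-Number_Theory.Cong"
begin

text \<open>
  In terms of \<open>v = (b * y + a * z) / (a + b)\<close> and \<open>w = (y + z) / (a + b) + v ^ 3\<close> the curve has the
  equation \<open>w ^ q + w = v ^ (2 * q + 1) + v ^ (q + 2) + \<beta>\<close>. As \<open>2 * q + 1\<close> is coprime to \<open>q\<close>, there is one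
  place at infinity, and it is rational; the other rational places correspond to the points of this
  smooth affine curve with coordinates in \<open>K\<close>. By additive characters their number is
  \<open>q ^ m + q * (\<Sum>\<mu>. \<psi> (\<mu> * c) * E \<mu>)\<close>, where \<open>\<mu>\<close> runs through the nonzero elements of \<open>k\<close> and
  \<open>E \<mu>\<close> is the sum of \<open>(- 1) ^ Tr (\<mu> * u ^ 3)\<close> over the elements \<open>u\<close> of \<open>K\<close> with relative trace \<open>0\<close>.

  The exponent is a quadratic form, so the radical of its polar form gives the square of \<open>E \<mu>\<close>. For even
  \<open>r\<close> the cube roots of unity act, so \<open>E \<mu>\<close> is congruent to \<open>1\<close> modulo \<open>3\<close>, which gives the sign. For odd
  \<open>r\<close> all elements of \<open>k\<close> are cubes and only \<open>E 1\<close> matters: for even \<open>m\<close> a totally isotropic subspace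
  relates it to the sum over all of \<open>K\<close>, and for odd \<open>m\<close> the Galois action of prime order \<open>p\<close> relates it modulo
  \<open>p\<close> to the sum for a smaller field, where \<open>2 ^ ((p - 1) / 2)\<close> contributes the quadratic character of \<open>2\<close>.
\<close>

section \<open>Valuation rings\<close>

text \<open>Since \<open>a\<close> and \<open>b\<close> are fixed by the power \<open>q\<close>, the
  two equations can be solved linearly: \<open>y = a * w0 + v\<close> and
  \<open>z = b * w0 + v\<close> with \<open>v ^ q + v = x\<close> and
  \<open>w0 ^ q + w0 = \<beta> + x ^ 3\<close>. In terms of \<open>v\<close> the last right-hand
  side has degree \<open>3 * q\<close>, which hides the ramification at infinity; adding
  \<open>v ^ 3\<close> to \<open>w0\<close> lowers the degree to \<open>2 * q + 1\<close>. As
  \<open>F\<close> is only a subfield of an ambient field, the monomials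
  \<open>v ^ i * w ^ j\<close> with \<open>j < q\<close> do the work of a field degree: their
  distinct orders at infinity make them independent, so that elements have well-defined values at
  points.

  The obstacle in the sums is the sign that the square leaves open. The congruence modulo
  \<open>p\<close> decides the sign for odd \<open>m\<close> because both sums are signs times
  powers of \<open>q\<close>, and \<open>q\<close> is prime to \<open>p\<close>.\<close>

lemma subring_closed:
  assumes "is_subring R"
  shows subring_one: "1 \<in> R"
    and subring_diff: "x \<in> R \<Longrightarrow> y \<in> R \<Longrightarrow> x - y \<in> R"
    and subring_mult: "x \<in> R \<Longrightarrow> y \<in> R \<Longrightarrow> x * y \<in> R"
  using assms by (auto simp: is_subring_def)

lemma subring_zero: "is_subring R \<Longrightarrow> 0 \<in> R"
  using subring_diff[of R 1 1] subring_one[of R] by simp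

lemma subring_uminus: "is_subring R \<Longrightarrow> x \<in> R \<Longrightarrow> - x \<in> R"
  using subring_diff[of R 0 x] subring_zero[of R] by simp

lemma subring_add: "is_subring R \<Longrightarrow> x \<in> R \<Longrightarrow> y \<in> R \<Longrightarrow> x + y \<in> R"
  using subring_diff[of R x "- y"] subring_uminus[of R y] by simp

lemma subring_power: "is_subring R \<Longrightarrow> x \<in> R \<Longrightarrow> x ^ n \<in> R"
  by (induction n) (auto simp: subring_one subring_mult)

lemma subring_sum: "is_subring R \<Longrightarrow> (\<And>i. i \<in> I \<Longrightarrow> f i \<in> R) \<Longrightarrow> sum f I \<in> R"
  by (induction I rule: infinite_finite_induct) (auto simp: subring_zero subring_add)

lemmas subring_intros = subring_one subring_diff subring_mult subring_zero subring_uminus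
  subring_add subring_power subring_sum

lemma subfield_subring: "is_subfield L \<Longrightarrow> is_subring L"
  by (simp add: is_subfield_def)

lemma subfield_inverse: "is_subfield L \<Longrightarrow> x \<in> L \<Longrightarrow> inverse x \<in> L"
  by (simp add: is_subfield_def)

lemma subfield_divide: "is_subfield L \<Longrightarrow> x \<in> L \<Longrightarrow> y \<in> L \<Longrightarrow> x / y \<in> L"
  by (simp add: divide_inverse subfield_inverse subring_mult subfield_subring)

lemma nonunits_iff: "z \<in> nonunits R \<longleftrightarrow> z \<in> R \<and> (z = 0 \<or> inverse z \<notin> R)"
proof -
  have "(\<exists>w\<in>R. z * w = 1) \<longleftrightarrow> z \<noteq> 0 \<and> inverse z \<in> R"
    by (metis inverse_unique mult_zero_left right_inverse zero_neq_one)
  then show ?thesis unfolding nonunits_def by blast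
qed

locale vring =
  fixes K F R :: "'f::field set"
  assumes valuation_ring: "valuation_ring K F R"
    and subfield_K: "is_subfield K" and subfield_F: "is_subfield F"
begin

abbreviation P where "P \<equiv> nonunits R"

lemma subring_R: "is_subring R" and K_R: "x \<in> K \<Longrightarrow> x \<in> R" and R_F: "x \<in> R \<Longrightarrow> x \<in> F"
  using valuation_ring unfolding valuation_ring_def by auto

lemma P_R: "x \<in> P \<Longrightarrow> x \<in> R"
  by (simp add: nonunits_iff)

lemma one_notin_P: "1 \<notin> P"
  by (simp add: nonunits_iff subring_one[OF subring_R])

lemma zero_in_P: "0 \<in> P"
  by (simp add: nonunits_iff subring_zero[OF subring_R])

lemma inverse_in_P: "z \<in> F \<Longrightarrow> z \<notin> R \<Longrightarrow> inverse z \<in> P"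
  using valuation_ring subring_zero[OF subring_R] unfolding valuation_ring_def
  by (metis inverse_inverse_eq nonunits_iff)

lemma P_mult: assumes "x \<in> P" "y \<in> R" shows "x * y \<in> P"
proof (cases "x * y = 0")
  case False
  have "x * y \<in> R" using assms subring_R by (simp add: subring_mult P_R)
  moreover have "inverse (x * y) \<notin> R"
  proof
    assume "inverse (x * y) \<in> R"
    then have "y * inverse (x * y) \<in> R" using assms subring_R by (simp add: subring_mult)
    moreover have "y * inverse (x * y) = inverse x" using False by (simp add: field_simps)
    ultimately have "inverse x \<in> R" by metis
    then show False using assms(1) False by (auto simp: nonunits_iff)
  qed
  ultimately show ?thesis by (simp add: nonunits_iff)
qed (use zero_in_P in auto)

lemma P_mult': "x \<in> R \<Longrightarrow> y \<in> P \<Longrightarrow> x * y \<in> P"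
  using P_mult[of y x] by (simp add: mult.commute)

lemma P_add: assumes "x \<in> P" "y \<in> P" shows "x + y \<in> P"
proof -
  have *: "x + y \<in> P" if "x \<in> P" "y \<noteq> 0" "y \<in> P" "x / y \<in> R" for x y
  proof -
    have "y * (1 + x / y) \<in> P" using that by (intro P_mult subring_intros subring_R)
    moreover have "y * (1 + x / y) = x + y" using that(2) by (simp add: distrib_left)
    ultimately show ?thesis by simp
  qed
  show ?thesis
  proof (cases "x = 0 \<or> y = 0")
    case False
    have "x / y \<in> F" using assms subfield_F R_F P_R by (simp add: subfield_divide)
    then have "x / y \<in> R \<or> inverse (x / y) \<in> R"
      using valuation_ring False unfolding valuation_ring_def by (metis divide_eq_0_iff)
    then show ?thesis using *[of x y] *[of y x] assms False
      by (metis add.commute inverse_divide)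
  qed (use assms in auto)
qed

lemma P_uminus: "x \<in> P \<Longrightarrow> - x \<in> P"
  using P_mult[of x "- 1"] by (simp add: subring_R subring_intros)

lemma P_diff: "x \<in> P \<Longrightarrow> y \<in> P \<Longrightarrow> x - y \<in> P"
  using P_add[of x "- y"] P_uminus by simp

lemma P_sum: "(\<And>i. i \<in> I \<Longrightarrow> f i \<in> P) \<Longrightarrow> sum f I \<in> P"
  by (induction I rule: infinite_finite_induct) (auto simp: zero_in_P P_add)

lemma P_power: "x \<in> P \<Longrightarrow> n > 0 \<Longrightarrow> x ^ n \<in> P"
  by (cases n) (auto simp: P_mult P_R subring_R subring_power)

lemma P_K: "x \<in> P \<Longrightarrow> x \<in> K \<Longrightarrow> x = 0"
  using K_R subfield_inverse[OF subfield_K] by (auto simp: nonunits_iff)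

lemma P_no_inverse: "x \<in> P \<Longrightarrow> y \<in> R \<Longrightarrow> x * y \<noteq> 1"
  using P_mult[of x y] one_notin_P by auto

text \<open>Orders at infinity can be compared after raising to the power \<open>q\<close>, where
  the equation of the curve applies; this leads back.\<close>

lemma P_of_power: assumes "x \<in> F" "x ^ n \<in> P" shows "x \<in> P"
proof (rule ccontr)
  assume "x \<notin> P"
  then have "x \<noteq> 0" "inverse x \<in> R" using assms(1) inverse_in_P zero_in_P
    by (auto simp: nonunits_iff)
  then have "x ^ n * inverse x ^ n \<in> P" using P_mult[OF assms(2) subring_power[OF subring_R]] by blast
  then show False using \<open>x \<noteq> 0\<close> one_notin_P by (simp flip: power_mult_distrib)
qed

lemma unit_of_residue:
  assumes "z - c \<in> P" "c \<in> K" "c \<noteq> 0"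
  shows "z \<in> R" "z \<noteq> 0" "inverse z \<in> R"
proof -
  have "(z - c) + c \<in> R" using assms by (intro subring_add subring_R P_R K_R)
  then show zR: "z \<in> R" by simp
  have "z \<notin> P"
  proof
    assume "z \<in> P"
    then have "z - (z - c) \<in> P" using assms P_diff by blast
    then show False using assms P_K by simp
  qed
  then show "z \<noteq> 0" "inverse z \<in> R" using zR by (auto simp: nonunits_iff)
qed

lemma residue_unique:
  assumes "z - c \<in> P" "z - d \<in> P" "c \<in> K" "d \<in> K"
  shows "c = d"
proof -
  have "(z - d) - (z - c) \<in> P" using assms P_diff by blast
  then show ?thesis using assms P_K[of "c - d"] subfield_subring[OF subfield_K]
    by (simp add: subring_diff)
qed

lemma residue_mult:
  assumes "x - c \<in> P" "y - d \<in> P" "c \<in> K" "d \<in> K"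
  shows "x * y - c * d \<in> P"
proof -
  have "(x - c) + c \<in> R" using assms by (intro subring_add subring_R P_R K_R)
  then have "x * (y - d) + (x - c) * d \<in> P"
    using assms P_add[OF P_mult'[of x "y - d"] P_mult[of "x - c" d]] K_R by simp
  then show ?thesis by (simp add: algebra_simps)
qed

lemma residue_add: "x - c \<in> P \<Longrightarrow> y - d \<in> P \<Longrightarrow> (x + y) - (c + d) \<in> P"
  using P_add[of "x - c" "y - d"] by (simp add: algebra_simps)

lemma residue_power:
  assumes "x - c \<in> P" "c \<in> K"
  shows "x ^ n - c ^ n \<in> P"
proof (induction n)
  case (Suc n)
  then show ?case using assms residue_mult[of x c "x ^ n" "c ^ n"]
    by (simp add: subfield_subring[OF subfield_K] subring_power)
qed (simp add: zero_in_P)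

lemma nonunits_eq_iff_notin: assumes "z \<in> F" shows "z \<in> R \<longleftrightarrow> z = 0 \<or> inverse z \<notin> P"
  using assms inverse_in_P[of z] subring_zero[OF subring_R] by (auto simp: nonunits_iff)

text \<open>The element \<open>b\<close> of a one-element basis is itself congruent to a nonzero
  constant, because \<open>1\<close> is a multiple of it modulo \<open>P\<close>. So the constants
  represent all residue classes.\<close>

lemma degree_one_iff: "has_place_degree K R P 1 \<longleftrightarrow> (\<forall>z\<in>R. \<exists>c\<in>K. z - c \<in> P)"
proof
  assume "has_place_degree K R P 1"
  then obtain b where b: "residue_basis K R P {b}"
    unfolding has_place_degree_def by (metis card_1_singletonE)
  then have bR: "b \<in> R"
    and ex: "\<And>z. z \<in> R \<Longrightarrow> \<exists>u. u \<in> {b} \<rightarrow>\<^sub>E K \<and> z - u b * b \<in> P"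
    unfolding residue_basis_def by (auto dest!: ex1_implies_ex)
  have ex': "\<exists>d\<in>K. z - d * b \<in> P" if "z \<in> R" for z
    using ex[OF that] by (auto simp: PiE_def Pi_def)
  obtain d where d: "d \<in> K" "1 - d * b \<in> P" using ex'[OF subring_one[OF subring_R]] by blast
  have "d \<noteq> 0" using d(2) one_notin_P by auto
  have b': "b - inverse d \<in> P"
  proof -
    have "(- inverse d) * (1 - d * b) \<in> P"
      using d subfield_K by (intro P_mult' K_R subring_uminus subfield_subring subfield_inverse) auto
    then show ?thesis using \<open>d \<noteq> 0\<close> by (simp add: algebra_simps)
  qed
  show "\<forall>z\<in>R. \<exists>c\<in>K. z - c \<in> P"
  proof
    fix z assume "z \<in> R"
    then obtain e where e: "e \<in> K" "z - e * b \<in> P" using ex' by blast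
    have "(z - e * b) + e * (b - inverse d) \<in> P" using e b' by (intro P_add P_mult' K_R)
    then show "\<exists>c\<in>K. z - c \<in> P" using e d subfield_K
      by (intro bexI[of _ "e * inverse d"])
         (auto simp: algebra_simps subfield_subring subfield_inverse subring_mult)
  qed
next
  assume ex: "\<forall>z\<in>R. \<exists>c\<in>K. z - c \<in> P"
  have "\<exists>!u. u \<in> {1} \<rightarrow>\<^sub>E K \<and> z - (\<Sum>b\<in>{1}. u b * b) \<in> P" if zR: "z \<in> R" for z
  proof -
    obtain c where c: "c \<in> K" "z - c \<in> P" using bspec[OF ex zR] by blast
    show ?thesis
    proof (rule ex1I[of _ "\<lambda>x\<in>{1}. c"])
      show "(\<lambda>x\<in>{1}. c) \<in> {1} \<rightarrow>\<^sub>E K \<and> z - (\<Sum>b\<in>{1}. (\<lambda>x\<in>{1}. c) b * b) \<in> P"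
        using c by simp
      fix u assume u: "u \<in> {1} \<rightarrow>\<^sub>E K \<and> z - (\<Sum>b\<in>{1}. u b * b) \<in> P"
      then have u1: "u 1 \<in> K" "z - u 1 \<in> P" "u \<in> extensional {1}" by (auto simp: PiE_def)
      then have "u 1 = c" using c residue_unique[of z "u 1" c] by blast
      then show "u = (\<lambda>x\<in>{1}. c)" using u1(3) by (intro extensionalityI[of _ "{1}"]) auto
    qed
  qed
  then have "residue_basis K R P {1}"
    unfolding residue_basis_def by (simp add: subring_one[OF subring_R])
  then show "has_place_degree K R P 1" unfolding has_place_degree_def by force
qed

end

lemma rational_places_eq:
  assumes "is_subfield K" "is_subfield F"
  shows "rational_places K F =
    nonunits ` {R. valuation_ring K F R \<and> (\<forall>z\<in>R. \<exists>c\<in>K. z - c \<in> nonunits R)}"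
proof -
  have "has_place_degree K R (nonunits R) 1 \<longleftrightarrow> (\<forall>z\<in>R. \<exists>c\<in>K. z - c \<in> nonunits R)"
    if "valuation_ring K F R" for R
    using vring.degree_one_iff[of K F R] that assms unfolding vring_def by simp
  then show ?thesis unfolding rational_places_def by auto
qed

text \<open>The ring is recovered from its maximal ideal: a nonzero \<open>z\<close> of
  \<open>F\<close> lies in it unless the inverse of \<open>z\<close> is a non-unit. Places may
  therefore be counted by their rings.\<close>

lemma nonunits_inj_on:
  assumes "is_subfield K" "is_subfield F"
  shows "inj_on nonunits {R. valuation_ring K F R}"
proof (rule inj_onI, clarify)
  fix R S assume *: "valuation_ring K F R" "valuation_ring K F S" "nonunits R = nonunits S"
  interpret R: vring K F R using * assms by unfold_locales
  interpret S: vring K F S using * assms by unfold_locales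
  show "R = S"
    using R.nonunits_eq_iff_notin S.nonunits_eq_iff_notin R.R_F S.R_F *(3) by blast
qed

text \<open>Chevalley's argument by maximality. Avoiding \<open>v\<close> while containing its
  inverse \<open>t\<close> means that \<open>t\<close> stays a non-unit, which replaces the usual
  condition that an ideal stays proper.\<close>

lemma maximal_subring_valuation:
  assumes F: "is_subfield F" "v \<in> F"
    and R: "is_subring R" "R \<subseteq> F" "inverse v \<in> R" "v \<notin> R"
    and max: "\<And>S. is_subring S \<Longrightarrow> R \<subseteq> S \<Longrightarrow> S \<subseteq> F \<Longrightarrow> v \<notin> S \<Longrightarrow> S = R"
    and z: "z \<in> F" "z \<noteq> 0"
  shows "z \<in> R \<or> inverse z \<in> R"
proof (rule ccontr)
  assume "\<not> (z \<in> R \<or> inverse z \<in> R)"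
  then have zR: "z \<notin> R" "inverse z \<notin> R" by auto
  define t where "t = inverse v"
  have v0: "v \<noteq> 0" using R subring_zero by auto
  have subF: "is_subring F" using F(1) by (rule subfield_subring)
  define RX where "RX = {p :: 'a poly. \<forall>i. coeff p i \<in> R}"
  have RX_mult: "p * p' \<in> RX" if "p \<in> RX" "p' \<in> RX" for p p'
    using that R(1) unfolding RX_def by (auto simp: coeff_mult intro!: subring_sum subring_mult)
  have RX_diff: "p - p' \<in> RX" if "p \<in> RX" "p' \<in> RX" for p p'
    using that R(1) unfolding RX_def by (auto intro!: subring_diff)
  have RX_1: "1 \<in> RX"
    using R(1) unfolding RX_def by (auto simp: coeff_1 subring_zero subring_one)
  have RX_const: "[:a:] \<in> RX" if "a \<in> R" for a
    using that R(1) unfolding RX_def by (auto simp: coeff_pCons subring_zero split: nat.splits)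
  have RX_X: "[:0, 1:] \<in> RX"
    using R(1) unfolding RX_def
    by (auto simp: coeff_pCons subring_zero subring_one split: nat.splits)
  \<comment> \<open>\<open>R[x]\<close> is strictly larger than \<open>R\<close>, so by maximality
    it contains \<open>v\<close>.\<close>
  have key: "\<exists>p\<in>RX. v = poly p x" if x: "x \<in> F" "x \<notin> R" for x
  proof (rule ccontr)
    assume no: "\<not> (\<exists>p\<in>RX. v = poly p x)"
    define S where "S = (\<lambda>p. poly p x) ` RX"
    have "is_subring S"
      unfolding is_subring_def S_def
      by (auto simp flip: poly_diff poly_mult intro!: imageI RX_mult RX_diff)
         (metis RX_1 image_eqI poly_1)
    moreover have "R \<subseteq> S"
      unfolding S_def using RX_const by (force intro!: image_eqI)
    moreover have "S \<subseteq> F"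
      unfolding S_def RX_def using R(2) x subF
      by (auto simp: poly_altdef intro!: subring_sum subring_mult subring_power)
    moreover have "v \<notin> S" using no unfolding S_def by auto
    ultimately have "S = R" using max by blast
    moreover have "x \<in> S" unfolding S_def using RX_X by (force intro!: image_eqI)
    ultimately show False using x by simp
  qed
  \<comment> \<open>\<open>t\<close> lies in the Jacobson radical of \<open>R\<close>. Otherwise
    \<open>v\<close> is a polynomial in the inverse of \<open>1 - t * b\<close>; clearing
    denominators puts \<open>v * (1 - t * e) = v - e\<close> into \<open>R\<close> for some
    \<open>e\<close> in \<open>R\<close>, and with it \<open>v\<close>.\<close>
  have jac: "inverse (1 - t * b) \<in> R" "1 - t * b \<noteq> 0" if b: "b \<in> R" for b
  proof -
    show ne: "1 - t * b \<noteq> 0"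
    proof
      assume "1 - t * b = 0"
      then have "v = b" using v0 unfolding t_def by (simp add: field_simps)
      then show False using b R by simp
    qed
    show "inverse (1 - t * b) \<in> R"
    proof (rule ccontr)
      assume notin: "inverse (1 - t * b) \<notin> R"
      have "1 - t * b \<in> F" using b R subF F unfolding t_def
        by (auto intro!: subring_intros simp: subfield_inverse)
      then obtain p where p: "p \<in> RX" "v = poly p (inverse (1 - t * b))"
        using key notin F(1) subfield_inverse by blast
      define N where "N = degree p"
      have a_R: "1 - t * b \<in> R" using b R unfolding t_def by (auto intro!: subring_intros)
      have "v * (1 - t * b) ^ N = (\<Sum>i\<le>N. coeff p i * (1 - t * b) ^ (N - i))"
        unfolding p(2) poly_altdef N_def[symmetric] sum_distrib_right
      proof (rule sum.cong)
        fix i assume "i \<in> {..N}"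
        then have "(1 - t * b) ^ N = (1 - t * b) ^ i * (1 - t * b) ^ (N - i)"
          by (simp flip: power_add)
        then show "coeff p i * inverse (1 - t * b) ^ i * (1 - t * b) ^ N
          = coeff p i * (1 - t * b) ^ (N - i)"
          using ne by (simp add: power_inverse field_simps)
      qed simp
      also have "\<dots> \<in> R" using p a_R R(1) unfolding RX_def
        by (intro subring_sum subring_mult subring_power) auto
      finally have in_R: "v * (1 - t * b) ^ N \<in> R" .
      have pw: "\<exists>e\<in>R. (1 - t * b) ^ n = 1 - t * e" for n
      proof (induction n)
        case 0 show ?case using R(1) subring_zero by (intro bexI[of _ 0]) auto
      next
        case (Suc n)
        then obtain e where e: "e \<in> R" "(1 - t * b) ^ n = 1 - t * e" by blast
        have "b + e - t * b * e \<in> R" using e b R unfolding t_def by (auto intro!: subring_intros)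
        moreover have "(1 - t * b) ^ Suc n = 1 - t * (b + e - t * b * e)"
          unfolding power_Suc e(2) by (simp add: algebra_simps)
        ultimately show ?case by blast
      qed
      then obtain e where e: "e \<in> R" "(1 - t * b) ^ N = 1 - t * e" by blast
      have "v * (1 - t * b) ^ N + e = v" unfolding e(2) using v0 by (simp add: t_def algebra_simps)
      then show False using in_R e R subring_add by metis
    qed
  qed
  define rel where "rel x n \<longleftrightarrow> (\<exists>p\<in>RX. v = poly p x \<and> degree p \<le> n)" for x n
  define dg where "dg x = (LEAST n. rel x n)" for x
  have least: "rel x (dg x)" "\<And>n. rel x n \<Longrightarrow> dg x \<le> n" if x: "x \<in> F" "x \<notin> R" for x
  proof -
    obtain p where "p \<in> RX" "v = poly p x" using key[OF x] by blast
    then have "rel x (degree p)" unfolding rel_def by blast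
    then show "rel x (dg x)" unfolding dg_def by (rule LeastI)
    show "\<And>n. rel x n \<Longrightarrow> dg x \<le> n" unfolding dg_def by (rule Least_le)
  qed
  text \<open>A relation for \<open>y = inverse x\<close> of degree \<open>m \<le> n\<close> lets one lower the degree of
    a relation of minimal degree \<open>n\<close> for \<open>x\<close>.\<close>
  have absurd: False if x: "x \<in> F" "x \<notin> R" "inverse x \<notin> R" "x \<noteq> 0" and le: "dg (inverse x) \<le> dg x" for x
  proof -
    define n m where "n = dg x" and "m = dg (inverse x)"
    have xi: "inverse x \<in> F" using x F(1) subfield_inverse by blast
    obtain p where p: "p \<in> RX" "v = poly p x" "degree p \<le> n"
      using least(1)[OF x(1,2)] unfolding rel_def n_def by blast
    obtain p' where p': "p' \<in> RX" "v = poly p' (inverse x)" "degree p' \<le> m"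
      using least(1)[OF xi x(3)] unfolding rel_def m_def by blast
    have "n > 0"
    proof (rule ccontr)
      assume "\<not> n > 0"
      then have "degree p = 0" using p by simp
      then have "v = coeff p 0" using p(2) by (simp add: poly_altdef)
      then show False using p(1) R unfolding RX_def by auto
    qed
    have c0: "coeff p' 0 \<in> R" using p' unfolding RX_def by auto
    \<comment> \<open>Multiplied by \<open>t\<close>, the relation for \<open>inverse x\<close>
      reads \<open>1 = t * coeff p' 0\<close> plus higher terms. Dividing by the unit
      \<open>1 - t * coeff p' 0\<close> expresses \<open>1\<close> by positive powers of
      \<open>inverse x\<close>, hence \<open>x ^ n\<close> by lower powers of
      \<open>x\<close>.\<close>
    define a where "a = inverse (1 - t * coeff p' 0)"
    have a: "a \<in> R" "a * (1 - t * coeff p' 0) = 1" using jac[OF c0] unfolding a_def by auto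
    have sum': "v = coeff p' 0 + (\<Sum>i\<in>{1..m}. coeff p' i * inverse x ^ i)"
    proof -
      have "v = (\<Sum>i\<le>m. coeff p' i * inverse x ^ i)" unfolding p'(2)
        using p'(3) by (subst poly_altdef) (rule sum.mono_neutral_left, auto simp: coeff_eq_0)
      also have "{..m} = insert 0 {1..m}" by auto
      finally show ?thesis by simp
    qed
    have "1 - t * coeff p' 0 = t * (v - coeff p' 0)" using v0 unfolding t_def by (simp add: algebra_simps)
    also have "\<dots> = t * (\<Sum>i\<in>{1..m}. coeff p' i * inverse x ^ i)" using sum' by simp
    finally have one: "1 = a * t * (\<Sum>i\<in>{1..m}. coeff p' i * inverse x ^ i)"
      using a(2) by (simp add: mult.assoc)
    have xn: "x ^ n = (\<Sum>i\<in>{1..m}. a * t * coeff p' i * x ^ (n - i))"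
    proof -
      have "x ^ n = a * t * (\<Sum>i\<in>{1..m}. coeff p' i * inverse x ^ i) * x ^ n"
        using one by simp
      also have "\<dots> = (\<Sum>i\<in>{1..m}. a * t * coeff p' i * (inverse x ^ i * x ^ n))"
        by (simp add: sum_distrib_left sum_distrib_right mult.assoc)
      also have "\<dots> = (\<Sum>i\<in>{1..m}. a * t * coeff p' i * x ^ (n - i))"
      proof (rule sum.cong)
        fix i assume "i \<in> {1..m}"
        then have "i \<le> n" using le unfolding n_def m_def by auto
        then have "inverse x ^ i * x ^ n = x ^ (n - i)"
          using x(4) by (simp add: power_diff power_inverse divide_inverse mult.commute)
        then show "a * t * coeff p' i * (inverse x ^ i * x ^ n) = a * t * coeff p' i * x ^ (n - i)"
          by simp
      qed simp
      finally show ?thesis .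
    qed
    define s where "s = p - monom (coeff p n) n
      + (\<Sum>i\<in>{1..m}. monom (coeff p n * a * t * coeff p' i) (n - i))"
    have "poly s x = v - coeff p n * x ^ n + coeff p n * (\<Sum>i\<in>{1..m}. a * t * coeff p' i * x ^ (n - i))"
      unfolding s_def by (simp add: poly_monom poly_sum p(2) sum_distrib_left mult.assoc)
    then have "poly s x = v" by (simp only: xn[symmetric] diff_add_cancel)
    moreover have "s \<in> RX"
      unfolding s_def RX_def using p(1) p'(1) a(1) R unfolding RX_def t_def
      by (auto simp: coeff_sum intro!: subring_add subring_diff subring_sum subring_mult subring_zero)
    moreover have "degree s \<le> n - 1"
    proof (rule degree_le, clarify)
      fix i assume i: "n - 1 < i"
      have "coeff p i - (if n = i then coeff p n else 0) = 0"
        using i p(3) by (cases "i = n") (auto simp: coeff_eq_0)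
      moreover have "coeff (monom (coeff p n * a * t * coeff p' j) (n - j)) i = 0"
        if "j \<in> {1..m}" for j
        using that i by auto
      ultimately show "coeff s i = 0" unfolding s_def by (simp add: coeff_sum)
    qed
    ultimately have "rel x (n - 1)" unfolding rel_def by metis
    then have "n \<le> n - 1" unfolding n_def using least(2)[OF x(1,2)] n_def by blast
    then show False using \<open>n > 0\<close> by simp
  qed
  show False
    using absurd[of z] absurd[of "inverse z"] z zR F(1) subfield_inverse by force
qed

text \<open>Zorn's lemma for the subrings between \<open>S\<close> and \<open>F\<close> that avoid
  \<open>v\<close>; the union of a chain still avoids it.\<close>

lemma valuation_ring_exists:
  assumes F: "is_subfield F" "is_subfield K" "K \<subseteq> F" and v: "v \<in> F"
    and S: "is_subring S" "K \<subseteq> S" "S \<subseteq> F" "inverse v \<in> S" "v \<notin> S"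
  obtains R where "valuation_ring K F R" "v \<notin> R"
proof -
  define \<A> where "\<A> = {R. is_subring R \<and> S \<subseteq> R \<and> R \<subseteq> F \<and> v \<notin> R}"
  have "\<exists>M\<in>\<A>. \<forall>X\<in>\<A>. M \<subseteq> X \<longrightarrow> X = M"
  proof (rule subset_Zorn_nonempty)
    show "\<A> \<noteq> {}" using S unfolding \<A>_def by auto
    fix C assume C: "C \<noteq> {}" "subset.chain \<A> C"
    have sub: "is_subring X" if "X \<in> C" for X using C that unfolding subset.chain_def \<A>_def by auto
    have lin: "X \<subseteq> Y \<or> Y \<subseteq> X" if "X \<in> C" "Y \<in> C" for X Y
      using C that unfolding subset.chain_def by auto
    have "is_subring (\<Union>C)"
      unfolding is_subring_def
    proof (intro conjI ballI)
      show "1 \<in> \<Union>C" using C(1) sub subring_one by blast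
      fix x y assume "x \<in> \<Union>C" "y \<in> \<Union>C"
      then obtain X where "X \<in> C" "x \<in> X" "y \<in> X" using lin by blast
      then show "x - y \<in> \<Union>C" "x * y \<in> \<Union>C" using sub subring_diff subring_mult by blast+
    qed
    then show "\<Union>C \<in> \<A>" using C unfolding subset.chain_def \<A>_def by blast
  qed
  then obtain R where R: "R \<in> \<A>" and max: "\<And>X. X \<in> \<A> \<Longrightarrow> R \<subseteq> X \<Longrightarrow> X = R" by blast
  have *: "z \<in> R \<or> inverse z \<in> R" if "z \<in> F" "z \<noteq> 0" for z
  proof (rule maximal_subring_valuation[OF F(1) v _ _ _ _ _ that])
    show "is_subring R" "R \<subseteq> F" "v \<notin> R" "inverse v \<in> R" using R S unfolding \<A>_def by auto
    fix X assume "is_subring X" "R \<subseteq> X" "X \<subseteq> F" "v \<notin> X"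
    then show "X = R" using R by (intro max) (auto simp: \<A>_def)
  qed
  \<comment> \<open>\<open>inverse v\<close> is in \<open>R\<close> but not in \<open>K\<close>, so
    that \<open>K\<close> is a proper subset of \<open>R\<close>.\<close>
  have "v \<notin> K" using S by auto
  then have "inverse v \<notin> K" using F(2) subfield_inverse by force
  then have "valuation_ring K F R"
    unfolding valuation_ring_def using * R S v unfolding \<A>_def by blast
  then show thesis using that R unfolding \<A>_def by blast
qed


section \<open>Curves \<open>w ^ q - w = h(v)\<close> with one place at infinity\<close>

text \<open>The bound is put on the coefficients rather than on \<open>degree\<close>, so that
  \<open>N = 0\<close> leaves only the zero polynomial and the count is exactly
  \<open>card K ^ N\<close>.\<close>

definition polys_below :: "'f::field set \<Rightarrow> nat \<Rightarrow> 'f poly set" where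
  "polys_below K N = {p. (\<forall>i. coeff p i \<in> K) \<and> (\<forall>i\<ge>N. coeff p i = 0)}"

definition polys_over :: "'f::field set \<Rightarrow> 'f poly set" where
  "polys_over K = {p. \<forall>i. coeff p i \<in> K}"

lemma pCons_over_iff: "pCons c p \<in> polys_over K \<longleftrightarrow> c \<in> K \<and> p \<in> polys_over K"
  unfolding polys_over_def by (auto simp: coeff_pCons split: nat.splits)

lemma polys_below_over: "p \<in> polys_below K N \<Longrightarrow> p \<in> polys_over K"
  unfolding polys_over_def polys_below_def by auto

lemma polys_below_mono: "p \<in> polys_below K N \<Longrightarrow> N \<le> M \<Longrightarrow> p \<in> polys_below K M"
  unfolding polys_below_def by auto

lemma polys_below_add:
  "is_subring K \<Longrightarrow> p \<in> polys_below K N \<Longrightarrow> p' \<in> polys_below K N \<Longrightarrow> p + p' \<in> polys_below K N"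
  unfolding polys_below_def by (auto intro: subring_add)

lemma polys_below_diff:
  "is_subring K \<Longrightarrow> p \<in> polys_below K N \<Longrightarrow> p' \<in> polys_below K N \<Longrightarrow> p - p' \<in> polys_below K N"
  unfolding polys_below_def by (auto intro: subring_diff)

lemma polys_below_smult:
  "is_subring K \<Longrightarrow> c \<in> K \<Longrightarrow> p \<in> polys_below K N \<Longrightarrow> smult c p \<in> polys_below K N"
  unfolding polys_below_def by (auto intro: subring_mult)

lemma polys_below_pCons:
  "c \<in> K \<Longrightarrow> p \<in> polys_below K N \<Longrightarrow> pCons c p \<in> polys_below K (Suc N)"
  unfolding polys_below_def by (auto simp: coeff_pCons split: nat.splits)

lemma polys_below_mult:
  assumes "is_subring K" "p \<in> polys_below K N" "p' \<in> polys_over K"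
  shows "p * p' \<in> polys_below K (N + degree p')"
  unfolding polys_below_def
proof (intro CollectI conjI allI impI)
  show "coeff (p * p') i \<in> K" for i
    using assms unfolding polys_below_def polys_over_def coeff_mult
    by (intro subring_sum subring_mult) auto
  fix i assume i: "N + degree p' \<le> i"
  have "coeff p j * coeff p' (i - j) = 0" for j
  proof (cases "j < N")
    case True
    then show ?thesis using i by (simp add: coeff_eq_0)
  next
    case False
    then show ?thesis using assms(2) by (simp add: polys_below_def)
  qed
  then show "coeff (p * p') i = 0" unfolding coeff_mult by (intro sum.neutral) auto
qed

lemma card_polys_below:
  assumes "is_subring K" "finite K"
  shows "finite (polys_below K N)" "card (polys_below K N) = card K ^ N"
proof (induction N)
  case 0
  have "polys_below K 0 = {0}" using assms(1) unfolding polys_below_def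
    by (auto simp: poly_eq_iff subring_zero)
  then show "finite (polys_below K 0)" "card (polys_below K 0) = card K ^ 0" by auto
next
  case (Suc N)
  have eq: "polys_below K (Suc N) = (\<lambda>(c, p). pCons c p) ` (K \<times> polys_below K N)"
  proof (intro equalityI subsetI)
    fix p assume p: "p \<in> polys_below K (Suc N)"
    obtain c p' where cp: "p = pCons c p'" by (cases p)
    have "coeff p i \<in> K" "i \<ge> Suc N \<Longrightarrow> coeff p i = 0" for i
      using p unfolding polys_below_def by auto
    from this[of 0] this[of "Suc _"] have "c \<in> K" "p' \<in> polys_below K N"
      unfolding cp polys_below_def by auto
    then show "p \<in> (\<lambda>(c, p). pCons c p) ` (K \<times> polys_below K N)" using cp by auto
  qed (auto intro: polys_below_pCons)
  have inj: "inj_on (\<lambda>(c, p). pCons c p) (K \<times> polys_below K N)" by (auto simp: inj_on_def)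
  show "finite (polys_below K (Suc N))" "card (polys_below K (Suc N)) = card K ^ Suc N"
    unfolding eq using Suc assms by (auto simp: card_image[OF inj] card_cartesian_product)
qed

lemma adjoin_subset: "is_subfield L \<Longrightarrow> K \<subseteq> L \<Longrightarrow> S \<subseteq> L \<Longrightarrow> adjoin K S \<subseteq> L"
  unfolding adjoin_def by (intro hull_minimal) auto

lemma subset_adjoin: "K \<subseteq> adjoin K S" "S \<subseteq> adjoin K S"
  unfolding adjoin_def using hull_subset[of "K \<union> S" is_subfield] by auto

lemma subfield_adjoin: "is_subfield (adjoin K S)"
  unfolding adjoin_def hull_def is_subfield_def is_subring_def by blast

text \<open>\<open>q * i + n * j\<close> stands for the pole order of \<open>v ^ i * w ^ j\<close>
  at infinity. Modulo \<open>q\<close> it determines \<open>n * j\<close>, hence \<open>j\<close>,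
  as \<open>n\<close> is invertible there.\<close>

lemma weights_distinct:
  assumes "coprime n q" "j < q" "j' < q" "q * i + n * j = q * i' + n * (j' :: nat)"
  shows "j = j'" "i = i'"
proof -
  have "j = j'" if "j < q" "j' < q" "q * i + n * j = q * i' + n * j'" "j \<le> j'" for i i' j j' :: nat
  proof -
    have "q * i = q * i' + n * (j' - j)" using that by (simp add: diff_mult_distrib2)
    then have "q dvd n * (j' - j)" by (metis dvd_add_right_iff dvd_triv_left)
    then have "q dvd j' - j" using assms(1) by (simp add: coprime_commute coprime_dvd_mult_right_iff)
    moreover have "j' - j < q" using that by simp
    ultimately show ?thesis using that(4) by (auto dest!: dvd_imp_le simp: not_less)
  qed
  from this[OF assms(2-4)] this[OF assms(3,2) assms(4)[symmetric]] show "j = j'" by linarith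
  then show "i = i'" using assms by auto
qed

locale one_infinite_place =
  fixes K :: "'f::field set" and q :: nat and v w :: 'f and h :: "'f poly"
  assumes subfield_K: "is_subfield K" and finite_K: "finite K"
    and q_ge_2: "q \<ge> 2" and char_dvd_q: "of_nat q = (0 :: 'f)"
    and transcendental: "transcendental_over K v"
    and h_over: "h \<in> polys_over K" and coprime_deg: "coprime (degree h) q"
    and equation: "w ^ q - w = poly h v"
begin

abbreviation F where "F \<equiv> adjoin K {v, w}"
abbreviation n where "n \<equiv> degree h"

lemmas subring_K = subfield_subring[OF subfield_K]
lemmas subring_F = subfield_subring[OF subfield_adjoin[of K "{v, w}"]]

lemma F_mem: "K \<subseteq> F" "v \<in> F" "w \<in> F"
  using subset_adjoin[where K = K and S = "{v, w}"] by auto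

lemma n_pos: "n > 0"
  using coprime_deg q_ge_2 by (cases n) auto

lemma poly_v_eq_0: assumes "p \<in> polys_over K" "poly p v = 0" shows "p = 0"
proof -
  have "\<forall>i\<le>degree p. coeff p i = 0"
    using transcendental[unfolded transcendental_over_def, rule_format, of "degree p" "coeff p"] assms
    unfolding poly_altdef polys_over_def by auto
  then show ?thesis by (metis leading_coeff_0_iff order_refl)
qed

lemma v_nonzero: "v \<noteq> 0"
proof
  assume "v = 0"
  then have "[:0, 1:] = (0 :: 'f poly)"
    using subring_K by (intro poly_v_eq_0)
      (auto simp: polys_over_def coeff_pCons subring_zero subring_one split: nat.splits)
  then show False by simp
qed

definition at_infinity :: "'f set \<Rightarrow> bool" where
  "at_infinity R \<longleftrightarrow> valuation_ring K F R \<and> v \<notin> R"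

lemma at_infinity_vring: "at_infinity R \<Longrightarrow> vring K F R"
  using subfield_K subfield_adjoin unfolding at_infinity_def by unfold_locales auto

lemma at_infinity_exists: "\<exists>R. at_infinity R"
proof -
  define S where "S = (\<lambda>p. poly p (inverse v)) ` polys_over K"
  have S: "is_subring S"
    unfolding is_subring_def
  proof (intro conjI ballI)
    have "1 \<in> polys_over K" using subring_K by (auto simp: polys_over_def subring_zero subring_one)
    then show "1 \<in> S" unfolding S_def by (metis image_eqI poly_1)
    fix x y assume "x \<in> S" "y \<in> S"
    then obtain p p' where p: "p \<in> polys_over K" "p' \<in> polys_over K"
      "x = poly p (inverse v)" "y = poly p' (inverse v)" unfolding S_def by auto
    then have "p - p' \<in> polys_over K" "p * p' \<in> polys_over K" using subring_K
      by (auto simp: polys_over_def coeff_mult intro!: subring_diff subring_sum subring_mult)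
    then show "x - y \<in> S" "x * y \<in> S" unfolding S_def p(3,4)
      by (metis image_eqI poly_diff, metis image_eqI poly_mult)
  qed
  have "K \<subseteq> S"
  proof
    fix c assume "c \<in> K"
    then have "[:c:] \<in> polys_over K" using subring_K
      by (auto simp: polys_over_def coeff_pCons subring_zero split: nat.splits)
    then show "c \<in> S" unfolding S_def by (force intro!: image_eqI)
  qed
  moreover have "S \<subseteq> F"
    unfolding S_def polys_over_def using F_mem subring_F
    by (auto simp: poly_altdef
        intro!: subring_sum subring_mult subring_power subfield_inverse subfield_adjoin)
  moreover have "inverse v \<in> S"
  proof -
    have "[:0, 1:] \<in> polys_over K" using subring_K
      by (auto simp: polys_over_def coeff_pCons subring_zero subring_one split: nat.splits)
    then show "inverse v \<in> S" unfolding S_def by (force intro!: image_eqI)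
  qed
  \<comment> \<open>Clearing denominators in \<open>v = poly p (inverse v)\<close> would give a
    polynomial relation for \<open>v\<close> whose leading term \<open>v ^ (N + 1)\<close> cannot
    cancel.\<close>
  moreover have "v \<notin> S"
  proof
    assume "v \<in> S"
    then obtain p where p: "p \<in> polys_over K" "v = poly p (inverse v)" unfolding S_def by auto
    define N where "N = degree p"
    have "v * v ^ N = (\<Sum>i\<le>N. coeff p i * v ^ (N - i))"
    proof -
      have "v * v ^ N = (\<Sum>i\<le>N. coeff p i * inverse v ^ i) * v ^ N"
        using p(2) by (simp add: poly_altdef N_def)
      also have "\<dots> = (\<Sum>i\<le>N. coeff p i * v ^ (N - i))"
        unfolding sum_distrib_right using v_nonzero
        by (intro sum.cong) (auto simp: power_diff divide_inverse power_inverse mult_ac)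
      finally show ?thesis .
    qed
    then have "poly (monom 1 (Suc N) - (\<Sum>i\<le>N. monom (coeff p i) (N - i))) v = 0"
      by (simp add: poly_monom poly_sum)
    then have "monom 1 (Suc N) - (\<Sum>i\<le>N. monom (coeff p i) (N - i)) = 0"
      using p(1) subring_K by (intro poly_v_eq_0)
        (auto simp: polys_over_def coeff_sum subring_zero subring_one
          intro!: subring_diff subring_sum subring_uminus)
    then have "coeff (monom 1 (Suc N) - (\<Sum>i\<le>N. monom (coeff p i) (N - i))) (Suc N) = 0" by simp
    moreover have "(\<Sum>i\<le>N. if N - i = Suc N then coeff p i else 0) = 0"
      by (intro sum.neutral) auto
    ultimately show False by (simp add: coeff_sum)
  qed
  ultimately show ?thesis
    using valuation_ring_exists[OF subfield_adjoin subfield_K _ _ S] F_mem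
    unfolding at_infinity_def by metis
qed

text \<open>The same coefficients are used twice: at \<open>(v, w)\<close> they give a function on
  the curve, and at a point \<open>(a, b)\<close> the value of that function.\<close>

definition rep :: "(nat \<Rightarrow> 'f poly) \<Rightarrow> 'f \<Rightarrow> 'f \<Rightarrow> 'f" where
  "rep p a b = (\<Sum>j<q. poly (p j) a * b ^ j)"

context
  fixes R assumes R: "at_infinity R"
begin

interpretation vring K F R
  using R by (rule at_infinity_vring)

lemma inverse_v_P: "inverse v \<in> P"
  using R F_mem inverse_in_P unfolding at_infinity_def by blast

lemma lead_term: assumes "p \<in> polys_over K"
  shows "poly p v / v ^ degree p - lead_coeff p \<in> P"
proof -
  have "poly p v / v ^ degree p = (\<Sum>i\<le>degree p. coeff p i * inverse v ^ (degree p - i))"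
    unfolding poly_altdef sum_divide_distrib using v_nonzero
    by (intro sum.cong) (auto simp: power_diff divide_inverse power_inverse mult_ac)
  also have "\<dots> = lead_coeff p + (\<Sum>i<degree p. coeff p i * inverse v ^ (degree p - i))"
    by (simp add: lessThan_Suc_atMost[symmetric])
  finally show ?thesis using assms
    by (auto simp: polys_over_def intro!: P_sum P_mult' K_R P_power inverse_v_P)
qed

text \<open>Equality of orders at infinity, expressed by a unit instead of a value group. As
  \<open>w\<close> has a pole there, \<open>w ^ q - w\<close> is \<open>w ^ q\<close> times a unit,
  while \<open>poly h v\<close> is \<open>v ^ n\<close> times a unit.\<close>

lemma unit_relation: obtains e where "e \<in> R" "inverse e \<in> R" "e \<noteq> 0" "w ^ q = e * v ^ n"
proof -
  define h0 where "h0 = poly h v / v ^ n"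
  have "lead_coeff h \<noteq> 0" "lead_coeff h \<in> K"
    using n_pos h_over by (auto simp: polys_over_def)
  then have h0: "h0 \<in> R" "h0 \<noteq> 0" "inverse h0 \<in> R"
    using unit_of_residue[OF lead_term[OF h_over]] unfolding h0_def by auto
  have "w \<notin> R"
  proof
    assume "w \<in> R"
    then have "poly h v \<in> R" using equation[symmetric] subring_R by (auto intro!: subring_intros)
    then have "poly h v * inverse h0 \<in> R" using h0 subring_R by (auto intro!: subring_intros)
    moreover have "poly h v * inverse h0 = v ^ n" using h0(2) unfolding h0_def by auto
    ultimately have "inverse v ^ n * v ^ n \<noteq> 1"
      using P_no_inverse[OF P_power[OF inverse_v_P n_pos]] by metis
    then show False using v_nonzero by (simp flip: power_mult_distrib)
  qed
  then have iw: "inverse w \<in> P" and w0: "w \<noteq> 0"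
    using F_mem inverse_in_P subring_zero[OF subring_R] by auto
  define d where "d = 1 - inverse w ^ (q - 1)"
  have "- (inverse w ^ (q - 1)) \<in> P" using iw q_ge_2 by (intro P_uminus P_power) auto
  then have "d - 1 \<in> P" unfolding d_def by simp
  then have d: "d \<in> R" "d \<noteq> 0" "inverse d \<in> R"
    using unit_of_residue[of d 1] subring_K subring_one by auto
  have "w ^ q * d = w ^ q - w"
  proof -
    have "w ^ q = w * w ^ (q - 1)" using q_ge_2 by (simp flip: power_Suc)
    then show ?thesis unfolding d_def using w0 by (simp add: algebra_simps power_inverse)
  qed
  then have "w ^ q * d = h0 * v ^ n" using equation v_nonzero by (simp add: h0_def)
  then have "w ^ q = (h0 * inverse d) * v ^ n" using d(2) by (simp add: field_simps)
  moreover have "inverse (h0 * inverse d) = d * inverse h0" using h0 d by simp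
  ultimately show thesis using h0 d subring_R by (intro that[of "h0 * inverse d"])
      (auto intro: subring_mult)
qed

lemma w_nonzero: "w \<noteq> 0"
proof
  assume "w = 0"
  obtain e where "e \<noteq> 0" "w ^ q = e * v ^ n" using unit_relation by blast
  then show False using \<open>w = 0\<close> v_nonzero q_ge_2 by (auto simp: power_0_left split: if_splits)
qed

text \<open>The order of \<open>w\<close> is known only through \<open>w ^ q\<close>. The power
  \<open>q\<close> of the ratio is a unit times a positive power of
  \<open>inverse v\<close>.\<close>

lemma monomial_ratio:
  assumes "q * i' + n * j' < q * i + n * j"
  shows "(v ^ i' * w ^ j') / (v ^ i * w ^ j) \<in> P"
proof -
  obtain e where e: "e \<in> R" "inverse e \<in> R" "e \<noteq> 0" "w ^ q = e * v ^ n" using unit_relation .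
  have pow: "(v ^ i * w ^ j) ^ q = e ^ j * v ^ (q * i + n * j)" for i j
  proof -
    have "(v ^ i * w ^ j) ^ q = v ^ (q * i) * (w ^ q) ^ j"
      by (simp add: power_mult_distrib flip: power_mult) (simp add: mult.commute)
    then show ?thesis unfolding e(4) by (simp add: power_mult_distrib power_add flip: power_mult)
  qed
  have split: "v ^ (q * i + n * j) = v ^ (q * i' + n * j') * v ^ (q * i + n * j - (q * i' + n * j'))"
    using assms by (simp flip: power_add)
  have "((v ^ i' * w ^ j') / (v ^ i * w ^ j)) ^ q
      = e ^ j' * inverse e ^ j * inverse v ^ (q * i + n * j - (q * i' + n * j'))"
    unfolding power_divide pow split using v_nonzero e(3) by (simp add: field_simps)
  also have "\<dots> \<in> P"
    using assms e(1,2) subring_R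
    by (intro P_mult' P_power inverse_v_P subring_mult subring_power) auto
  finally have "((v ^ i' * w ^ j') / (v ^ i * w ^ j)) ^ q \<in> P" .
  moreover have "(v ^ i' * w ^ j') / (v ^ i * w ^ j) \<in> F"
    using F_mem subring_F by (intro subfield_divide subfield_adjoin subring_mult subring_power) auto
  ultimately show ?thesis using P_of_power by blast
qed

end

text \<open>Since \<open>w ^ q\<close> has the order of \<open>v ^ n\<close> at infinity and \<open>n\<close> is coprime to \<open>q\<close>, the monomials
  \<open>v ^ i * w ^ j\<close> with \<open>j < q\<close> have different orders there.\<close>

lemma dominating_term:
  assumes p: "\<And>j. p j \<in> polys_over K" and ex: "\<exists>j<q. p j \<noteq> 0"
  obtains i j c where "c \<in> K" "c \<noteq> 0" "j < q"
    "\<And>R. at_infinity R \<Longrightarrow> rep p v w / (v ^ i * w ^ j) - c \<in> nonunits R"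
proof -
  define J where "J = {j. j < q \<and> p j \<noteq> 0}"
  define wt where "wt j = q * degree (p j) + n * j" for j
  have "finite J" "J \<noteq> {}" using ex unfolding J_def by auto
  then obtain j where j: "j \<in> J" "\<And>j'. j' \<in> J \<Longrightarrow> wt j' \<le> wt j"
    using obtains_MAX by (metis Max_ge finite_imageI image_eqI)
  have less: "wt j' < wt j" if "j' \<in> J" "j' \<noteq> j" for j'
  proof -
    have "wt j' \<noteq> wt j"
      using weights_distinct(1)[OF coprime_deg, of j j' "degree (p j)" "degree (p j')"] j(1) that
      unfolding wt_def J_def by auto
    then show ?thesis using j(2)[OF that(1)] by simp
  qed
  have "rep p v w / (v ^ degree (p j) * w ^ j) - lead_coeff (p j) \<in> nonunits R" if R: "at_infinity R" for R
  proof -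
    interpret vring K F R
      using R by (rule at_infinity_vring)
    define M where "M j = v ^ degree (p j) * w ^ j" for j
    have M0: "M j \<noteq> 0" for j using v_nonzero w_nonzero[OF R] unfolding M_def by simp
    have summand: "poly (p j') v * w ^ j' / M j = (poly (p j') v / v ^ degree (p j')) * (M j' / M j)" for j'
      using M0 v_nonzero unfolding M_def by (simp add: field_simps)
    have "rep p v w = (\<Sum>j'\<in>J. poly (p j') v * w ^ j')"
      unfolding rep_def J_def by (rule sum.mono_neutral_right) auto
    also have "\<dots> = poly (p j) v * w ^ j + (\<Sum>j'\<in>J - {j}. poly (p j') v * w ^ j')"
      using \<open>finite J\<close> j(1) by (rule sum.remove)
    finally have "rep p v w / M j - lead_coeff (p j) = (poly (p j) v / v ^ degree (p j) - lead_coeff (p j))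
        + (\<Sum>j'\<in>J - {j}. (poly (p j') v / v ^ degree (p j')) * (M j' / M j))"
      using M0 v_nonzero by (simp add: add_divide_distrib sum_divide_distrib summand)
    also have "\<dots> \<in> P"
    proof (intro P_add P_sum lead_term[OF R p] P_mult')
      fix j' assume "j' \<in> J - {j}"
      then show "M j' / M j \<in> P" using monomial_ratio[OF R] less unfolding M_def wt_def by blast
      have "(poly (p j') v / v ^ degree (p j') - lead_coeff (p j')) + lead_coeff (p j') \<in> R"
        using lead_term[OF R p] p unfolding polys_over_def
        by (intro subring_add subring_R P_R K_R) auto
      then show "poly (p j') v / v ^ degree (p j') \<in> R" by simp
    qed
    finally show ?thesis unfolding M_def .
  qed
  then show thesis using j(1) p unfolding J_def polys_over_def
    by (intro that[of "lead_coeff (p j)" j "degree (p j)"]) auto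
qed

text \<open>Divided by its dominating monomial, a nonzero combination has a nonzero residue at
  infinity. The existence of a place there thus yields the independence of the powers of
  \<open>w\<close>, in lieu of the irreducibility of the equation.\<close>

lemma rep_eq_0:
  assumes "\<And>j. p j \<in> polys_over K" "rep p v w = 0" "j < q"
  shows "p j = 0"
proof (rule ccontr)
  assume "p j \<noteq> 0"
  then obtain i j c where c: "c \<in> K" "c \<noteq> 0"
    "\<And>R. at_infinity R \<Longrightarrow> rep p v w / (v ^ i * w ^ j) - c \<in> nonunits R"
    using dominating_term[of p] assms by metis
  obtain R where R: "at_infinity R" using at_infinity_exists by blast
  interpret vring K F R
    using R by (rule at_infinity_vring)
  have "- c \<in> P" using c(3)[OF R] assms(2) by simp
  then show False using c P_K[of "- c"] subring_K subring_uminus by auto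
qed

end


section \<open>Values on the coordinate ring and uniqueness of the place at infinity\<close>

context one_infinite_place
begin

definition pairs :: "'f \<Rightarrow> 'f \<Rightarrow> nat \<Rightarrow> ('f \<times> 'f) set" where
  "pairs a b N = {(rep p v w, rep p a b) | p. \<forall>j. p j \<in> polys_below K N}"

text \<open>The element \<open>x\<close> of \<open>K[v, w]\<close> takes the value \<open>y\<close> at the point \<open>(a, b)\<close>. That \<open>y\<close> is determined by
  \<open>x\<close> follows from the linear independence of the \<open>v ^ i * w ^ j\<close>, \<open>j < q\<close>.\<close>

definition evaluates :: "'f \<Rightarrow> 'f \<Rightarrow> 'f \<Rightarrow> 'f \<Rightarrow> bool" where
  "evaluates a b x y \<longleftrightarrow> (\<exists>N. (x, y) \<in> pairs a b N)"

text \<open>Products must be reduced by the equation, so multiplicativity of values is not visible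
  on coefficients. Multipliers are closed under sums and products by their very form, which leaves
  constants, \<open>v\<close> and \<open>w\<close> to check. That \<open>D\<close> is uniform in
  \<open>N\<close> serves the later counting argument.\<close>

definition multiplier :: "'f \<Rightarrow> 'f \<Rightarrow> 'f \<Rightarrow> 'f \<Rightarrow> bool" where
  "multiplier a b x' y' \<longleftrightarrow>
     (\<exists>D. \<forall>N x y. (x, y) \<in> pairs a b N \<longrightarrow> (x' * x, y' * y) \<in> pairs a b (N + D))"

lemma rep_add: "rep (\<lambda>j. p j + p' j) a b = rep p a b + rep p' a b"
  unfolding rep_def by (simp add: algebra_simps sum.distrib)

lemma rep_diff: "rep (\<lambda>j. p j - p' j) a b = rep p a b - rep p' a b"
  unfolding rep_def by (simp add: algebra_simps sum_subtractf)

lemma rep_smult: "rep (\<lambda>j. smult c (p j)) a b = c * rep p a b"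
  unfolding rep_def by (simp add: sum_distrib_left mult.assoc)

lemma pairs_mono: "(x, y) \<in> pairs a b N \<Longrightarrow> N \<le> M \<Longrightarrow> (x, y) \<in> pairs a b M"
  unfolding pairs_def using polys_below_mono by blast

lemma pairs_add:
  assumes "(x, y) \<in> pairs a b N" "(x', y') \<in> pairs a b N"
  shows "(x + x', y + y') \<in> pairs a b N"
proof -
  obtain p p' where "\<forall>j. p j \<in> polys_below K N" "\<forall>j. p' j \<in> polys_below K N"
    "x = rep p v w" "y = rep p a b" "x' = rep p' v w" "y' = rep p' a b"
    using assms unfolding pairs_def by blast
  then show ?thesis unfolding pairs_def using polys_below_add[OF subring_K]
    by (auto simp flip: rep_add intro!: exI[of _ "\<lambda>j. p j + p' j"])
qed

lemma multiplier_add: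
  assumes "multiplier a b x y" "multiplier a b x' y'"
  shows "multiplier a b (x + x') (y + y')"
proof -
  obtain D D' where
    D: "\<And>N u u'. (u, u') \<in> pairs a b N \<Longrightarrow> (x * u, y * u') \<in> pairs a b (N + D)" and
    D': "\<And>N u u'. (u, u') \<in> pairs a b N \<Longrightarrow> (x' * u, y' * u') \<in> pairs a b (N + D')"
    using assms unfolding multiplier_def by metis
  have "((x + x') * u, (y + y') * u') \<in> pairs a b (N + (D + D'))" if "(u, u') \<in> pairs a b N" for N u u'
    using pairs_add[OF pairs_mono[OF D[OF that]] pairs_mono[OF D'[OF that]], of "N + (D + D')"]
    by (simp add: algebra_simps)
  then show ?thesis unfolding multiplier_def by blast
qed

lemma multiplier_mult:
  assumes "multiplier a b x y" "multiplier a b x' y'"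
  shows "multiplier a b (x * x') (y * y')"
proof -
  obtain D D' where
    D: "\<And>N u u'. (u, u') \<in> pairs a b N \<Longrightarrow> (x * u, y * u') \<in> pairs a b (N + D)" and
    D': "\<And>N u u'. (u, u') \<in> pairs a b N \<Longrightarrow> (x' * u, y' * u') \<in> pairs a b (N + D')"
    using assms unfolding multiplier_def by metis
  have "((x * x') * u, (y * y') * u') \<in> pairs a b (N + (D' + D))" if "(u, u') \<in> pairs a b N" for N u u'
    using D[OF D'[OF that]] by (simp add: mult.assoc add.assoc)
  then show ?thesis unfolding multiplier_def by blast
qed

lemma multiplier_const: assumes "c \<in> K" shows "multiplier a b c c"
  unfolding multiplier_def
proof (rule exI[of _ 0], intro allI impI)
  fix N x y assume "(x, y) \<in> pairs a b N"
  then obtain p where "\<forall>j. p j \<in> polys_below K N" "x = rep p v w" "y = rep p a b"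
    unfolding pairs_def by blast
  then show "(c * x, c * y) \<in> pairs a b (N + 0)"
    unfolding pairs_def using polys_below_smult[OF subring_K assms]
    by (auto simp flip: rep_smult intro!: exI[of _ "\<lambda>j. smult c (p j)"])
qed

lemma multiplier_v: "multiplier a b v a"
  unfolding multiplier_def
proof (rule exI[of _ 1], intro allI impI)
  fix N x y assume "(x, y) \<in> pairs a b N"
  then obtain p where p: "\<forall>j. p j \<in> polys_below K N" "x = rep p v w" "y = rep p a b"
    unfolding pairs_def by blast
  have "rep (\<lambda>j. pCons 0 (p j)) a b = a * rep p a b" for a b
    unfolding rep_def by (simp add: sum_distrib_left mult.assoc)
  then show "(v * x, a * y) \<in> pairs a b (N + 1)"
    unfolding pairs_def p(2,3) using p(1) polys_below_pCons[OF subring_zero[OF subring_K]]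
    by (auto intro!: exI[of _ "\<lambda>j. pCons 0 (p j)"])
qed

lemma multiplier_w: assumes "b ^ q - b = poly h a" shows "multiplier a b w b"
  unfolding multiplier_def
proof (rule exI[of _ n], intro allI impI)
  fix N x y assume "(x, y) \<in> pairs a b N"
  then obtain p where p: "\<forall>j. p j \<in> polys_below K N" "x = rep p v w" "y = rep p a b"
    unfolding pairs_def by blast
  obtain Q where Q: "q = Suc Q" "Q > 0" using q_ge_2 by (cases q) auto
  \<comment> \<open>Multiplication by \<open>w\<close> shifts the coefficients, and the overflow
    \<open>p Q * w ^ q\<close> is replaced by \<open>p Q * (h + w)\<close>, which feeds the
    coefficients 0 and 1. The same \<open>p'\<close> is right at \<open>(a, b)\<close>, since the
    point satisfies the equation.\<close>
  define p' where "p' = (\<lambda>j. if j = 0 then p Q * h else p (j - 1) + (if j = 1 then p Q else 0))"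
  have first: "(\<Sum>j<q. f j) = f 0 + (\<Sum>j<Q. f (Suc j))" for f :: "nat \<Rightarrow> 'f"
    unfolding Q(1) by (rule sum.lessThan_Suc_shift)
  have last: "(\<Sum>j<q. f j) = (\<Sum>j<Q. f j) + f Q" for f :: "nat \<Rightarrow> 'f"
    unfolding Q(1) by simp
  have rep': "rep p' a b = b * rep p a b" if ab: "b ^ q - b = poly h a" for a b
  proof -
    have h: "poly h a = b * b ^ Q - b" using ab Q(1) by simp
    have "(\<Sum>j<Q. poly (p' (Suc j)) a * b ^ Suc j)
        = (\<Sum>j<Q. poly (p j) a * b ^ Suc j + (if j = 0 then poly (p Q) a * b else 0))"
      unfolding p'_def by (intro sum.cong) (auto simp: algebra_simps)
    then have "rep p' a b = poly (p Q) a * poly h a + (\<Sum>j<Q. poly (p j) a * b ^ Suc j)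
        + (\<Sum>j<Q. if j = 0 then poly (p Q) a * b else 0)"
      unfolding rep_def first by (simp add: p'_def sum.distrib)
    also have "(\<Sum>j<Q. if j = 0 then poly (p Q) a * b else 0) = poly (p Q) a * b"
      using Q(2) by (subst sum.delta) auto
    also have "poly (p Q) a * poly h a + (\<Sum>j<Q. poly (p j) a * b ^ Suc j) + poly (p Q) a * b
        = b * rep p a b"
      unfolding rep_def last h by (simp add: algebra_simps sum_distrib_left)
    finally show ?thesis .
  qed
  have "p' j \<in> polys_below K (N + n)" for j
  proof -
    have 0: "0 \<in> polys_below K (N + n)"
      using subring_zero[OF subring_K] by (auto simp: polys_below_def)
    have "p i \<in> polys_below K (N + n)" for i using p(1) polys_below_mono[of "p i" K N] by simp
    then show ?thesis unfolding p'_def using p(1) 0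
      by (auto intro!: polys_below_add polys_below_mult subring_K h_over)
  qed
  then show "(w * x, b * y) \<in> pairs a b (N + n)"
    unfolding pairs_def p(2,3) using rep'[OF assms] rep'[OF equation]
    by (auto intro!: exI[of _ p'])
qed

context
  fixes a b assumes ab: "b ^ q - b = poly h a"
begin

lemma multiplier_poly: "p \<in> polys_over K \<Longrightarrow> multiplier a b (poly p v) (poly p a)"
proof (induction p)
  case 0
  show ?case using multiplier_const[OF subring_zero[OF subring_K]] by simp
next
  case (pCons c p)
  then have "c \<in> K" "p \<in> polys_over K" by (simp_all add: pCons_over_iff)
  then show ?case using pCons
    by (auto intro!: multiplier_add multiplier_mult multiplier_const multiplier_v)
qed

lemma multiplier_power: "multiplier a b x y \<Longrightarrow> multiplier a b (x ^ i) (y ^ i)"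
  using multiplier_const[OF subring_one[OF subring_K]]
  by (induction i) (auto intro: multiplier_mult)

lemma multiplier_sum: "(\<And>i. i \<in> I \<Longrightarrow> multiplier a b (f i) (g i)) \<Longrightarrow> multiplier a b (sum f I) (sum g I)"
  using multiplier_const[OF subring_zero[OF subring_K]]
  by (induction I rule: infinite_finite_induct) (auto intro: multiplier_add)

lemma one_pairs: "(1, 1) \<in> pairs a b 1"
proof -
  have "(\<Sum>j<q. poly (if j = 0 then 1 else 0) a * b ^ j) = (\<Sum>j<q. if j = 0 then 1 else 0)" for a b :: 'f
    by (rule sum.cong) auto
  then have "rep (\<lambda>j. if j = 0 then 1 else 0) a b = 1" for a b
    unfolding rep_def using q_ge_2 by (simp add: sum.delta)
  then show ?thesis
    unfolding pairs_def using subring_zero[OF subring_K] subring_one[OF subring_K]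
    by (auto simp: polys_below_def coeff_1 intro!: exI[of _ "\<lambda>j. if j = 0 then 1 else 0"])
qed

text \<open>Applying a multiplier to the pair \<open>(1, 1)\<close> gives the value back, so values
  inherit the ring laws of multipliers.\<close>

lemma evaluates_iff_multiplier: "evaluates a b x y \<longleftrightarrow> multiplier a b x y"
proof
  assume "evaluates a b x y"
  then obtain N p where p: "\<forall>j. p j \<in> polys_below K N" "x = rep p v w" "y = rep p a b"
    unfolding evaluates_def pairs_def by blast
  show "multiplier a b x y"
    unfolding p(2,3) rep_def using p(1) polys_below_over
    by (intro multiplier_sum multiplier_mult multiplier_poly multiplier_power multiplier_w ab) blast
next
  assume "multiplier a b x y"
  then show "evaluates a b x y"
    using one_pairs unfolding evaluates_def multiplier_def by fastforce
qed

lemma evaluates_mult: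
  "evaluates a b x y \<Longrightarrow> evaluates a b x' y' \<Longrightarrow> evaluates a b (x * x') (y * y')"
  by (simp add: evaluates_iff_multiplier multiplier_mult)

lemma evaluates_add:
  "evaluates a b x y \<Longrightarrow> evaluates a b x' y' \<Longrightarrow> evaluates a b (x + x') (y + y')"
  by (simp add: evaluates_iff_multiplier multiplier_add)

lemma evaluates_const: "c \<in> K \<Longrightarrow> evaluates a b c c"
  by (simp add: evaluates_iff_multiplier multiplier_const)

lemma evaluates_diff:
  assumes "evaluates a b x y" "evaluates a b x' y'" shows "evaluates a b (x - x') (y - y')"
proof -
  have "- 1 \<in> K" using subring_K by (simp add: subring_one subring_uminus)
  then have "evaluates a b (x + (- 1) * x') (y + (- 1) * y')"
    using assms by (intro evaluates_add evaluates_mult evaluates_const)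
  then show ?thesis by simp
qed

lemma evaluates_poly: "p \<in> polys_over K \<Longrightarrow> evaluates a b (poly p v) (poly p a)"
  by (simp add: evaluates_iff_multiplier multiplier_poly)

lemma evaluates_v: "evaluates a b v a"
  by (simp add: evaluates_iff_multiplier multiplier_v)

lemma evaluates_w: "evaluates a b w b"
  by (simp add: evaluates_iff_multiplier multiplier_w ab)

lemma evaluates_power: "evaluates a b x y \<Longrightarrow> evaluates a b (x ^ i) (y ^ i)"
  by (simp add: evaluates_iff_multiplier multiplier_power)

lemma evaluates_sum: "(\<And>i. i \<in> I \<Longrightarrow> evaluates a b (f i) (g i)) \<Longrightarrow> evaluates a b (sum f I) (sum g I)"
  by (simp add: evaluates_iff_multiplier multiplier_sum)

lemma evaluates_0: assumes "evaluates a b 0 y" shows "y = 0"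
proof -
  obtain N p where p: "\<forall>j. p j \<in> polys_below K N" "0 = rep p v w" "y = rep p a b"
    using assms unfolding evaluates_def pairs_def by blast
  then have "p j = 0" if "j < q" for j using rep_eq_0[of p j] polys_below_over that by metis
  then show "y = 0" unfolding p(3) rep_def by simp
qed

end

definition coord_ring :: "'f set" where
  "coord_ring = {rep p v w | p. \<exists>N. \<forall>j. p j \<in> polys_below K N}"

lemma coord_ring_iff: "x \<in> coord_ring \<longleftrightarrow> (\<exists>y. evaluates a b x y)"
  unfolding coord_ring_def evaluates_def pairs_def by blast

lemma subring_coord_ring: "is_subring coord_ring"
  unfolding is_subring_def
proof (intro conjI ballI)
  show "1 \<in> coord_ring"
    using evaluates_const[OF equation subring_one[OF subring_K]] coord_ring_iff by blast
  fix x y assume "x \<in> coord_ring" "y \<in> coord_ring"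
  then obtain x' y' where "evaluates v w x x'" "evaluates v w y y'" using coord_ring_iff by blast
  then show "x - y \<in> coord_ring" "x * y \<in> coord_ring"
    using evaluates_diff[OF equation] evaluates_mult[OF equation] coord_ring_iff[of _ v w]
    by blast+
qed

text \<open>Multiplication by \<open>x\<close> raises the degrees of the coefficients by a bounded amount, so that
  some multiple of \<open>x\<close> has only a constant coefficient by the pigeonhole principle.\<close>

lemma multiple_in_polynomials:
  assumes "x \<in> coord_ring" "x \<noteq> 0"
  obtains x' p where "x' \<in> coord_ring" "p \<in> polys_over K" "p \<noteq> 0" "x * x' = poly p v"
proof -
  obtain y where "evaluates v w x y" using assms(1) coord_ring_iff by blast
  then obtain D where D: "\<And>N u u'. (u, u') \<in> pairs v w N \<Longrightarrow> (x * u, y * u') \<in> pairs v w (N + D)"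
    unfolding evaluates_iff_multiplier[OF equation] multiplier_def by blast
  \<comment> \<open>Chosen so that \<open>(N + D) * (q - 1) < N * q\<close>: the
    \<open>q - 1\<close> higher coefficients of a product admit fewer choices than the
    \<open>q\<close> coefficients of the factor.\<close>
  define N where "N = (q - 1) * D + 1"
  define A where "A = (\<Pi>\<^sub>E j\<in>{..<q}. polys_below K N)"
  define B where "B = (\<Pi>\<^sub>E j\<in>{1..<q}. polys_below K (N + D))"
  \<comment> \<open>Members of \<open>A\<close> are \<open>undefined\<close> from index
    \<open>q\<close> on; \<open>ext\<close> puts 0 there, so that every coefficient meets the degree
    bound.\<close>
  define ext where "ext u j = (if j < q then u j else 0)" for u :: "nat \<Rightarrow> 'f poly" and j
  note card_below = card_polys_below[OF subring_K finite_K]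
  have zero_below: "0 \<in> polys_below K N" for N
    using subring_zero[OF subring_K] by (simp add: polys_below_def)
  have ext: "\<forall>j. ext u j \<in> polys_below K N" if "u \<in> A" for u
    using that zero_below unfolding ext_def A_def by auto
  have "\<exists>u'. (\<forall>j. u' j \<in> polys_below K (N + D)) \<and> x * rep (ext u) v w = rep u' v w" if "u \<in> A" for u
  proof -
    have "(rep (ext u) v w, rep (ext u) v w) \<in> pairs v w N" using ext[OF that] unfolding pairs_def by blast
    from D[OF this] show ?thesis unfolding pairs_def by blast
  qed
  then obtain f where f: "\<And>u j. u \<in> A \<Longrightarrow> f u j \<in> polys_below K (N + D)"
      "\<And>u. u \<in> A \<Longrightarrow> x * rep (ext u) v w = rep (f u) v w" by metis
  have "card K \<ge> 2"
  proof -
    have "{0, 1} \<subseteq> K" using subring_K by (simp add: subring_zero subring_one)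
    from card_mono[OF finite_K this] show ?thesis by simp
  qed
  have "card B = card K ^ ((N + D) * (q - 1))"
    unfolding B_def by (simp add: card_PiE card_below power_mult)
  also have "\<dots> < card K ^ (N * q)"
  proof (rule power_strict_increasing)
    have "N * q = N * (q - 1) + N" using q_ge_2 by (simp add: algebra_simps)
    then show "(N + D) * (q - 1) < N * q" unfolding N_def by (simp add: algebra_simps)
  qed (use \<open>card K \<ge> 2\<close> in simp)
  also have "\<dots> = card A" unfolding A_def by (simp add: card_PiE card_below power_mult)
  finally have "card B < card A" .
  moreover have "(\<lambda>u. restrict (f u) {1..<q}) ` A \<subseteq> B" unfolding B_def using f(1) by auto
  moreover have "finite B" unfolding B_def by (intro finite_PiE) (auto simp: card_below)
  ultimately have "\<not> inj_on (\<lambda>u. restrict (f u) {1..<q}) A"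
    using card_inj_on_le leD by blast
  then obtain u1 u2 where u: "u1 \<in> A" "u2 \<in> A" "u1 \<noteq> u2"
    "restrict (f u1) {1..<q} = restrict (f u2) {1..<q}" unfolding inj_on_def by blast
  define d where "d j = ext u1 j - ext u2 j" for j
  define p where "p = f u1 0 - f u2 0"
  have d_below: "d j \<in> polys_below K N" for j
    unfolding d_def using ext u polys_below_diff[OF subring_K] by blast
  have "\<exists>j<q. d j \<noteq> 0"
  proof (rule ccontr)
    assume "\<not> (\<exists>j<q. d j \<noteq> 0)"
    then have "u1 j = u2 j" if "j < q" for j using that unfolding d_def ext_def by auto
    then have "u1 = u2" using u(1,2) unfolding A_def by (intro PiE_ext) auto
    then show False using u(3) by simp
  qed
  then have d_nonzero: "rep d v w \<noteq> 0" using rep_eq_0[of d] d_below polys_below_over by blast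
  have "x * rep d v w = rep (\<lambda>j. f u1 j - f u2 j) v w"
    unfolding d_def rep_diff using f(2)[OF u(1)] f(2)[OF u(2)] by (simp add: algebra_simps)
  also have "\<dots> = (\<Sum>j<q. if j = 0 then poly p v else 0)"
    unfolding rep_def
  proof (rule sum.cong)
    fix j assume j: "j \<in> {..<q}"
    show "poly (f u1 j - f u2 j) v * w ^ j = (if j = 0 then poly p v else 0)"
    proof (cases "j = 0")
      case False
      then have "f u1 j = f u2 j" using j fun_cong[OF u(4), of j] by auto
      then show ?thesis using False by simp
    qed (simp add: p_def)
  qed simp
  also have "\<dots> = poly p v" using q_ge_2 by (simp add: sum.delta)
  finally have eq: "x * rep d v w = poly p v" .
  moreover have "p \<in> polys_over K"
    unfolding p_def using f(1)[OF u(1)] f(1)[OF u(2)] polys_below_diff[OF subring_K] polys_below_over by blast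
  moreover have "p \<noteq> 0" using eq d_nonzero assms(2) by auto
  moreover have "rep d v w \<in> coord_ring" unfolding coord_ring_def using d_below by blast
  ultimately show thesis using that by blast
qed

lemma F_fractions:
  assumes "z \<in> F"
  obtains x x' where "x \<in> coord_ring" "x' \<in> coord_ring" "x' \<noteq> 0" "z = x / x'"
proof -
  define L where "L = {x / x' | x x'. x \<in> coord_ring \<and> x' \<in> coord_ring \<and> x' \<noteq> 0}"
  have LI: "x / x' \<in> L" if "x \<in> coord_ring" "x' \<in> coord_ring" "x' \<noteq> 0" for x x'
    using that unfolding L_def by blast
  note A = subring_coord_ring
  have A_L: "x \<in> L" if "x \<in> coord_ring" for x
    using LI[OF that subring_one[OF A]] by simp
  have "is_subfield L"
    unfolding is_subfield_def is_subring_def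
  proof (intro conjI ballI)
    show "1 \<in> L" using A_L subring_one[OF A] by blast
    fix z z' assume "z \<in> L" "z' \<in> L"
    then obtain x x' y y' where z: "x \<in> coord_ring" "x' \<in> coord_ring" "x' \<noteq> 0" "z = x / x'"
      and z': "y \<in> coord_ring" "y' \<in> coord_ring" "y' \<noteq> 0" "z' = y / y'" unfolding L_def by blast
    have "z - z' = (x * y' - y * x') / (x' * y')" using z z' by (simp add: field_simps)
    then show "z - z' \<in> L" using z z' by (auto intro!: LI subring_diff subring_mult A)
    have "z * z' = (x * y) / (x' * y')" using z z' by simp
    then show "z * z' \<in> L" using z z' by (auto intro!: LI subring_mult A)
  next
    fix z assume "z \<in> L"
    then obtain x x' where z: "x \<in> coord_ring" "x' \<in> coord_ring" "x' \<noteq> 0" "z = x / x'"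
      unfolding L_def by blast
    show "inverse z \<in> L"
    proof (cases "x = 0")
      case True then show ?thesis using A_L subring_zero[OF A] z by simp
    next
      case False then show ?thesis using LI z by simp
    qed
  qed
  moreover have "K \<subseteq> L" "{v, w} \<subseteq> L"
    using A_L coord_ring_iff[of _ v w] evaluates_const[OF equation] evaluates_v[OF equation]
      evaluates_w[OF equation] by blast+
  ultimately have "F \<subseteq> L" by (intro adjoin_subset)
  then show thesis using assms that unfolding L_def by blast
qed

lemma coord_ring_F: "x \<in> coord_ring \<Longrightarrow> x \<in> F"
  unfolding coord_ring_def rep_def polys_below_def using F_mem subring_F
  by (auto simp: poly_altdef intro!: subring_sum subring_mult subring_power)

text \<open>What matters is that the answer does not depend on \<open>R\<close>: \<open>z\<close> is
  a quotient of elements with dominating monomials, whose weights decide between zero, pole and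
  nonzero constant residue. Uniqueness and rationality of the place both follow.\<close>

lemma infinity_dichotomy:
  assumes "z \<in> F"
  shows "(\<exists>c\<in>K. \<forall>R. at_infinity R \<longrightarrow> z - c \<in> nonunits R) \<or>
    (\<forall>R. at_infinity R \<longrightarrow> z \<notin> R)"
proof (cases "z = 0")
  case True
  then show ?thesis
    using subring_zero[OF subring_K] vring.zero_in_P[of K F] subfield_K subfield_adjoin
    unfolding at_infinity_def vring_def by (intro disjI1 bexI[of _ 0]) auto
next
  case False
  obtain x x' where xx: "x \<in> coord_ring" "x' \<in> coord_ring" "x' \<noteq> 0" "z = x / x'"
    using F_fractions[OF assms] .
  have dom: "\<exists>i j c. c \<in> K \<and> c \<noteq> 0 \<and> j < q \<and>
      (\<forall>R. at_infinity R \<longrightarrow> x / (v ^ i * w ^ j) - c \<in> nonunits R)"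
    if x: "x \<in> coord_ring" "x \<noteq> 0" for x
  proof -
    obtain p N where p: "x = rep p v w" "\<And>j. p j \<in> polys_below K N"
      using x unfolding coord_ring_def by blast
    have "\<exists>j<q. p j \<noteq> 0"
    proof (rule ccontr)
      assume "\<not> (\<exists>j<q. p j \<noteq> 0)"
      then show False using x(2) unfolding p(1) rep_def by simp
    qed
    from dominating_term[OF polys_below_over[OF p(2)] this] show ?thesis unfolding p(1) by metis
  qed
  have "x \<noteq> 0" using xx False by auto
  from dom[OF xx(1) \<open>x \<noteq> 0\<close>] obtain i j c where c: "c \<in> K" "c \<noteq> 0" "j < q"
    "\<And>R. at_infinity R \<Longrightarrow> x / (v ^ i * w ^ j) - c \<in> nonunits R" by blast
  from dom[OF xx(2,3)] obtain i' j' c' where c': "c' \<in> K" "c' \<noteq> 0" "j' < q"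
    "\<And>R. at_infinity R \<Longrightarrow> x' / (v ^ i' * w ^ j') - c' \<in> nonunits R" by blast
  define M M' where "M = v ^ i * w ^ j" and "M' = v ^ i' * w ^ j'"
  obtain R0 where R0: "at_infinity R0" using at_infinity_exists by blast
  have M0: "M \<noteq> 0" "M' \<noteq> 0" unfolding M_def M'_def using v_nonzero w_nonzero[OF R0] by auto
  have z_eq: "z = (x / M) * inverse (x' / M') * (M / M')" using M0 xx by (simp add: field_simps)
  have units: "x / M \<in> R \<and> inverse (x / M) \<in> R \<and> x' / M' \<in> R \<and> inverse (x' / M') \<in> R"
    if R: "at_infinity R" for R
  proof -
    interpret vring K F R
      using R by (rule at_infinity_vring)
    show ?thesis using unit_of_residue[OF c(4)[OF R] c(1,2)] unit_of_residue[OF c'(4)[OF R] c'(1,2)]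
      unfolding M_def M'_def by auto
  qed
  consider (less) "q * i + n * j < q * i' + n * j'" | (gr) "q * i' + n * j' < q * i + n * j"
    | (eq) "q * i + n * j = q * i' + n * j'" by linarith
  then show ?thesis
  proof cases
    case less
    have "z \<in> nonunits R" if R: "at_infinity R" for R
    proof -
      interpret vring K F R
        using R by (rule at_infinity_vring)
      have "M / M' \<in> P" using monomial_ratio[OF R less] unfolding M_def M'_def .
      then show ?thesis unfolding z_eq using units[OF R]
        by (intro P_mult' subring_mult subring_R) auto
    qed
    then show ?thesis using subring_zero[OF subring_K] by (intro disjI1 bexI[of _ 0]) auto
  next
    case gr
    have "z \<notin> R" if R: "at_infinity R" for R
    proof -
      interpret vring K F R
        using R by (rule at_infinity_vring)
      have "inverse z = (x' / M') * inverse (x / M) * (M' / M)"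
        using M0 \<open>x \<noteq> 0\<close> by (simp add: xx(4) field_simps)
      also have "M' / M \<in> P" using monomial_ratio[OF R gr] unfolding M_def M'_def .
      then have "(x' / M') * inverse (x / M) * (M' / M) \<in> P" using units[OF R]
        by (intro P_mult' subring_mult subring_R) auto
      finally have "inverse z \<in> P" .
      from P_no_inverse[OF this, of z] show ?thesis using False by auto
    qed
    then show ?thesis by blast
  next
    case eq
    then have "M = M'" using weights_distinct[OF coprime_deg c(3) c'(3) eq] unfolding M_def M'_def by simp
    have "z - c / c' \<in> nonunits R" if R: "at_infinity R" for R
    proof -
      interpret vring K F R
        using R by (rule at_infinity_vring)
      have "z - c / c' = (x / M - c) * inverse (x' / M') - (c / c') * inverse (x' / M') * (x' / M' - c')"
        unfolding xx(4) using \<open>M = M'\<close> M0 xx(3) c'(2) by (simp add: field_simps)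
      also have "\<dots> \<in> P"
      proof (rule P_diff)
        show "(x / M - c) * inverse (x' / M') \<in> P"
          using c(4)[OF R] units[OF R] unfolding M_def by (intro P_mult) auto
        show "(c / c') * inverse (x' / M') * (x' / M' - c') \<in> P"
        proof (intro P_mult' subring_mult subring_R)
          show "c / c' \<in> R" using c(1) c'(1) by (intro K_R subfield_divide subfield_K)
        qed (use c'(4)[OF R] units[OF R] in \<open>auto simp: M'_def\<close>)
      qed
      finally show ?thesis .
    qed
    moreover have "c / c' \<in> K" using c(1) c'(1) by (intro subfield_divide subfield_K)
    ultimately show ?thesis by blast
  qed
qed

lemma at_infinity_unique: "\<exists>!R. at_infinity R"
  and at_infinity_rational: "at_infinity R \<Longrightarrow> \<forall>z\<in>R. \<exists>c\<in>K. z - c \<in> nonunits R"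
proof -
  have mem: "z \<in> R \<longleftrightarrow> z \<in> F \<and> (\<exists>c\<in>K. \<forall>R. at_infinity R \<longrightarrow> z - c \<in> nonunits R)"
    if R: "at_infinity R" for R z
  proof -
    interpret vring K F R
      using R by (rule at_infinity_vring)
    have "z \<in> R" if "c \<in> K" "z - c \<in> P" for c
      using subring_add[OF subring_R P_R[OF that(2)] K_R[OF that(1)]] by simp
    then show ?thesis using infinity_dichotomy[of z] R R_F by blast
  qed
  then have "R = R'" if "at_infinity R" "at_infinity R'" for R R' using that by blast
  then show "\<exists>!R. at_infinity R" using at_infinity_exists by blast
  show "at_infinity R \<Longrightarrow> \<forall>z\<in>R. \<exists>c\<in>K. z - c \<in> nonunits R" using mem by blast
qed

end


section \<open>Local rings at the affine points\<close>

lemma synthetic_div_over: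
  assumes "is_subring K" "a \<in> K" "p \<in> polys_over K"
  shows "poly p a \<in> K \<and> synthetic_div p a \<in> polys_over K"
  using assms(3)
proof (induction p)
  case 0
  then show ?case by simp (simp add: polys_over_def)
next
  case (pCons c p)
  then have c: "c \<in> K" "p \<in> polys_over K" by (simp_all add: pCons_over_iff)
  then have IH: "poly p a \<in> K" "synthetic_div p a \<in> polys_over K" using pCons.IH by auto
  then show ?case using c assms
    by (auto simp: polys_over_def coeff_pCons intro!: subring_add subring_mult split: nat.splits)
qed

lemma poly_diff_multiple: "poly p v - poly p a = (v - a) * poly (synthetic_div p a) v"
  for v a :: "'a::comm_ring_1"
proof -
  have "poly ([:- a, 1:] * synthetic_div p a + [:poly p a:]) v = poly p v"
    by (simp only: synthetic_div_correct')
  then show ?thesis by (simp add: algebra_simps)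
qed

context one_infinite_place
begin

text \<open>The coordinate ring is generated by the constants, \<open>v\<close> and
  \<open>w\<close>, so facts such as membership of values in \<open>K\<close> or divisibility by
  \<open>v - a\<close> need to be checked on generators only.\<close>

lemma evaluates_induct [consumes 2, case_names const v w add mult]:
  assumes "b ^ q - b = poly h a" "evaluates a b x y"
    and const: "\<And>c. c \<in> K \<Longrightarrow> Q c c" and v: "Q v a" and w: "Q w b"
    and add: "\<And>x y x' y'. Q x y \<Longrightarrow> Q x' y' \<Longrightarrow> Q (x + x') (y + y')"
    and mult: "\<And>x y x' y'. Q x y \<Longrightarrow> Q x' y' \<Longrightarrow> Q (x * x') (y * y')"
  shows "Q x y"
proof -
  obtain N p where p: "\<forall>j. p j \<in> polys_below K N" "x = rep p v w" "y = rep p a b"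
    using assms(2) unfolding evaluates_def pairs_def by blast
  have poly: "Q (poly p v) (poly p a)" if "p \<in> polys_over K" for p
    using that
  proof (induction p)
    case 0
    show ?case using const[OF subring_zero[OF subring_K]] by simp
  next
    case (pCons c p)
    then have "c \<in> K" "p \<in> polys_over K" by (simp_all add: pCons_over_iff)
    then show ?case using pCons by (auto intro!: add mult const v)
  qed
  have pow: "Q (w ^ i) (b ^ i)" for i
    by (induction i) (auto intro!: mult w const[OF subring_one[OF subring_K]])
  have sum: "(\<And>i. i \<in> I \<Longrightarrow> Q (f i) (g i)) \<Longrightarrow> Q (sum f I) (sum g I)" for f g and I :: "nat set"
    by (induction I rule: infinite_finite_induct)
       (auto intro!: add const[OF subring_zero[OF subring_K]])
  show ?thesis unfolding p(2,3) rep_def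
    using p(1) polys_below_over by (intro sum mult poly pow) blast
qed

definition local_value :: "'f \<Rightarrow> 'f \<Rightarrow> 'f \<Rightarrow> 'f \<Rightarrow> bool" where
  "local_value a b z c \<longleftrightarrow>
     (\<exists>x y x' y'. evaluates a b x y \<and> evaluates a b x' y' \<and> y' \<noteq> 0 \<and> z = x / x' \<and> c = y / y')"

definition local_ring :: "'f \<Rightarrow> 'f \<Rightarrow> 'f set" where
  "local_ring a b = {z. \<exists>c. local_value a b z c}"

context
  fixes a b assumes a: "a \<in> K" and b: "b \<in> K" and ab: "b ^ q - b = poly h a"
begin

lemma evaluates_in_K: "evaluates a b x y \<Longrightarrow> y \<in> K"
  using ab by (induction x y rule: evaluates_induct)
    (auto simp: a b intro: subring_add subring_mult subring_K)

lemma local_valueE: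
  assumes "local_value a b z c"
  obtains x y x' y' where "evaluates a b x y" "evaluates a b x' y'" "y' \<noteq> 0" "x' \<noteq> 0"
    "z = x / x'" "c = y / y'"
  using assms evaluates_0[OF ab] unfolding local_value_def by blast

lemma local_valueI:
  "evaluates a b x y \<Longrightarrow> evaluates a b x' y' \<Longrightarrow> y' \<noteq> 0 \<Longrightarrow> local_value a b (x / x') (y / y')"
  unfolding local_value_def by blast

lemma local_value_of: "evaluates a b x y \<Longrightarrow> local_value a b x y"
  using local_valueI[OF _ evaluates_const[OF ab subring_one[OF subring_K]]] by fastforce

lemma local_value_in_K: "local_value a b z c \<Longrightarrow> c \<in> K"
  using evaluates_in_K by (elim local_valueE) (auto intro!: subfield_divide subfield_K)

lemma local_value_diff:
  assumes "local_value a b z c" "local_value a b z' c'" shows "local_value a b (z - z') (c - c')"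
proof -
  from assms(1) obtain x y x' y' where 1: "evaluates a b x y" "evaluates a b x' y'" "y' \<noteq> 0" "x' \<noteq> 0"
    "z = x / x'" "c = y / y'" by (rule local_valueE)
  from assms(2) obtain r s r' s' where 2: "evaluates a b r s" "evaluates a b r' s'" "s' \<noteq> 0" "r' \<noteq> 0"
    "z' = r / r'" "c' = s / s'" by (rule local_valueE)
  have "local_value a b ((x * r' - r * x') / (x' * r')) ((y * s' - s * y') / (y' * s'))"
    using 1 2 by (intro local_valueI evaluates_diff evaluates_mult ab) auto
  then show ?thesis using 1 2 by (simp add: diff_frac_eq)
qed

lemma local_value_mult:
  assumes "local_value a b z c" "local_value a b z' c'" shows "local_value a b (z * z') (c * c')"
proof -
  from assms(1) obtain x y x' y' where 1: "evaluates a b x y" "evaluates a b x' y'" "y' \<noteq> 0" "x' \<noteq> 0"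
    "z = x / x'" "c = y / y'" by (rule local_valueE)
  from assms(2) obtain r s r' s' where 2: "evaluates a b r s" "evaluates a b r' s'" "s' \<noteq> 0" "r' \<noteq> 0"
    "z' = r / r'" "c' = s / s'" by (rule local_valueE)
  have "local_value a b ((x * r) / (x' * r')) ((y * s) / (y' * s'))"
    using 1 2 by (intro local_valueI evaluates_mult ab) auto
  then show ?thesis using 1 2 by simp
qed

lemma local_value_inverse:
  assumes "local_value a b z c" "c \<noteq> 0" shows "local_value a b (inverse z) (inverse c)"
proof -
  from assms(1) obtain x y x' y' where 1: "evaluates a b x y" "evaluates a b x' y'" "y' \<noteq> 0" "x' \<noteq> 0"
    "z = x / x'" "c = y / y'" by (rule local_valueE)
  then have "local_value a b (x' / x) (y' / y)" using assms(2) by (intro local_valueI) auto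
  then show ?thesis using 1 by simp
qed

lemma local_value_unique:
  assumes "local_value a b z c" "local_value a b z c'" shows "c = c'"
proof -
  have "local_value a b 0 (c - c')" using local_value_diff[OF assms] by simp
  then obtain x y x' y' where 1: "evaluates a b x y" "evaluates a b x' y'" "y' \<noteq> 0" "x' \<noteq> 0"
    "0 = x / x'" "c - c' = y / y'" by (rule local_valueE)
  then have "y = 0" using evaluates_0[OF ab, of y] by simp
  then show ?thesis using 1 by simp
qed

lemma local_value_const: "c \<in> K \<Longrightarrow> local_value a b c c"
  by (intro local_value_of evaluates_const ab)

lemma local_value_add:
  assumes "local_value a b z c" "local_value a b z' c'" shows "local_value a b (z + z') (c + c')"
  using local_value_diff[OF assms(1) local_value_diff[OF local_value_const[OF subring_zero] assms(2)]]
    subring_K by simp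

lemma local_value_power: "local_value a b z c \<Longrightarrow> local_value a b (z ^ k) (c ^ k)"
  using local_value_const[OF subring_one[OF subring_K]]
  by (induction k) (auto intro: local_value_mult)

lemma v_not_const: "v \<notin> K"
proof
  assume "v \<in> K"
  then have "[:- v, 1:] \<in> polys_over K" using subring_K
    by (auto simp: polys_over_def coeff_pCons subring_zero subring_one subring_uminus split: nat.splits)
  then have "[:- v, 1:] = 0" by (rule poly_v_eq_0) simp
  then show False by simp
qed

lemma t_nonzero: "v - a \<noteq> 0"
  using v_not_const a by auto

lemma local_value_t: "local_value a b (v - a) 0"
  using local_value_diff[OF local_value_of[OF evaluates_v[OF ab]] local_value_const[OF a]] by simp

lemma local_value_w: "local_value a b (w - b) 0"
  using local_value_diff[OF local_value_of[OF evaluates_w[OF ab]] local_value_const[OF b]] by simp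

text \<open>At the point \<open>(a, b)\<close> the derivative of the equation with respect to \<open>w\<close> is \<open>- 1\<close>, so that
  \<open>v - a\<close> generates the maximal ideal.\<close>

lemma w_multiple_of_t: obtains z c where "local_value a b z c" "w - b = (v - a) * z"
proof -
  \<comment> \<open>The cofactor of \<open>w - b\<close> in \<open>w ^ q - b ^ q\<close>. Its value
    at the point is \<open>q * b ^ (q - 1) = 0\<close>, so \<open>S - 1\<close> is a unit
    there.\<close>
  define S where "S = (\<Sum>i<q. b ^ (q - Suc i) * w ^ i)"
  define H where "H = poly (synthetic_div h a) v"
  have "evaluates a b S (\<Sum>i<q. b ^ (q - Suc i) * b ^ i)"
    unfolding S_def by (intro evaluates_sum evaluates_mult evaluates_power evaluates_w
        evaluates_const ab b)
  also have "(\<Sum>i<q. b ^ (q - Suc i) * b ^ i) = (\<Sum>i<q. b ^ (q - 1))"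
    by (intro sum.cong) (auto simp flip: power_add)
  also have "\<dots> = 0" using char_dvd_q by simp
  finally have E: "evaluates a b (S - 1) (- 1)"
    using evaluates_diff[OF ab _ evaluates_const[OF ab subring_one[OF subring_K]]] by fastforce
  have "(w - b) * (S - 1) = (w ^ q - w) - (b ^ q - b)"
    using power_diff_sumr2[of w q b] unfolding S_def by (simp add: right_diff_distrib)
  also have "\<dots> = (v - a) * H"
    unfolding equation ab H_def by (rule poly_diff_multiple)
  finally have eq: "(w - b) * (S - 1) = (v - a) * H" .
  have "evaluates a b H (poly (synthetic_div h a) a)"
    unfolding H_def using synthetic_div_over[OF subring_K a h_over] by (intro evaluates_poly ab) blast
  then have "local_value a b (H / (S - 1)) (poly (synthetic_div h a) a / - 1)"
    using E by (intro local_valueI) auto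
  moreover have "S - 1 \<noteq> 0" using E evaluates_0[OF ab, of "- 1"] by auto
  then have "w - b = (v - a) * (H / (S - 1))" using eq by (simp add: field_simps)
  ultimately show thesis using that by blast
qed

text \<open>Every evaluation pair has \<open>x - y\<close> divisible by \<open>v - a\<close>: this
  holds for the generators, and passes to products by
  \<open>x * x' - y * y' = x * (x' - y') + (x - y) * y'\<close>. A fraction with value 0 has a
  numerator with \<open>y = 0\<close>.\<close>

lemma maximal_ideal_principal:
  assumes "local_value a b z 0" obtains z' c' where "local_value a b z' c'" "z = (v - a) * z'"
proof -
  obtain u d where u: "local_value a b u d" "w - b = (v - a) * u" using w_multiple_of_t by blast
  have *: "local_value a b x y \<and> y \<in> K \<and> (\<exists>z c. local_value a b z c \<and> x - y = (v - a) * z)"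
    if "evaluates a b x y" for x y
    using ab that
  proof (induction x y rule: evaluates_induct)
    case (const c)
    then show ?case using local_value_const[OF subring_zero[OF subring_K]] local_value_const by force
  next
    case v
    show ?case using local_value_const[OF subring_one[OF subring_K]] a
        local_value_of[OF evaluates_v[OF ab]] by force
  next
    case w
    then show ?case using u b local_value_of[OF evaluates_w[OF ab]] by blast
  next
    case (add x y x' y')
    then obtain z c z' c' where *: "local_value a b z c" "x - y = (v - a) * z"
      "local_value a b z' c'" "x' - y' = (v - a) * z'" by blast
    then have "(x + x') - (y + y') = (v - a) * (z + z')" by (simp add: algebra_simps)
    then show ?case using local_value_add[OF *(1,3)] local_value_add add subring_add[OF subring_K] by blast
  next
    case (mult x y x' y')
    then obtain z c z' c' where *: "local_value a b z c" "x - y = (v - a) * z"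
      "local_value a b z' c'" "x' - y' = (v - a) * z'" by blast
    have "x * x' - y * y' = x * (x' - y') + (x - y) * y'" by (simp add: algebra_simps)
    also have "\<dots> = (v - a) * (x * z' + z * y')" unfolding * by (simp add: algebra_simps)
    finally have "x * x' - y * y' = (v - a) * (x * z' + z * y')" .
    moreover have "local_value a b (x * z' + z * y') (y * c' + c * y')"
      using * mult by (intro local_value_add local_value_mult local_value_const) auto
    ultimately show ?case using local_value_mult mult subring_mult[OF subring_K] by blast
  qed
  from assms obtain x y x' y' where 1: "evaluates a b x y" "evaluates a b x' y'" "y' \<noteq> 0" "x' \<noteq> 0"
    "z = x / x'" "0 = y / y'" by (rule local_valueE)
  then obtain r s where r: "local_value a b r s" "x = (v - a) * r" using *[of x y] by force
  have "local_value a b (r * inverse x') (s * inverse y')"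
    using local_value_mult[OF r(1) local_value_inverse[OF local_value_of[OF 1(2)] 1(3)]] .
  moreover have "z = (v - a) * (r * inverse x')" using 1 r by (simp add: divide_inverse)
  ultimately show thesis using that by blast
qed

text \<open>The cofactor \<open>e\<close> ensures that the factors \<open>v - a\<close> of
  \<open>f\<close> run out: each one split off from \<open>f\<close> or \<open>e\<close> is also
  split off from \<open>p\<close>, whose degree drops. This takes the place of a Noetherian
  argument.\<close>

lemma power_of_t_times_unit:
  assumes "p \<in> polys_over K" "p \<noteq> 0" "local_value a b f c" "local_value a b e d" "f * e = poly p v"
  shows "\<exists>k g c'. local_value a b g c' \<and> c' \<noteq> 0 \<and> f = (v - a) ^ k * g"
  using assms
proof (induction "degree p" arbitrary: p f c e d rule: less_induct)
  case less
  have "local_value a b (poly p v) (c * d)" using local_value_mult[OF less(4,5)] less(6) by simp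
  then have cd: "c * d = poly p a"
    using local_value_unique local_value_of[OF evaluates_poly[OF ab less(2)]] by blast
  show ?case
  proof (cases "c = 0 \<or> d = 0")
    case False
    then have "local_value a b f c \<and> c \<noteq> 0 \<and> f = (v - a) ^ 0 * f" using less by simp
    then show ?thesis by blast
  next
    case True
    define p1 where "p1 = synthetic_div p a"
    have p1: "p1 \<in> polys_over K"
      unfolding p1_def using synthetic_div_over[OF subring_K a less(2)] by blast
    have pv: "poly p v = (v - a) * poly p1 v"
      using poly_diff_multiple[of p v a] cd True unfolding p1_def by auto
    have "p1 \<noteq> 0" using pv poly_v_eq_0[OF less(2)] less(3) by auto
    have "degree p \<noteq> 0"
    proof
      assume "degree p = 0"
      then show False using cd True less(3) by (auto elim!: degree_eq_zeroE)
    qed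
    then have deg: "degree p1 < degree p" unfolding p1_def by (simp add: degree_synthetic_div)
    show ?thesis
    proof (cases "c = 0")
      case True
      then obtain f1 c1 where f1: "local_value a b f1 c1" "f = (v - a) * f1"
        using maximal_ideal_principal less(4) by blast
      then have "f1 * e = poly p1 v" using less(6) pv t_nonzero by simp
      from less(1)[OF deg p1 \<open>p1 \<noteq> 0\<close> f1(1) less(5) this] obtain k g c'
        where "local_value a b g c'" "c' \<noteq> 0" "f1 = (v - a) ^ k * g" by blast
      then have "local_value a b g c' \<and> c' \<noteq> 0 \<and> f = (v - a) ^ Suc k * g" using f1 by simp
      then show ?thesis by blast
    next
      case False
      then obtain e1 d1 where e1: "local_value a b e1 d1" "e = (v - a) * e1"
        using maximal_ideal_principal less(5) \<open>c = 0 \<or> d = 0\<close> by blast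
      then have "f * e1 = poly p1 v" using less(6) pv t_nonzero by simp
      from less(1)[OF deg p1 \<open>p1 \<noteq> 0\<close> less(4) e1(1) this] show ?thesis .
    qed
  qed
qed

lemma coord_ring_power_of_t:
  assumes "x \<in> coord_ring" "x \<noteq> 0"
  shows "\<exists>k g c. local_value a b g c \<and> c \<noteq> 0 \<and> x = (v - a) ^ k * g"
proof -
  obtain x' p where x': "x' \<in> coord_ring" "p \<in> polys_over K" "p \<noteq> 0" "x * x' = poly p v"
    using multiple_in_polynomials[OF assms] .
  obtain c d where "evaluates a b x c" "evaluates a b x' d"
    using assms x' coord_ring_iff[of _ a b] by blast
  then show ?thesis using power_of_t_times_unit[OF x'(2,3) _ _ x'(4)] local_value_of by blast
qed

lemma local_ring_or_inverse:
  assumes "z \<in> F" "z \<noteq> 0" shows "z \<in> local_ring a b \<or> inverse z \<in> local_ring a b"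
proof -
  obtain x x' where x: "x \<in> coord_ring" "x' \<in> coord_ring" "x' \<noteq> 0" "z = x / x'"
    using F_fractions[OF assms(1)] .
  then have "x \<noteq> 0" using assms by auto
  obtain k g c where g: "local_value a b g c" "c \<noteq> 0" "x = (v - a) ^ k * g"
    using coord_ring_power_of_t[OF x(1) \<open>x \<noteq> 0\<close>] by blast
  obtain k' g' c' where g': "local_value a b g' c'" "c' \<noteq> 0" "x' = (v - a) ^ k' * g'"
    using coord_ring_power_of_t[OF x(2,3)] by blast
  have nz: "g \<noteq> 0" "g' \<noteq> 0" using g g' \<open>x \<noteq> 0\<close> x by auto
  have "(v - a) ^ k / (v - a) ^ k' = (v - a) ^ (k - k') \<or> (v - a) ^ k' / (v - a) ^ k = (v - a) ^ (k' - k)"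
    using t_nonzero by (metis nle_le power_diff)
  then show ?thesis
  proof
    assume "(v - a) ^ k / (v - a) ^ k' = (v - a) ^ (k - k')"
    then have "z = (v - a) ^ (k - k') * (g * inverse g')"
      unfolding x g(3) g'(3) by (simp add: divide_inverse mult_ac)
    moreover have "local_value a b ((v - a) ^ (k - k') * (g * inverse g')) (0 ^ (k - k') * (c * inverse c'))"
      using g g' by (intro local_value_mult local_value_power local_value_inverse local_value_t)
    ultimately show ?thesis unfolding local_ring_def by (metis mem_Collect_eq)
  next
    assume "(v - a) ^ k' / (v - a) ^ k = (v - a) ^ (k' - k)"
    then have "inverse z = (v - a) ^ (k' - k) * (g' * inverse g)"
      unfolding x g(3) g'(3) by (simp add: divide_inverse mult_ac)
    moreover have "local_value a b ((v - a) ^ (k' - k) * (g' * inverse g)) (0 ^ (k' - k) * (c' * inverse c))"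
      using g g' by (intro local_value_mult local_value_power local_value_inverse local_value_t)
    ultimately show ?thesis unfolding local_ring_def by (metis mem_Collect_eq)
  qed
qed

lemma valuation_ring_local_ring: "valuation_ring K F (local_ring a b)"
  unfolding valuation_ring_def
proof (intro conjI ballI impI)
  show "is_subring (local_ring a b)"
    unfolding is_subring_def local_ring_def
    using local_value_diff local_value_mult local_value_const[OF subring_one[OF subring_K]] by blast
  have "v \<in> local_ring a b" using local_value_of[OF evaluates_v[OF ab]] unfolding local_ring_def by blast
  moreover have "K \<subseteq> local_ring a b" using local_value_const unfolding local_ring_def by blast
  ultimately show "K \<subset> local_ring a b" using v_not_const by blast
  have "local_ring a b \<subseteq> F"
  proof
    fix z assume "z \<in> local_ring a b"
    then obtain c where "local_value a b z c" unfolding local_ring_def by blast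
    then show "z \<in> F"
      using coord_ring_F coord_ring_iff[of _ a b]
      by (elim local_valueE) (auto intro!: subfield_divide subfield_adjoin)
  qed
  moreover have "inverse (v - a) \<in> F"
    using F_mem a subring_F by (intro subfield_inverse subfield_adjoin subring_diff) auto
  moreover have "inverse (v - a) \<notin> local_ring a b"
  proof
    assume "inverse (v - a) \<in> local_ring a b"
    then obtain c where "local_value a b (inverse (v - a)) c" unfolding local_ring_def by blast
    from local_value_mult[OF local_value_t this] have "local_value a b 1 0" using t_nonzero by simp
    then show False using local_value_unique local_value_const[OF subring_one[OF subring_K]] by fastforce
  qed
  ultimately show "local_ring a b \<subset> F" by blast
qed (rule local_ring_or_inverse)

lemma nonunits_local_ring: "nonunits (local_ring a b) = {z. local_value a b z 0}"
proof (intro equalityI subsetI CollectI)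
  fix z assume z: "z \<in> nonunits (local_ring a b)"
  then obtain c where c: "local_value a b z c" unfolding nonunits_iff local_ring_def by blast
  show "local_value a b z 0"
  proof (cases "c = 0 \<or> z = 0")
    case False
    then have "inverse z \<in> local_ring a b" using local_value_inverse[OF c] unfolding local_ring_def by blast
    then show ?thesis using z False by (auto simp: nonunits_iff)
  qed (use c local_value_const[OF subring_zero[OF subring_K]] in auto)
next
  fix z assume "z \<in> {z. local_value a b z 0}"
  then have z: "local_value a b z 0" by simp
  have "inverse z \<notin> local_ring a b" if "z \<noteq> 0"
  proof
    assume "inverse z \<in> local_ring a b"
    then obtain c where "local_value a b (inverse z) c" unfolding local_ring_def by blast
    from local_value_mult[OF z this] have "local_value a b 1 0" using that by simp
    then show False using local_value_unique local_value_const[OF subring_one[OF subring_K]] by fastforce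
  qed
  then show "z \<in> nonunits (local_ring a b)" using z by (auto simp: nonunits_iff local_ring_def)
qed

lemma local_ring_rational: "\<forall>z\<in>local_ring a b. \<exists>c\<in>K. z - c \<in> nonunits (local_ring a b)"
proof
  fix z assume "z \<in> local_ring a b"
  then obtain c where c: "local_value a b z c" unfolding local_ring_def by blast
  have "local_value a b (z - c) 0"
    using local_value_diff[OF c local_value_const[OF local_value_in_K[OF c]]] by simp
  then show "\<exists>c\<in>K. z - c \<in> nonunits (local_ring a b)"
    using local_value_in_K[OF c] unfolding nonunits_local_ring by blast
qed

text \<open>The residues of \<open>v\<close> and \<open>w\<close> fix those of the whole local ring,
  so it lies in \<open>R\<close> and its maximal ideal in that of \<open>R\<close>. As a valuation
  ring it cannot be smaller: an element of \<open>R\<close> outside it would be the inverse of an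
  element of the maximal ideal of \<open>R\<close>.\<close>

lemma local_ring_unique:
  assumes R: "valuation_ring K F R" and "v - a \<in> nonunits R" "w - b \<in> nonunits R"
  shows "R = local_ring a b"
proof -
  interpret vring K F R using R subfield_K subfield_adjoin by unfold_locales
  have ev: "x - y \<in> P \<and> y \<in> K" if "evaluates a b x y" for x y
    using ab that
  proof (induction x y rule: evaluates_induct)
    case (add x y x' y')
    then show ?case using residue_add[of x y x' y'] subring_add[OF subring_K] by blast
  next
    case (mult x y x' y')
    then show ?case using residue_mult[of x y x' y'] subring_mult[OF subring_K] by blast
  qed (use assms a b zero_in_P in auto)
  have sub: "z - c \<in> P" "z \<in> R" if lv: "local_value a b z c" for z c
  proof -
    from lv obtain x y x' y' where 1: "evaluates a b x y" "evaluates a b x' y'" "y' \<noteq> 0" "x' \<noteq> 0"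
      "z = x / x'" "c = y / y'" by (rule local_valueE)
    have ix: "inverse x' \<in> R" using unit_of_residue[of x' y'] ev[OF 1(2)] 1(3) by auto
    have iy: "inverse y' \<in> K" using ev[OF 1(2)] by (intro subfield_inverse subfield_K) auto
    have "- ((inverse x' * inverse y') * (x' - y')) \<in> P"
      using P_uminus P_mult'[OF subring_mult[OF subring_R ix K_R[OF iy]]] ev[OF 1(2)] by blast
    also have "- ((inverse x' * inverse y') * (x' - y')) = inverse x' - inverse y'"
      using 1 by (simp add: field_simps)
    finally have "x * inverse x' - y * inverse y' \<in> P"
      using ev[OF 1(1)] iy by (intro residue_mult) auto
    then show zc: "z - c \<in> P" unfolding 1 by (simp add: divide_inverse)
    show "z \<in> R"
      using subring_add[OF subring_R P_R[OF zc] K_R[OF local_value_in_K[OF lv]]] by simp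
  qed
  show ?thesis
  proof (intro equalityI subsetI)
    fix z assume z: "z \<in> R"
    show "z \<in> local_ring a b"
    proof (rule ccontr)
      assume notin: "z \<notin> local_ring a b"
      then have "z \<noteq> 0" using local_value_const[OF subring_zero[OF subring_K]] unfolding local_ring_def by auto
      then obtain d where d: "local_value a b (inverse z) d"
        using local_ring_or_inverse[OF R_F[OF z]] notin unfolding local_ring_def by blast
      have "d = 0" using local_value_inverse[OF d] notin unfolding local_ring_def by auto
      then have "inverse z \<in> P" using sub(1)[OF d] by simp
      from P_no_inverse[OF this z] show False using \<open>z \<noteq> 0\<close> by simp
    qed
  qed (use sub in \<open>auto simp: local_ring_def\<close>)
qed

end

definition points :: "('f \<times> 'f) set" where
  "points = {(a, b). a \<in> K \<and> b \<in> K \<and> b ^ q - b = poly h a}"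

lemma finite_points: "finite points"
  by (rule finite_subset[of _ "K \<times> K"]) (auto simp: points_def finite_K)

lemma rational_affine_ring:
  assumes R: "valuation_ring K F R" and vR: "v \<in> R"
    and rational: "\<forall>z\<in>R. \<exists>c\<in>K. z - c \<in> nonunits R"
  shows "\<exists>(a, b)\<in>points. R = local_ring a b"
proof -
  interpret vring K F R using R subfield_K subfield_adjoin by unfold_locales
  have poly_R: "poly p v \<in> R" if "p \<in> polys_over K" for p
    unfolding poly_altdef using that vR K_R subring_R
    by (intro subring_sum subring_mult subring_power) (auto simp: polys_over_def)
  \<comment> \<open>\<open>w\<close> is integral over \<open>K[v]\<close>: at a pole of
    \<open>w\<close>, division of the equation by \<open>w ^ q\<close> would put \<open>1\<close>
    into \<open>P\<close>.\<close>
  have wR: "w \<in> R"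
  proof (rule ccontr)
    assume "w \<notin> R"
    then have iw: "inverse w \<in> P" and "w \<noteq> 0"
      using F_mem inverse_in_P subring_zero[OF subring_R] by auto
    have "w ^ q = w * w ^ (q - 1)" using q_ge_2 by (simp flip: power_Suc)
    then have "poly h v * inverse w ^ q = 1 - inverse w ^ (q - 1)"
      using \<open>w \<noteq> 0\<close> unfolding equation[symmetric] by (simp add: field_simps)
    then have "1 = poly h v * inverse w ^ q + inverse w ^ (q - 1)" by simp
    also have "\<dots> \<in> P" using iw poly_R[OF h_over] q_ge_2 by (intro P_add P_mult' P_power) auto
    finally show False using one_notin_P by simp
  qed
  obtain a where a: "a \<in> K" "v - a \<in> P" using rational vR by blast
  obtain b where b: "b \<in> K" "w - b \<in> P" using rational wR by blast
  have "(w ^ q - b ^ q) - (w - b) - (poly h v - poly h a) \<in> P"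
  proof (rule P_diff[OF P_diff[OF residue_power[OF b(2,1)] b(2)]])
    show "poly h v - poly h a \<in> P"
      unfolding poly_diff_multiple using a synthetic_div_over[OF subring_K a(1) h_over]
      by (intro P_mult poly_R) auto
  qed
  also have "(w ^ q - b ^ q) - (w - b) - (poly h v - poly h a) = poly h a - (b ^ q - b)"
    unfolding equation[symmetric] by simp
  finally have "poly h a - (b ^ q - b) = 0"
    using a b synthetic_div_over[OF subring_K a(1) h_over] subring_K
    by (intro P_K) (auto intro!: subring_diff subring_power)
  then have ab: "b ^ q - b = poly h a" by simp
  from local_ring_unique[OF a(1) b(1) ab R a(2) b(2)] show ?thesis
    using a b ab unfolding points_def by blast
qed

theorem card_rational_places: "card (rational_places K F) = 1 + card points"
proof -
  obtain R0 where R0: "at_infinity R0" using at_infinity_exists by blast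
  define rings where "rings = {R. valuation_ring K F R \<and> (\<forall>z\<in>R. \<exists>c\<in>K. z - c \<in> nonunits R)}"
  have "rings = insert R0 ((\<lambda>(a, b). local_ring a b) ` points)"
  proof (intro equalityI subsetI)
    fix R assume R: "R \<in> rings"
    show "R \<in> insert R0 ((\<lambda>(a, b). local_ring a b) ` points)"
    proof (cases "v \<in> R")
      case True
      then show ?thesis using rational_affine_ring[of R] R unfolding rings_def by fast
    next
      case False
      then have "at_infinity R" using R unfolding rings_def at_infinity_def by blast
      then show ?thesis using at_infinity_unique R0 by blast
    qed
  next
    fix R assume "R \<in> insert R0 ((\<lambda>(a, b). local_ring a b) ` points)"
    then show "R \<in> rings"
      using R0 at_infinity_rational valuation_ring_local_ring local_ring_rational
      unfolding rings_def points_def at_infinity_def by fast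
  qed
  moreover have "R0 \<notin> (\<lambda>(a, b). local_ring a b) ` points"
  proof
    assume "R0 \<in> (\<lambda>(a, b). local_ring a b) ` points"
    then obtain a b where "a \<in> K" "b \<in> K" "b ^ q - b = poly h a" "R0 = local_ring a b"
      unfolding points_def by blast
    then have "v \<in> R0" using local_value_of[of a b] evaluates_v[of b a] unfolding local_ring_def by blast
    then show False using R0 unfolding at_infinity_def by blast
  qed
  moreover have "inj_on (\<lambda>(a, b). local_ring a b) points"
  proof (rule inj_onI, clarify)
    fix a b a' b' assume *: "(a, b) \<in> points" "(a', b') \<in> points" "local_ring a b = local_ring a' b'"
    then have pt: "a \<in> K" "b \<in> K" "b ^ q - b = poly h a" "a' \<in> K" "b' \<in> K" "b' ^ q - b' = poly h a'"
      unfolding points_def by auto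
    interpret vring K F "local_ring a b"
      using valuation_ring_local_ring[OF pt(1-3)] subfield_K subfield_adjoin by unfold_locales
    have "v - a \<in> P" "w - b \<in> P"
      using local_value_t[OF pt(1-3)] local_value_w[OF pt(1-3)]
      unfolding nonunits_local_ring[OF pt(1-3)] by auto
    moreover have "v - a' \<in> P" "w - b' \<in> P"
      using local_value_t[OF pt(4-6)] local_value_w[OF pt(4-6)]
      unfolding *(3) nonunits_local_ring[OF pt(4-6)] by auto
    ultimately show "a = a' \<and> b = b'" using residue_unique pt by blast
  qed
  ultimately have "card rings = 1 + card points"
    using finite_points by (simp add: card_image)
  moreover have "card (rational_places K F) = card rings"
    unfolding rational_places_eq[OF subfield_K subfield_adjoin] rings_def
    by (intro card_image inj_on_subset[OF nonunits_inj_on[OF subfield_K subfield_adjoin]]) auto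
  ultimately show ?thesis by simp
qed

end


section \<open>The curve in question\<close>

text \<open>If \<open>v\<close> were algebraic, \<open>K[v]\<close> would be finite, as
  \<open>K\<close> is. Then two powers of \<open>v ^ n - v\<close> would agree, which is an
  algebraic relation for it.\<close>

lemma transcendental_descends:
  assumes K: "is_subfield K" "finite K" and x: "transcendental_over K (v ^ n - v)"
  shows "transcendental_over K v"
proof (rule ccontr)
  note subK = subfield_subring[OF K(1)]
  assume "\<not> transcendental_over K v"
  then obtain N and u :: "nat \<Rightarrow> 'a" where u: "\<forall>i\<le>N. u i \<in> K" "(\<Sum>i\<le>N. u i * v ^ i) = 0" "\<exists>i\<le>N. u i \<noteq> 0"
    unfolding transcendental_over_def by blast
  define d where "d = Max {i. i \<le> N \<and> u i \<noteq> 0}"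
  have "d \<in> {i. i \<le> N \<and> u i \<noteq> 0}" unfolding d_def using u(3) by (intro Max_in) auto
  then have d: "d \<le> N" "u d \<noteq> 0" by auto
  have above: "u i = 0" if "d < i" "i \<le> N" for i
  proof (rule ccontr)
    assume "u i \<noteq> 0"
    then have "i \<le> d" unfolding d_def using that by (intro Max_ge) auto
    then show False using that by simp
  qed
  define S where "S = (\<lambda>c. \<Sum>i<d. c i * v ^ i) ` (\<Pi>\<^sub>E i\<in>{..<d}. K)"
  have finite_S: "finite S" unfolding S_def using K(2) by (intro finite_imageI finite_PiE) auto
  have SI: "(\<Sum>i<d. c i * v ^ i) \<in> S" if "\<And>i. i < d \<Longrightarrow> c i \<in> K" for c
  proof -
    have "(\<Sum>i<d. c i * v ^ i) = (\<Sum>i<d. restrict c {..<d} i * v ^ i)" by (intro sum.cong) auto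
    then show ?thesis unfolding S_def using that by (intro image_eqI[of _ _ "restrict c {..<d}"]) auto
  qed
  have SE: "\<exists>c. (\<forall>i<d. c i \<in> K) \<and> y = (\<Sum>i<d. c i * v ^ i)" if "y \<in> S" for y
    using that unfolding S_def by auto
  have S_add: "y - z \<in> S" if yz: "y \<in> S" "z \<in> S" for y z
  proof -
    obtain c c' where "\<forall>i<d. c i \<in> K" "y = (\<Sum>i<d. c i * v ^ i)" "\<forall>i<d. c' i \<in> K"
      "z = (\<Sum>i<d. c' i * v ^ i)" using SE[OF yz(1)] SE[OF yz(2)] by blast
    then show ?thesis using SI[of "\<lambda>i. c i - c' i"] subring_diff[OF subK]
      by (simp add: sum_subtractf left_diff_distrib)
  qed
  have split: "(\<Sum>i\<le>N. u i * v ^ i) = (\<Sum>i<d. u i * v ^ i) + u d * v ^ d"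
  proof -
    have "(\<Sum>i\<le>N. u i * v ^ i) = (\<Sum>i\<le>d. u i * v ^ i)"
      using d above by (intro sum.mono_neutral_right) auto
    then show ?thesis by (simp flip: lessThan_Suc_atMost)
  qed
  then have vd: "v ^ d = (\<Sum>i<d. (- u i / u d) * v ^ i)"
    using u(2) d(2) by (simp add: field_simps sum_negf eq_neg_iff_add_eq_0 flip: sum_divide_distrib)
  have "d > 0"
  proof (rule ccontr)
    assume "\<not> d > 0"
    then show False using vd by simp
  qed
  have S_v: "v * y \<in> S" if "y \<in> S" for y
  proof -
    obtain c where c: "\<forall>i<d. c i \<in> K" "y = (\<Sum>i<d. c i * v ^ i)" using SE[OF \<open>y \<in> S\<close>] by blast
    obtain e where e: "d = Suc e" using \<open>d > 0\<close> by (cases d) auto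
    have "v * y = (\<Sum>i<d. c i * v ^ Suc i)" unfolding c(2) by (simp add: sum_distrib_left mult_ac)
    also have "\<dots> = (\<Sum>i<e. c i * v ^ Suc i) + c e * v ^ d" unfolding e by simp
    also have "(\<Sum>i<e. c i * v ^ Suc i) = (\<Sum>i<d. (case i of 0 \<Rightarrow> 0 | Suc j \<Rightarrow> c j) * v ^ i)"
      unfolding e sum.lessThan_Suc_shift by simp
    also have "\<dots> + c e * v ^ d
        = (\<Sum>i<d. ((case i of 0 \<Rightarrow> 0 | Suc j \<Rightarrow> c j) + c e * (- u i / u d)) * v ^ i)"
      unfolding vd by (simp only: distrib_right sum.distrib sum_distrib_left mult.assoc)
    also have "\<dots> \<in> S"
      using c(1) u(1) d e K by (intro SI subring_add subring_mult subring_zero subK subfield_divide)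
        (auto simp: subring_zero[OF subK] subring_uminus[OF subK] split: nat.splits)
    finally show ?thesis .
  qed
  have S_pow: "v ^ i * y \<in> S" if "y \<in> S" for i y
    by (induction i) (use that in \<open>auto simp: mult.assoc intro: S_v\<close>)
  have "(v ^ n - v) ^ i \<in> S" for i
  proof (induction i)
    case 0
    have "(\<Sum>i<d. (if i = 0 then 1 else 0) * v ^ i) = (\<Sum>i<d. if i = 0 then 1 else 0)"
      by (intro sum.cong) auto
    also have "\<dots> = 1" using \<open>d > 0\<close> by (simp add: sum.delta)
    finally show ?case
      using SI[of "\<lambda>i. if i = 0 then 1 else 0"] subring_one[OF subK] subring_zero[OF subK] by auto
  next
    case (Suc i)
    then show ?case using S_add[OF S_pow[OF Suc, of n] S_v[OF Suc]] by (simp add: left_diff_distrib)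
  qed
  then have "range (\<lambda>i. (v ^ n - v) ^ i) \<subseteq> S" by auto
  then have "finite (range (\<lambda>i. (v ^ n - v) ^ i))" using finite_S finite_subset by blast
  then have "\<not> inj (\<lambda>i. (v ^ n - v) ^ i)" using finite_imageD by blast
  then obtain i j where "i \<noteq> j" "(v ^ n - v) ^ i = (v ^ n - v) ^ j" unfolding inj_on_def by blast
  then obtain i j where ij: "i < j" "(v ^ n - v) ^ i = (v ^ n - v) ^ j"
    by (metis linorder_neqE_nat)
  define u' :: "nat \<Rightarrow> 'a" where "u' l = (if l = j then 1 else 0) - (if l = i then 1 else 0)" for l
  have "(\<Sum>l\<le>j. u' l * (v ^ n - v) ^ l)
      = (\<Sum>l\<le>j. (if l = j then (v ^ n - v) ^ l else 0) - (if l = i then (v ^ n - v) ^ l else 0))"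
    unfolding u'_def by (intro sum.cong) auto
  also have "\<dots> = 0" using ij by (simp add: sum_subtractf sum.delta)
  finally have "(\<Sum>l\<le>j. u' l * (v ^ n - v) ^ l) = 0" .
  moreover have "\<forall>l\<le>j. u' l \<in> K"
    unfolding u'_def using subring_one[OF subK] subring_zero[OF subK] subring_uminus[OF subK] by auto
  ultimately have "u' j = 0" using x unfolding transcendental_over_def by blast
  then show False using ij unfolding u'_def by simp
qed

section \<open>Frobenius on finite subfields, and the passage from places to affine points\<close>

lemma subfield_power_card:
  assumes "is_subfield L" "finite L" "x \<in> L"
  shows "x ^ card L = x"
proof (cases "x = 0")
  case True
  have "card L > 0" using assms(2,3) card_gt_0_iff by blast
  then show ?thesis using True by simp
next
  case False
  have L: "is_subring L" using assms(1) by (rule subfield_subring)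
  have "bij_betw (\<lambda>y. x * y) (L - {0}) (L - {0})"
  proof (rule bij_betwI[where g = "\<lambda>y. inverse x * y"])
    show "(\<lambda>y. inverse x * y) \<in> L - {0} \<rightarrow> L - {0}"
      using assms L False by (auto intro: subring_mult subfield_inverse)
  qed (use assms L False in \<open>auto intro: subring_mult\<close>)
  from prod.reindex_bij_betw[OF this, of "\<lambda>y. y"] have "(\<Prod>y\<in>L - {0}. x * y) = (\<Prod>y\<in>L - {0}. y)" .
  then have "x ^ card (L - {0}) * (\<Prod>y\<in>L - {0}. y) = (\<Prod>y\<in>L - {0}. y)" by (simp add: prod.distrib)
  moreover have "(\<Prod>y\<in>L - {0}. y) \<noteq> 0" using assms(2) by simp
  ultimately have "x ^ card (L - {0}) = 1" by simp
  moreover have "card L = Suc (card (L - {0}))"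
    by (rule card.remove[OF assms(2) subring_zero[OF L]])
  ultimately show ?thesis by simp
qed

lemma of_nat_card_subfield:
  fixes L :: "'f::field set"
  assumes "is_subfield L" "finite L"
  shows "of_nat (card L) = (0 :: 'f)"
proof -
  have L: "is_subring L" using assms(1) by (rule subfield_subring)
  have "bij_betw (\<lambda>x. x + 1) L L"
    by (rule bij_betwI[where g = "\<lambda>x. x - 1"])
       (use L subring_one[OF L] in \<open>auto intro: subring_add subring_diff\<close>)
  from sum.reindex_bij_betw[OF this, of "\<lambda>x. x"] have "(\<Sum>x\<in>L. x + 1) = (\<Sum>x\<in>L. x)" .
  then show ?thesis by (simp add: sum.distrib)
qed

lemma char_two:
  fixes L :: "'f::field set"
  assumes "is_subfield L" "card L = 2 ^ n" "n > 0"
  shows "(2 :: 'f) = 0"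
proof -
  have "finite L" using assms(2) by (simp add: card_ge_0_finite)
  from of_nat_card_subfield[OF assms(1) this] have "(2 :: 'f) ^ n = 0" unfolding assms(2) by simp
  then show ?thesis by simp
qed

lemma char_two_simps:
  assumes "(2 :: 'f::comm_ring_1) = 0"
  shows "x + x = (0 :: 'f)" "x - y = x + (y :: 'f)" "- x = (x :: 'f)"
proof -
  show "x + x = 0" for x :: 'f using assms by (metis mult_2 mult_zero_left)
  then show "- x = x" by (simp add: minus_unique)
  from \<open>\<And>x. x + x = 0\<close>[of y] show "x - y = x + y" by (simp add: diff_eq_eq add.assoc)
qed

lemma frobenius_add:
  assumes "(2 :: 'f::comm_ring_1) = 0"
  shows "(x + y :: 'f) ^ 2 ^ n = x ^ 2 ^ n + y ^ 2 ^ n"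
proof (induction n)
  case (Suc n)
  have sq: "(x + y) ^ 2 = x ^ 2 + y ^ 2" for x y :: 'f using assms by (simp add: power2_sum)
  have "(x + y) ^ 2 ^ Suc n = ((x + y) ^ 2 ^ n) ^ 2" by (simp add: power_mult mult.commute flip: power_mult)
  also have "\<dots> = (x ^ 2 ^ n) ^ 2 + (y ^ 2 ^ n) ^ 2" unfolding Suc by (rule sq)
  finally show ?case by (simp add: mult.commute flip: power_mult)
qed simp

lemma frobenius_sum:
  assumes "(2 :: 'f::comm_ring_1) = 0"
  shows "(sum f I :: 'f) ^ 2 ^ n = (\<Sum>i\<in>I. f i ^ 2 ^ n)"
  by (induction I rule: infinite_finite_induct) (simp_all add: frobenius_add[OF assms] zero_power)

theorem card_places_curve:
  fixes K k F :: "'f::field set"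
  assumes q: "q = 2 ^ r" "r > 0"
    and K: "is_subfield K" "finite K" and k: "is_subfield k" "card k = q" "k \<subseteq> K"
    and ab: "a \<in> k" "b \<in> k" "a \<noteq> b" and \<beta>: "\<beta> \<in> K"
    and F: "is_curve_field q K a b \<beta> F"
  shows "card (rational_places K F) =
    1 + card {(x, y). x \<in> K \<and> y \<in> K \<and> y ^ q + y = \<beta> + (x ^ q + x) ^ 3}"
proof -
  have two: "(2 :: 'f) = 0" using char_two[OF k(1)] k(2) q by simp
  note c2 = char_two_simps[OF two]
  note frob = frobenius_add[OF two, of _ _ r, folded q(1)]
  note subK = subfield_subring[OF K(1)]
  obtain x y z where x: "transcendental_over K x" and y: "y ^ q + y = x + a * (\<beta> + x ^ 3)"
    and z: "z ^ q + z = x + b * (\<beta> + x ^ 3)" and F_eq: "F = adjoin K {x, y, z}"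
    using F unfolding is_curve_field_def c2 by blast
  have fin_k: "finite k" using k K finite_subset by blast
  have fix_k: "c ^ q = c" if "c \<in> k" for c
    using subfield_power_card[OF k(1) fin_k that] k(2) by simp
  define e where "e = a + b"
  have e0: "e \<noteq> 0" using ab(3) unfolding e_def by (metis c2(2) eq_iff_diff_eq_0)
  have ek: "e \<in> k" unfolding e_def using ab k(1) by (intro subring_add subfield_subring)
  define v where "v = (b * y + a * z) / e"
  define w0 where "w0 = (y + z) / e"
  define w where "w = w0 + v ^ 3"
  have "v ^ q + v = (b * (y ^ q + y) + a * (z ^ q + z)) / e"
    unfolding v_def power_divide frob power_mult_distrib fix_k[OF ek] fix_k[OF ab(1)] fix_k[OF ab(2)]
    by (simp add: algebra_simps flip: add_divide_distrib)
  also have "b * (y ^ q + y) + a * (z ^ q + z) = e * x + (a * b * (\<beta> + x ^ 3) + a * b * (\<beta> + x ^ 3))"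
    unfolding y z e_def by (simp add: algebra_simps)
  also have "\<dots> = e * x" unfolding c2 by simp
  finally have v: "v ^ q + v = x" using e0 by simp
  have "w0 ^ q + w0 = ((y ^ q + y) + (z ^ q + z)) / e"
    unfolding w0_def power_divide frob fix_k[OF ek] by (simp add: algebra_simps flip: add_divide_distrib)
  also have "(y ^ q + y) + (z ^ q + z) = (x + x) + e * (\<beta> + x ^ 3)"
    unfolding y z e_def by (simp add: algebra_simps)
  finally have w0: "w0 ^ q + w0 = \<beta> + x ^ 3" using e0 unfolding c2 by simp
  have "a * w0 + v = ((a + b) * y + (a * z + a * z)) / e"
    unfolding w0_def v_def by (simp add: algebra_simps add_divide_distrib)
  then have y_eq: "y = a * w0 + v" unfolding c2 using e0 by (simp add: e_def)
  have "b * w0 + v = ((a + b) * z + (b * y + b * y)) / e"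
    unfolding w0_def v_def by (simp add: algebra_simps add_divide_distrib)
  then have z_eq: "z = b * w0 + v" unfolding c2 using e0 by (simp add: e_def)
  have w0_eq: "w0 = w + v ^ 3" unfolding w_def using c2(1)[of "v ^ 3"] by (simp add: add.assoc)
  text \<open>The substitution removes the terms of degree \<open>3 * q\<close> and \<open>3\<close>.\<close>
  have cube: "(t ^ q + t) ^ 3 + (t ^ 3) ^ q + t ^ 3 = t ^ (2 * q + 1) + t ^ (q + 2)" for t :: 'f
  proof -
    have "(u + t) ^ 3 + u ^ 3 + t ^ 3 = u ^ 2 * t + u * t ^ 2
        + 2 * (u ^ 3 + t ^ 3 + u ^ 2 * t + u * t ^ 2)" for u :: 'f
      by algebra
    from this[of "t ^ q"] have "(t ^ q + t) ^ 3 + (t ^ q) ^ 3 + t ^ 3 = (t ^ q) ^ 2 * t + t ^ q * t ^ 2"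
      using two by simp
    moreover have "(t ^ q) ^ 3 = (t ^ 3) ^ q" by (simp add: mult.commute flip: power_mult)
    moreover have "(t ^ q) ^ 2 * t = t ^ (2 * q + 1)"
      by (simp only: power_add mult.commute[of 2 q] power_mult power_one_right)
    moreover have "t ^ q * t ^ 2 = t ^ (q + 2)" by (simp only: power_add)
    ultimately show ?thesis by simp
  qed
  define h where "h = [:\<beta>:] + monom 1 (q + 2) + monom 1 (2 * q + 1)"
  have poly_h: "poly h t = \<beta> + t ^ (q + 2) + t ^ (2 * q + 1)" for t
    unfolding h_def by (simp add: poly_monom)
  have shift: "(u + t ^ 3) ^ q + (u + t ^ 3) = poly h t \<longleftrightarrow> u ^ q + u = \<beta> + (t ^ q + t) ^ 3" for u t
  proof -
    have "(u + t ^ 3) ^ q + (u + t ^ 3) = poly h t \<longleftrightarrow>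
      (u ^ q + u) + ((t ^ 3) ^ q + t ^ 3) = \<beta> + (t ^ (2 * q + 1) + t ^ (q + 2))"
      unfolding frob poly_h by (simp add: algebra_simps)
    also have "\<dots> \<longleftrightarrow> u ^ q + u + ((t ^ 3) ^ q + t ^ 3) = \<beta> + (t ^ q + t) ^ 3 + ((t ^ 3) ^ q + t ^ 3)"
      unfolding cube[symmetric] by (simp add: algebra_simps)
    finally show ?thesis by simp
  qed
  have q2: "q \<ge> 2" using q self_le_power[of 2 r] by simp
  have deg: "degree h = 2 * q + 1"
  proof -
    have "degree ([:\<beta>:] + monom 1 (q + 2)) < degree (monom (1 :: 'f) (2 * q + 1))"
      using q2 by (intro degree_add_less) (auto simp: degree_monom_eq)
    then show ?thesis unfolding h_def by (simp add: degree_add_eq_right degree_monom_eq)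
  qed
  interpret curve: one_infinite_place K q v w h
  proof
    show "of_nat q = (0 :: 'f)" using of_nat_card_subfield[OF k(1) fin_k] k(2) by simp
    have "transcendental_over K (v ^ q - v)" using x v unfolding c2 by simp
    then show "transcendental_over K v" using transcendental_descends K by blast
    show "h \<in> polys_over K"
      unfolding h_def polys_over_def using subK \<beta> q2
      by (auto simp: coeff_pCons split: nat.splits intro!: subring_add subring_zero subring_one)
    have "coprime (2 * q + 1) q"
      by (rule coprimeI) (metis dvd_add_right_iff dvd_mult)
    then show "coprime (degree h) q" unfolding deg .
    show "w ^ q - w = poly h v" unfolding c2 w_def using shift[of w0 v] w0 v by simp
  qed (use K q2 in auto)
  have "F = adjoin K {v, w}"
  proof
    have L: "is_subring (adjoin K {v, w})" by (rule curve.subring_F)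
    have mem: "v \<in> adjoin K {v, w}" "w \<in> adjoin K {v, w}" "K \<subseteq> adjoin K {v, w}"
      using curve.F_mem by auto
    have "x \<in> adjoin K {v, w}" unfolding v[symmetric]
      using mem L by (intro subring_add subring_power)
    moreover have "w0 \<in> adjoin K {v, w}" unfolding w0_eq
      using mem L by (intro subring_add subring_power)
    ultimately show "F \<subseteq> adjoin K {v, w}" unfolding F_eq y_eq z_eq using mem L ab k(3)
      by (intro adjoin_subset subfield_adjoin) (auto intro!: subring_add subring_mult)
    have L': "is_subring F" unfolding F_eq by (intro subfield_subring subfield_adjoin)
    have mem': "x \<in> F" "y \<in> F" "z \<in> F" "K \<subseteq> F"
      unfolding F_eq using subset_adjoin[where K = K and S = "{x, y, z}"] by auto
    have "a \<in> F" "b \<in> F" "e \<in> F" using ab ek k(3) mem' by auto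
    then have "v \<in> F" "w0 \<in> F" unfolding v_def w0_def using mem' L' unfolding F_eq
      by (auto intro!: subfield_divide subfield_adjoin subring_add subring_mult)
    moreover from this have "w \<in> F" unfolding w_def using L' by (intro subring_add subring_power)
    ultimately show "adjoin K {v, w} \<subseteq> F" using mem'(4)
      by (intro adjoin_subset) (auto simp: F_eq subfield_adjoin)
  qed
  then have "card (rational_places K F) = 1 + card curve.points"
    using curve.card_rational_places by simp
  \<comment> \<open>The points are carried back to the form with \<open>(x ^ q + x) ^ 3\<close>,
    where the quantity being cubed runs through the elements of trace zero.\<close>
  also have "card curve.points = card {(x, y). x \<in> K \<and> y \<in> K \<and> y ^ q + y = \<beta> + (x ^ q + x) ^ 3}"
  proof (rule bij_betw_same_card)
    have inv: "t ^ 3 + (u + t ^ 3) = u" "(u + t ^ 3) + t ^ 3 = u" for u t :: 'f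
      using c2(1)[of "t ^ 3"] by (simp_all add: algebra_simps)
    show "bij_betw (\<lambda>(x, y). (x, y + x ^ 3)) curve.points
        {(x, y). x \<in> K \<and> y \<in> K \<and> y ^ q + y = \<beta> + (x ^ q + x) ^ 3}"
    proof (rule bij_betwI[where g = "\<lambda>(x, y). (x, y + x ^ 3)"])
      show "(\<lambda>(x, y). (x, y + x ^ 3)) \<in> curve.points \<rightarrow>
        {(x, y). x \<in> K \<and> y \<in> K \<and> y ^ q + y = \<beta> + (x ^ q + x) ^ 3}"
        unfolding curve.points_def c2 using subK shift[of "_ + _ ^ 3"]
        by (auto simp: inv shift[symmetric] intro!: subring_add subring_power)
      show "(\<lambda>(x, y). (x, y + x ^ 3)) \<in> {(x, y). x \<in> K \<and> y \<in> K \<and> y ^ q + y = \<beta> + (x ^ q + x) ^ 3}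
        \<rightarrow> curve.points"
        unfolding curve.points_def c2 using subK shift
        by (auto intro!: subring_add subring_power)
    qed (auto simp: inv)
  qed
  finally show ?thesis .
qed


section \<open>Sums of signs over groups of exponent two\<close>

text \<open>In characteristic two each element is its own negative, so closure under addition
  already makes a subgroup.\<close>

definition add_group :: "'f::ring_1 set \<Rightarrow> bool" where
  "add_group V \<longleftrightarrow> finite V \<and> 0 \<in> V \<and> (\<forall>x\<in>V. \<forall>y\<in>V. x + y \<in> V)"

lemma add_groupD:
  assumes "add_group V"
  shows "finite V" "0 \<in> V" "x \<in> V \<Longrightarrow> y \<in> V \<Longrightarrow> x + y \<in> V"
  using assms by (auto simp: add_group_def)

context
  assumes two: "(2 :: 'f::field) = 0"
begin

private lemmas c2 = char_two_simps[OF two]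

private lemma add_add: "x + y + y = (x :: 'f)"
  by (simp add: add.assoc c2(1))

lemma shift_bij: assumes "add_group V" "u \<in> V" shows "bij_betw (\<lambda>x. x + u) V (V :: 'f set)"
  by (rule bij_betwI[where g = "\<lambda>x. x + u"]) (use assms in \<open>auto simp: add_groupD add_add\<close>)

lemma sum_shift: assumes "add_group V" "u \<in> V" shows "(\<Sum>x\<in>V. f (x + u)) = (\<Sum>x\<in>(V :: 'f set). f x)"
  using sum.reindex_bij_betw[OF shift_bij[OF assms]] .

lemma sum_character:
  fixes f :: "'f \<Rightarrow> int"
  assumes V: "add_group V" and f: "\<And>x y. x \<in> V \<Longrightarrow> y \<in> V \<Longrightarrow> f (x + y) = f x * f y"
  shows "(\<Sum>x\<in>V. f x) = (if \<forall>x\<in>V. f x = 1 then int (card V) else 0)"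
proof (cases "\<forall>x\<in>V. f x = 1")
  case False
  then obtain u where u: "u \<in> V" "f u \<noteq> 1" by blast
  have "(\<Sum>x\<in>V. f x) = (\<Sum>x\<in>V. f (x + u))" by (rule sum_shift[OF V u(1), symmetric])
  also have "\<dots> = (\<Sum>x\<in>V. f x) * f u" using f u(1) by (simp add: sum_distrib_right)
  finally show ?thesis using u(2) False by auto
qed simp

lemma card_fibre:
  fixes f :: "'f \<Rightarrow> 'f"
  assumes V: "add_group V" and f: "\<And>x y. x \<in> V \<Longrightarrow> y \<in> V \<Longrightarrow> f (x + y) = f x + f y"
    and y: "y \<in> f ` V"
  shows "card {x \<in> V. f x = y} = card {x \<in> V. f x = 0}"
proof -
  obtain u where u: "u \<in> V" "f u = y" using y by blast
  have "bij_betw (\<lambda>x. x + u) {x \<in> V. f x = y} {x \<in> V. f x = 0}"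
    by (rule bij_betwI[where g = "\<lambda>x. x + u"])
       (use u V in \<open>auto simp: add_groupD add_add f c2(1)\<close>)
  then show ?thesis by (rule bij_betw_same_card)
qed

lemma card_preimage:
  fixes f :: "'f \<Rightarrow> 'f"
  assumes V: "add_group V" and f: "\<And>x y. x \<in> V \<Longrightarrow> y \<in> V \<Longrightarrow> f (x + y) = f x + f y"
    and D: "D \<subseteq> f ` V"
  shows "card {x \<in> V. f x \<in> D} = card {x \<in> V. f x = 0} * card D"
proof -
  have fin: "finite V" using V by (rule add_groupD)
  have "{x \<in> V. f x \<in> D} = (\<Union>y\<in>D. {x \<in> V. f x = y})" by auto
  also have "card \<dots> = (\<Sum>y\<in>D. card {x \<in> V. f x = y})"
    using finite_subset[OF D] fin by (intro card_UN_disjoint) auto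
  also have "\<dots> = (\<Sum>y\<in>D. card {x \<in> V. f x = 0})"
    using card_fibre[OF V f] D by (intro sum.cong) auto
  finally show ?thesis by simp
qed

text \<open>Here \<open>g\<close> is \<open>(- 1)\<close> to the power of a quadratic form, and \<open>h\<close> that of its polar form.\<close>

lemma quadratic_sum_square:
  fixes g :: "'f \<Rightarrow> int" and h :: "'f \<Rightarrow> 'f \<Rightarrow> int"
  assumes V: "add_group V"
    and g: "\<And>x y. x \<in> V \<Longrightarrow> y \<in> V \<Longrightarrow> g (x + y) = g x * g y * h x y"
    and g_sq: "\<And>x. g x * g x = 1"
    and h: "\<And>x y z. x \<in> V \<Longrightarrow> y \<in> V \<Longrightarrow> z \<in> V \<Longrightarrow> h x (y + z) = h x y * h x z"
  shows "(\<Sum>x\<in>V. g x)\<^sup>2 = int (card V) * (\<Sum>u | u \<in> V \<and> (\<forall>y\<in>V. h u y = 1). g u)"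
proof -
  have fin: "finite V" using V by (rule add_groupD)
  have "(\<Sum>x\<in>V. g x)\<^sup>2 = (\<Sum>y\<in>V. \<Sum>x\<in>V. g y * g x)"
    by (simp add: power2_eq_square sum_product)
  \<comment> \<open>After the shift \<open>g y\<close> occurs twice and cancels, and the remaining
    sum over \<open>y\<close> is a character sum that keeps only the radical.\<close>
  also have "\<dots> = (\<Sum>y\<in>V. \<Sum>u\<in>V. g y * g (u + y))"
    by (rule sum.cong[OF refl], rule sum_shift[OF V, where f = "\<lambda>x. g _ * g x", symmetric])
  also have "\<dots> = (\<Sum>y\<in>V. \<Sum>u\<in>V. g u * h u y)"
  proof (intro sum.cong refl)
    fix y u assume "y \<in> V" "u \<in> V"
    then have "g y * g (u + y) = g u * (g y * g y) * h u y" using g by (simp add: mult_ac)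
    then show "g y * g (u + y) = g u * h u y" using g_sq by simp
  qed
  also have "\<dots> = (\<Sum>u\<in>V. \<Sum>y\<in>V. g u * h u y)" by (rule sum.swap)
  also have "\<dots> = (\<Sum>u\<in>V. g u * (if \<forall>y\<in>V. h u y = 1 then int (card V) else 0))"
    using sum_character[OF V] h by (intro sum.cong) (auto simp flip: sum_distrib_left)
  also have "\<dots> = (\<Sum>u | u \<in> V \<and> (\<forall>y\<in>V. h u y = 1). g u * int (card V))"
    using fin by (intro sum.mono_neutral_cong_right) auto
  finally show ?thesis by (simp add: sum_distrib_left mult.commute)
qed

text \<open>Averaging over the translations by \<open>U\<close> multiplies \<open>g x\<close> by a
  character of \<open>U\<close>, whose sum vanishes unless \<open>x\<close> is orthogonal to
  \<open>U\<close>.\<close>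

lemma quadratic_sum_isotropic:
  fixes g :: "'f \<Rightarrow> int" and h :: "'f \<Rightarrow> 'f \<Rightarrow> int"
  assumes V: "add_group V" and U: "add_group U" "U \<subseteq> V"
    and g: "\<And>x y. x \<in> V \<Longrightarrow> y \<in> V \<Longrightarrow> g (x + y) = g x * g y * h y x"
    and h: "\<And>x y z. x \<in> V \<Longrightarrow> y \<in> U \<Longrightarrow> z \<in> U \<Longrightarrow> h (y + z) x = h y x * h z x"
    and isotropic: "\<And>u. u \<in> U \<Longrightarrow> g u = 1"
  shows "(\<Sum>x\<in>V. g x) = (\<Sum>x | x \<in> V \<and> (\<forall>u\<in>U. h u x = 1). g x)"
proof -
  have fin: "finite V" using V by (rule add_groupD)
  have pos: "card U > 0" using add_groupD[OF U(1)] by (auto simp: card_gt_0_iff)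
  have "(\<Sum>x\<in>V. g (x + u)) = (\<Sum>x\<in>V. g x)" if "u \<in> U" for u
    using U(2) that by (intro sum_shift[OF V]) auto
  then have "int (card U) * (\<Sum>x\<in>V. g x) = (\<Sum>u\<in>U. \<Sum>x\<in>V. g (x + u))" by simp
  also have "\<dots> = (\<Sum>u\<in>U. \<Sum>x\<in>V. g x * h u x)"
    using g isotropic U(2) by (intro sum.cong) auto
  also have "\<dots> = (\<Sum>x\<in>V. \<Sum>u\<in>U. g x * h u x)" by (rule sum.swap)
  also have "\<dots> = (\<Sum>x\<in>V. g x * (if \<forall>u\<in>U. h u x = 1 then int (card U) else 0))"
    using sum_character[OF U(1), of "\<lambda>u. h u _"] h by (intro sum.cong) (auto simp flip: sum_distrib_left)
  also have "\<dots> = (\<Sum>x | x \<in> V \<and> (\<forall>u\<in>U. h u x = 1). g x * int (card U))"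
    using fin by (intro sum.mono_neutral_cong_right) auto
  also have "\<dots> = int (card U) * (\<Sum>x | x \<in> V \<and> (\<forall>u\<in>U. h u x = 1). g x)"
    by (simp add: sum_distrib_left mult.commute)
  finally show ?thesis using pos by simp
qed

end

text \<open>The orbits of a permutation of prime order \<open>p\<close> have \<open>1\<close> or \<open>p\<close> elements.\<close>

lemma sum_cong_fixed_points:
  fixes g :: "'a \<Rightarrow> int"
  assumes p: "prime p" and "finite S"
    and "\<And>x. x \<in> S \<Longrightarrow> \<sigma> x \<in> S" "\<And>x. x \<in> S \<Longrightarrow> (\<sigma> ^^ p) x = x" "\<And>x. x \<in> S \<Longrightarrow> g (\<sigma> x) = g x"
  shows "[(\<Sum>x\<in>S. g x) = (\<Sum>x | x \<in> S \<and> \<sigma> x = x. g x)] (mod int p)"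
  using assms(2-)
proof (induction S rule: finite_psubset_induct)
  case (psubset S)
  note fin = psubset.hyps
  show ?case
  proof (cases "\<forall>x\<in>S. \<sigma> x = x")
    case True
    then have "{x. x \<in> S \<and> \<sigma> x = x} = S" by auto
    then show ?thesis by simp
  next
    case False
    then obtain x where x: "x \<in> S" "\<sigma> x \<noteq> x" by blast
    have it: "(\<sigma> ^^ i) x \<in> S \<and> g ((\<sigma> ^^ i) x) = g x" for i
      using x psubset.prems by (induction i) auto
    have p_it: "(\<sigma> ^^ (p * n)) x = x" for n
      using psubset.prems(2)[OF x(1)] by (induction n) (auto simp: funpow_add)
    \<comment> \<open>\<open>d\<close> is invertible modulo the prime \<open>p\<close>, so a return
      after \<open>d\<close> steps would make \<open>x\<close> a fixed point.\<close>
    have no_return: "(\<sigma> ^^ d) x \<noteq> x" if "0 < d" "d < p" for d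
    proof
      assume ret: "(\<sigma> ^^ d) x = x"
      have ret_n: "(\<sigma> ^^ (d * n)) x = x" for n using ret by (induction n) (auto simp: funpow_add)
      have "coprime d p" using that p by (metis coprime_commute nat_dvd_not_less prime_imp_coprime)
      then obtain n where n: "[d * n = Suc 0] (mod p)" using cong_solve_coprime_nat by blast
      have "d * n mod p = 1" using n prime_gt_1_nat[OF p] by (simp add: cong_def)
      then have "d * n = 1 + p * (d * n div p)" by (metis add.commute mult_div_mod_eq)
      then have "(\<sigma> ^^ (d * n)) x = \<sigma> ((\<sigma> ^^ (p * (d * n div p))) x)"
        by (metis comp_apply funpow.simps(2) plus_1_eq_Suc)
      then show False using ret_n p_it x(2) by simp
    qed
    define O1 where "O1 = (\<lambda>i. (\<sigma> ^^ i) x) ` {..<p}"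
    have "inj_on (\<lambda>i. (\<sigma> ^^ i) x) {..<p}"
    proof (rule linorder_inj_onI')
      fix i j assume ij: "i \<in> {..<p}" "j \<in> {..<p}" "i < j"
      show "(\<sigma> ^^ i) x \<noteq> (\<sigma> ^^ j) x"
      proof
        assume eq: "(\<sigma> ^^ i) x = (\<sigma> ^^ j) x"
        have "x = (\<sigma> ^^ (p - i + i)) x" using p_it[of 1] ij by simp
        also have "\<dots> = (\<sigma> ^^ (p - i)) ((\<sigma> ^^ j) x)" by (simp only: funpow_add comp_apply eq)
        also have "\<dots> = (\<sigma> ^^ (p - i + j)) x" by (simp only: funpow_add comp_apply)
        also have "p - i + j = (j - i) + p" using ij by auto
        also have "(\<sigma> ^^ ((j - i) + p)) x = (\<sigma> ^^ (j - i)) x" using p_it[of 1] by (simp add: funpow_add)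
        finally have "(\<sigma> ^^ (j - i)) x = x" by simp
        moreover have "0 < j - i" "j - i < p" using ij by auto
        ultimately show False using no_return by blast
      qed
    qed
    then have card_O: "card O1 = p" unfolding O1_def by (simp add: card_image)
    have O_S: "O1 \<subseteq> S" unfolding O1_def using it by auto
    have "x \<in> O1" unfolding O1_def using prime_gt_0_nat[OF p] by (force intro!: image_eqI[of _ _ 0])
    have sum_O: "(\<Sum>y\<in>O1. g y) = int p * g x"
    proof -
      have "(\<Sum>y\<in>O1. g y) = (\<Sum>y\<in>O1. g x)" unfolding O1_def using it by (intro sum.cong) auto
      then show ?thesis using card_O by simp
    qed
    have \<sigma>_O: "\<sigma> y \<in> O1" if y: "y \<in> O1" for y
    proof -
      obtain i where i: "i < p" "y = (\<sigma> ^^ i) x" using y unfolding O1_def by auto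
      show ?thesis
      proof (cases "Suc i = p")
        case True
        then have "\<sigma> y = (\<sigma> ^^ p) x" unfolding i(2) by (simp flip: True)
        then show ?thesis using psubset.prems(2)[OF x(1)] \<open>x \<in> O1\<close> by simp
      next
        case False
        then have "\<sigma> y = (\<sigma> ^^ Suc i) x" "Suc i < p" using i by auto
        then show ?thesis unfolding O1_def by blast
      qed
    qed
    \<comment> \<open>The induction hypothesis needs the complement of the orbit to be stable; this
      holds because \<open>\<sigma> ^^ (p - 1)\<close> inverts \<open>\<sigma>\<close> on
      \<open>S\<close>.\<close>
    have preim: "y \<in> O1" if "y \<in> S" "\<sigma> y \<in> O1" for y
    proof -
      have "(\<sigma> ^^ n) (\<sigma> y) \<in> O1" for n using that(2) \<sigma>_O by (induction n) auto
      moreover have "(\<sigma> ^^ (p - 1)) (\<sigma> y) = (\<sigma> ^^ p) y"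
        using prime_gt_0_nat[OF p] by (metis Suc_diff_1 comp_apply funpow_Suc_right)
      ultimately show ?thesis using psubset.prems(2)[OF that(1)] by metis
    qed
    have not_fixed: "\<sigma> y \<noteq> y" if y: "y \<in> O1" for y
    proof
      assume fix_y: "\<sigma> y = y"
      obtain i where i: "i < p" "y = (\<sigma> ^^ i) x" using y unfolding O1_def by auto
      have iter_fix: "(\<sigma> ^^ n) y = y" for n using fix_y by (induction n) auto
      have "x = (\<sigma> ^^ (p - i + i)) x" using p_it[of 1] i by simp
      also have "\<dots> = (\<sigma> ^^ (p - i)) y" by (simp only: funpow_add comp_apply i)
      finally show False using iter_fix fix_y x by simp
    qed
    have "[(\<Sum>y\<in>S - O1. g y) = (\<Sum>y | y \<in> S - O1 \<and> \<sigma> y = y. g y)] (mod int p)"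
    proof (rule psubset.IH)
      show "S - O1 \<subset> S" using \<open>x \<in> O1\<close> x by blast
    qed (use psubset.prems preim in auto)
    moreover have "{y. y \<in> S - O1 \<and> \<sigma> y = y} = {y. y \<in> S \<and> \<sigma> y = y}" using not_fixed by auto
    moreover have "(\<Sum>y\<in>S. g y) = int p * g x + (\<Sum>y\<in>S - O1. g y)"
      using sum.subset_diff[OF O_S fin, of g] sum_O by simp
    ultimately show ?thesis by (simp add: cong_def)
  qed
qed

text \<open>As \<open>- 2\<close> is congruent to 1 modulo 3, so is \<open>(- 2) ^ e\<close>, while
  the other square root of \<open>4 ^ e\<close> is not.\<close>

lemma square_cong_one_mod_3:
  fixes x :: int
  assumes "x\<^sup>2 = 4 ^ e" "[x = 1] (mod 3)"
  shows "x = (- 2) ^ e"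
proof -
  have "x\<^sup>2 = ((- 2) ^ e)\<^sup>2" using assms(1) by (simp flip: power_mult) (simp add: power_mult mult.commute[of e])
  then have "x = (- 2) ^ e \<or> x = - ((- 2) ^ e)" by (simp add: power2_eq_iff)
  moreover have "[(- 2 :: int) ^ e = 1] (mod 3)" using cong_pow[of "- 2 :: int" 1 3 e] by (simp add: cong_def)
  ultimately show ?thesis using assms(2)
    by (auto simp: cong_def) presburger
qed

section \<open>Finite fields of characteristic two\<close>

lemma card_power_fixed_le:
  assumes "Q > 1" shows "finite {x :: 'f::field. x ^ Q = x}" "card {x :: 'f. x ^ Q = x} \<le> Q"
proof -
  define p where "p = monom (1 :: 'f) Q - monom 1 1"
  have "coeff p Q = 1" unfolding p_def using assms by simp
  then have p0: "p \<noteq> 0" by auto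
  have deg: "degree p \<le> Q" unfolding p_def using assms by (intro degree_diff_le) (auto simp: degree_monom_eq)
  have "{x. x ^ Q = x} = {x. poly p x = 0}" unfolding p_def by (auto simp: poly_monom)
  then show "finite {x :: 'f. x ^ Q = x}" "card {x :: 'f. x ^ Q = x} \<le> Q"
    using poly_roots_finite[OF p0] card_poly_roots_bound[OF p0] deg by auto
qed

lemma card_trace_zero_le:
  assumes "Q > 1" "n > 0"
  shows "finite {z :: 'f::field. ff_trace Q n z = 0}" "card {z :: 'f. ff_trace Q n z = 0} \<le> Q ^ (n - 1)"
proof -
  define p where "p = (\<Sum>i<n. monom (1 :: 'f) (Q ^ i))"
  have "coeff p (Q ^ (n - 1)) = (\<Sum>i<n. if i = n - 1 then 1 else 0)"
    unfolding p_def coeff_sum coeff_monom using assms(1) by (intro sum.cong) auto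
  then have "coeff p (Q ^ (n - 1)) = 1" using assms(2) by (simp add: sum.delta)
  then have p0: "p \<noteq> 0" by auto
  have deg: "degree p \<le> Q ^ (n - 1)"
    unfolding p_def using assms
    by (intro degree_sum_le) (auto intro!: order.trans[OF degree_monom_le] power_increasing)
  have "{z. ff_trace Q n z = 0} = {x. poly p x = 0}"
    unfolding p_def ff_trace_def by (auto simp: poly_monom poly_sum)
  then show "finite {z :: 'f. ff_trace Q n z = 0}" "card {z :: 'f. ff_trace Q n z = 0} \<le> Q ^ (n - 1)"
    using poly_roots_finite[OF p0] card_poly_roots_bound[OF p0] deg by auto
qed

lemma sum_periodic:
  fixes f :: "nat \<Rightarrow> 'a::comm_semiring_1"
  assumes "\<And>i. f (i + p) = f i"
  shows "(\<Sum>i<l * p. f i) = of_nat l * (\<Sum>i<p. f i)"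
proof (induction l)
  case (Suc l)
  have "f (i + l * p) = f i" for i
    using assms by (induction l) (auto simp: algebra_simps, metis add.assoc add.commute)
  then have "(\<Sum>i<p. f (i + l * p)) = (\<Sum>i<p. f i)" by simp
  moreover have "(\<Sum>i<Suc l * p. f i) = (\<Sum>i<l * p. f i) + (\<Sum>i<p. f (i + l * p))"
    using sum.nat_group[of f p "Suc l"] sum.nat_group[of f p l]
    by (simp add: sum.shift_bounds_nat_ivl[of f 0 "l * p" p, simplified] lessThan_atLeast0 add.commute)
  ultimately show ?case using Suc by (simp add: algebra_simps)
qed simp

text \<open>The additive character \<open>(- 1) ^ Tr\<close> of the field with \<open>2 ^ N\<close>
  elements, with integer values so that its sums can be studied by congruences.\<close>

definition trace_sign :: "nat \<Rightarrow> 'f::field \<Rightarrow> int" where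
  "trace_sign N x = (if ff_trace 2 N x = 0 then 1 else - 1)"

lemma trace_sign_square: "trace_sign N x * trace_sign N x = 1"
  by (simp add: trace_sign_def)

lemma trace_sign_zero: "trace_sign N 0 = 1"
  by (simp add: trace_sign_def ff_trace_def zero_power)

locale binary_field =
  fixes L :: "'f::field set" and N :: nat
  assumes subfield_L: "is_subfield L" and card_L: "card L = 2 ^ N" and N_pos: "N > 0"
begin

lemma finite_L: "finite L"
  using card_L by (simp add: card_ge_0_finite)

lemma two: "(2 :: 'f) = 0"
  using char_two[OF subfield_L card_L N_pos] .

lemmas c2 = char_two_simps[OF two]
lemmas frob_add = frobenius_add[OF two]
lemmas frob_sum = frobenius_sum[OF two]
lemmas subring_L = subfield_subring[OF subfield_L]
lemmas L_closed = subring_add[OF subring_L] subring_mult[OF subring_L] subring_power[OF subring_L]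
  subring_zero[OF subring_L] subring_one[OF subring_L]

lemma add_group_L: "add_group L"
  by (simp add: add_group_def finite_L L_closed)

lemma power_card: "x \<in> L \<Longrightarrow> x ^ 2 ^ N = x"
  using subfield_power_card[OF subfield_L finite_L] card_L by simp

lemma of_nat_parity: "of_nat l = (if even l then 0 else 1 :: 'f)"
  using two by (auto elim!: evenE oddE)

lemma ff_trace_add: assumes "Q = 2 ^ e" shows "ff_trace Q n (x + y) = ff_trace Q n x + ff_trace Q n (y :: 'f)"
  unfolding ff_trace_def assms by (simp add: frob_add sum.distrib flip: power_mult)

lemma ff_trace_image:
  assumes "x \<in> L" shows "ff_trace Q n x \<in> L"
  unfolding ff_trace_def using assms by (intro subring_sum subring_L L_closed)

lemma ff_trace_coboundary:
  assumes "Q = 2 ^ e" shows "ff_trace Q n (x ^ Q + x) = x ^ (Q ^ n) + (x :: 'f)"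
proof (induction n)
  case (Suc n)
  have "(x ^ Q + x) ^ (Q ^ n) = x ^ (Q ^ Suc n) + x ^ (Q ^ n)"
    unfolding assms by (simp add: frob_add power_add flip: power_mult)
  then have "ff_trace Q (Suc n) (x ^ Q + x) = (x ^ (Q ^ n) + x) + (x ^ (Q ^ Suc n) + x ^ (Q ^ n))"
    using Suc unfolding ff_trace_def by simp
  also have "\<dots> = x ^ (Q ^ Suc n) + x + (x ^ (Q ^ n) + x ^ (Q ^ n))" by (simp add: algebra_simps)
  finally show ?case by (simp add: c2)
qed (simp add: ff_trace_def c2)

text \<open>One count gives all three, among them the additive form of Hilbert's theorem 90. The
  kernel of \<open>x ^ Q + x\<close> has at most \<open>Q\<close> elements and its image, inside the
  trace-zero set, at most \<open>Q ^ (n - 1)\<close>, both by counting roots; the product is the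
  order of \<open>L\<close>, so equality holds throughout.\<close>

lemma fixed_and_trace:
  assumes Q: "Q = 2 ^ e" and e: "e > 0" and n: "n > 0" and N: "N = e * n"
  shows card_fixed: "card {x \<in> L. x ^ Q = x} = Q"
    and image_eq_trace_zero: "(\<lambda>x. x ^ Q + x) ` L = {z \<in> L. ff_trace Q n z = 0}"
    and card_trace_zero: "card {z \<in> L. ff_trace Q n z = 0} = Q ^ (n - 1)"
proof -
  have Q1: "Q > 1" unfolding Q using e by (rule one_less_power[rotated]) simp
  have Qn: "Q ^ n = 2 ^ N" unfolding Q N by (simp add: power_mult)
  define f where "f x = x ^ Q + x" for x :: 'f
  have f_add: "f (x + y) = f x + f y" for x y
    unfolding f_def Q by (simp add: frob_add)
  have ker: "{x \<in> L. f x = 0} = {x \<in> L. x ^ Q = x}"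
    unfolding f_def by (auto simp: c2 simp flip: c2(2))
  have sub: "f ` L \<subseteq> {z \<in> L. ff_trace Q n z = 0}"
    unfolding f_def by (auto simp: ff_trace_coboundary[OF Q] Qn power_card c2 intro!: L_closed)
  have "card {x \<in> L. f x \<in> f ` L} = card {x \<in> L. f x = 0} * card (f ` L)"
    by (rule card_preimage[OF two add_group_L]) (use f_add in auto)
  moreover have "{x \<in> L. f x \<in> f ` L} = L" by auto
  ultimately have total: "card L = card {x \<in> L. x ^ Q = x} * card (f ` L)" unfolding ker by simp
  have "card {x \<in> L. x ^ Q = x} \<le> card {x :: 'f. x ^ Q = x}"
    using card_power_fixed_le(1)[OF Q1] by (rule card_mono) auto
  then have le1: "card {x \<in> L. x ^ Q = x} \<le> Q"
    using card_power_fixed_le(2)[OF Q1, where 'f = 'f] by linarith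
  have fin2: "finite {z \<in> L. ff_trace Q n z = 0}" using finite_L by simp
  have "card {z \<in> L. ff_trace Q n z = 0} \<le> card {z :: 'f. ff_trace Q n z = 0}"
    using card_trace_zero_le(1)[OF Q1 n] by (rule card_mono) auto
  then have le2: "card {z \<in> L. ff_trace Q n z = 0} \<le> Q ^ (n - 1)"
    using card_trace_zero_le(2)[OF Q1 n, where 'f = 'f] by linarith
  have le3: "card (f ` L) \<le> card {z \<in> L. ff_trace Q n z = 0}" using card_mono[OF fin2 sub] .
  have tot: "card L = Q * Q ^ (n - 1)" using card_L Qn n by (simp flip: power_Suc)
  have card_pos: "card (f ` L) > 0" using finite_L L_closed(4) by (auto simp: card_gt_0_iff)
  have e1: "card {x \<in> L. x ^ Q = x} = Q"
  proof (rule ccontr)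
    assume "card {x \<in> L. x ^ Q = x} \<noteq> Q"
    then have "card {x \<in> L. x ^ Q = x} < Q" using le1 by simp
    then have "card {x \<in> L. x ^ Q = x} * card (f ` L) < Q * Q ^ (n - 1)"
      using le2 le3 Q1 card_pos by (intro mult_less_le_imp_less) auto
    then show False using total tot by simp
  qed
  then have "card (f ` L) = Q ^ (n - 1)" using total tot Q1 by simp
  then have e2: "card {z \<in> L. ff_trace Q n z = 0} = Q ^ (n - 1)" using le2 le3 by simp
  show "card {x \<in> L. x ^ Q = x} = Q" by (rule e1)
  show "card {z \<in> L. ff_trace Q n z = 0} = Q ^ (n - 1)" by (rule e2)
  have "f ` L = {z \<in> L. ff_trace Q n z = 0}"
    using card_subset_eq[OF fin2 sub] e2 \<open>card (f ` L) = Q ^ (n - 1)\<close> by simp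
  then show "(\<lambda>x. x ^ Q + x) ` L = {z \<in> L. ff_trace Q n z = 0}" unfolding f_def .
qed

lemma abs_trace_values: assumes "x \<in> L" shows "ff_trace 2 N x = 0 \<or> ff_trace 2 N x = 1"
proof -
  have "(ff_trace 2 N x)\<^sup>2 = (\<Sum>i<N. x ^ 2 ^ Suc i)"
    unfolding ff_trace_def using frob_sum[of "\<lambda>i. x ^ 2 ^ i" "{..<N}" 1]
    by (simp add: mult.commute flip: power_mult)
  also have "\<dots> + x = (\<Sum>i<Suc N. x ^ 2 ^ i)" by (simp only: sum.lessThan_Suc_shift) simp
  then have "(\<Sum>i<N. x ^ 2 ^ Suc i) = ff_trace 2 N x"
    using power_card[OF assms] by (simp add: ff_trace_def)
  finally have "ff_trace 2 N x * (ff_trace 2 N x - 1) = 0"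
    by (simp add: power2_eq_square right_diff_distrib)
  then show ?thesis by simp
qed

lemma trace_sign_add:
  assumes "x \<in> L" "y \<in> L"
  shows "trace_sign N (x + y) = trace_sign N x * trace_sign N y"
  using abs_trace_values[OF assms(1)] abs_trace_values[OF assms(2)] ff_trace_add[of 2 1 N x y]
  by (auto simp: trace_sign_def c2)

lemma trace_sign_power2: assumes "x \<in> L" shows "trace_sign N (x\<^sup>2) = trace_sign N x"
proof -
  have "ff_trace 2 N (x\<^sup>2) = ff_trace 2 N (x\<^sup>2 + x) + ff_trace 2 N x"
    unfolding ff_trace_add[of 2 1, simplified] by (simp add: add.assoc c2)
  also have "ff_trace 2 N (x\<^sup>2 + x) = 0"
    using ff_trace_coboundary[of 2 1 N x] power_card[OF assms] by (simp add: c2)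
  finally show ?thesis by (simp add: trace_sign_def)
qed

lemma trace_sign_frob: "x \<in> L \<Longrightarrow> trace_sign N (x ^ 2 ^ i) = trace_sign N x"
proof (induction i)
  case (Suc i)
  have "x ^ 2 ^ Suc i = (x ^ 2 ^ i)\<^sup>2" by (simp add: mult.commute flip: power_mult)
  then show ?case using Suc trace_sign_power2[of "x ^ 2 ^ i"] by (simp add: L_closed)
qed simp

lemma sum_trace_sign:
  assumes "x \<in> L"
  shows "(\<Sum>y\<in>L. trace_sign N (x * y)) = (if x = 0 then int (card L) else 0)"
proof (cases "x = 0")
  case False
  have "\<exists>z\<in>L. ff_trace 2 N z \<noteq> 0"
  proof (rule ccontr)
    assume "\<not> (\<exists>z\<in>L. ff_trace 2 N z \<noteq> 0)"
    then have "{z \<in> L. ff_trace 2 N z = 0} = L" by auto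
    then have "card L = 2 ^ (N - 1)" using card_trace_zero[of 2 1 N] N_pos by simp
    then show False using card_L N_pos by simp
  qed
  then obtain z where z: "z \<in> L" "ff_trace 2 N z \<noteq> 0" by blast
  have "x * (inverse x * z) = z" "inverse x * z \<in> L"
    using False z assms subfield_L by (auto intro: L_closed subfield_inverse)
  moreover have "trace_sign N z \<noteq> 1" using z(2) by (simp add: trace_sign_def)
  ultimately have "\<not> (\<forall>y\<in>L. trace_sign N (x * y) = 1)" by metis
  moreover have "(\<Sum>y\<in>L. trace_sign N (x * y))
      = (if \<forall>y\<in>L. trace_sign N (x * y) = 1 then int (card L) else 0)"
    using assms by (intro sum_character[OF two add_group_L]) (simp add: distrib_left trace_sign_add L_closed)
  ultimately show ?thesis using False by (metis (full_types))
qed (simp add: trace_sign_zero)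

text \<open>Frobenius is onto, so the twist by \<open>2 ^ i\<close> does not weaken the condition.
  It is there because polar forms get collected at a Frobenius power of \<open>y\<close>.\<close>

lemma trace_sign_nondegenerate:
  assumes "x \<in> L" "\<And>y. y \<in> L \<Longrightarrow> trace_sign N (x * y ^ 2 ^ i) = 1"
  shows "x = 0"
proof (rule ccontr)
  assume "x \<noteq> 0"
  have surj: "\<exists>z\<in>L. z ^ 2 ^ i = y" if "y \<in> L" for y
  proof
    have "i \<le> N * i" using N_pos by simp
    then have "(y ^ 2 ^ (N * i - i)) ^ 2 ^ i = y ^ 2 ^ (N * i)" by (simp flip: power_mult power_add)
    also have "y ^ 2 ^ (N * j) = y" for j
      by (induction j) (simp_all add: power_add power_mult power_card[OF that])
    finally show "(y ^ 2 ^ (N * i - i)) ^ 2 ^ i = y" .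
  qed (use that in \<open>auto intro: L_closed\<close>)
  have "trace_sign N (x * y) = 1" if "y \<in> L" for y using surj[OF that] assms(2) by metis
  then have "(\<Sum>y\<in>L. trace_sign N (x * y)) = int (card L)" by simp
  then show False using sum_trace_sign[OF assms(1)] \<open>x \<noteq> 0\<close> card_L by simp
qed

text \<open>As the trace is invariant under squaring, the polar form of \<open>\<mu> * x ^ 3\<close> can be collected at \<open>y\<^sup>2\<close>.\<close>

lemma cube_sign_add:
  assumes "\<mu> \<in> L" "x \<in> L" "y \<in> L"
  shows "trace_sign N (\<mu> * (x + y) ^ 3) = trace_sign N (\<mu> * x ^ 3) * trace_sign N (\<mu> * y ^ 3)
    * trace_sign N ((\<mu>\<^sup>2 * x ^ 4 + \<mu> * x) * y\<^sup>2)"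
proof -
  have "(x + y) ^ 3 = x ^ 3 + y ^ 3 + (x\<^sup>2 * y + x * y\<^sup>2) + 2 * (x\<^sup>2 * y + x * y\<^sup>2)"
    by algebra
  then have "\<mu> * (x + y) ^ 3 = \<mu> * x ^ 3 + \<mu> * y ^ 3 + (\<mu> * x\<^sup>2 * y + \<mu> * x * y\<^sup>2)"
    using two by (simp add: algebra_simps)
  moreover have "(\<mu> * x\<^sup>2 * y)\<^sup>2 = \<mu>\<^sup>2 * x ^ 4 * y\<^sup>2"
    by (simp add: power_mult_distrib flip: power_mult)
  then have "trace_sign N (\<mu> * x\<^sup>2 * y) = trace_sign N (\<mu>\<^sup>2 * x ^ 4 * y\<^sup>2)"
    using trace_sign_power2[of "\<mu> * x\<^sup>2 * y"] assms by (simp add: L_closed)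
  ultimately show ?thesis using assms by (simp add: trace_sign_add L_closed distrib_right mult.assoc)
qed

lemma bilinear_sign_add:
  assumes "\<mu> \<in> L" "x \<in> L" "y \<in> L" "z \<in> L"
  shows "trace_sign N ((\<mu>\<^sup>2 * x ^ 4 + \<mu> * x) * (y + z)\<^sup>2)
    = trace_sign N ((\<mu>\<^sup>2 * x ^ 4 + \<mu> * x) * y\<^sup>2) * trace_sign N ((\<mu>\<^sup>2 * x ^ 4 + \<mu> * x) * z\<^sup>2)"
  using assms frob_add[of y z 1] by (simp add: distrib_left trace_sign_add L_closed)

lemma bilinear_sign_add':
  assumes "\<mu> \<in> L" "x \<in> L" "y \<in> L" "z \<in> L"
  shows "trace_sign N ((\<mu>\<^sup>2 * (y + z) ^ 4 + \<mu> * (y + z)) * x\<^sup>2)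
    = trace_sign N ((\<mu>\<^sup>2 * y ^ 4 + \<mu> * y) * x\<^sup>2) * trace_sign N ((\<mu>\<^sup>2 * z ^ 4 + \<mu> * z) * x\<^sup>2)"
proof -
  have "(\<mu>\<^sup>2 * (y + z) ^ 4 + \<mu> * (y + z)) * x\<^sup>2
      = (\<mu>\<^sup>2 * y ^ 4 + \<mu> * y) * x\<^sup>2 + (\<mu>\<^sup>2 * z ^ 4 + \<mu> * z) * x\<^sup>2"
    using frob_add[of y z 2] by (simp add: algebra_simps)
  then show ?thesis using assms by (simp add: trace_sign_add L_closed)
qed

lemma exists_omega:
  assumes "even N"
  obtains \<omega> where "\<omega> \<in> L" "\<omega> \<noteq> 0" "\<omega> \<noteq> 1" "\<omega> ^ 4 = \<omega>" "\<omega> ^ 3 = 1" "1 + \<omega> + \<omega>\<^sup>2 = 0"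
proof -
  have "card {x \<in> L. x ^ 4 = x} = 4"
    using card_fixed[of 4 2 "N div 2"] assms N_pos by (auto elim: evenE)
  moreover have "card {0, 1 :: 'f} \<le> 2" by simp
  ultimately have "\<not> {x \<in> L. x ^ 4 = x} \<subseteq> {0, 1}"
    using card_mono[of "{0, 1 :: 'f}" "{x \<in> L. x ^ 4 = x}"] by auto
  then obtain \<omega> where w: "\<omega> \<in> L" "\<omega> ^ 4 = \<omega>" "\<omega> \<noteq> 0" "\<omega> \<noteq> 1" by blast
  have "\<omega> * (\<omega> ^ 3 - 1) = 0" using w(2) by (simp add: algebra_simps eval_nat_numeral)
  then have w3: "\<omega> ^ 3 = 1" using w(3) by simp
  have "(\<omega> - 1) * (1 + \<omega> + \<omega>\<^sup>2) = \<omega> ^ 3 - 1" by algebra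
  then have "1 + \<omega> + \<omega>\<^sup>2 = 0" using w3 w(4) by simp
  then show thesis using that w w3 by blast
qed

lemma card_order_4: assumes "even N" shows "card {x \<in> L. x ^ 4 = x} = 4"
  using card_fixed[of 4 2 "N div 2"] assms N_pos by (auto elim: evenE)

text \<open>Multiplication by \<open>\<omega>\<close> has order 3, preserves cubes and fixes only 0,
  so modulo 3 only the term \<open>x = 0\<close> survives.\<close>

lemma cube_sum_mod_3:
  assumes "finite V" "V \<subseteq> L" "0 \<in> V" "\<omega> \<in> L" "\<omega> \<noteq> 1" "\<omega> ^ 3 = 1" "\<And>x. x \<in> V \<Longrightarrow> \<omega> * x \<in> V"
  shows "[(\<Sum>x\<in>V. trace_sign N (\<mu> * x ^ 3)) = 1] (mod 3)"
proof -
  have "((*) \<omega> ^^ i) x = \<omega> ^ i * x" for i x by (induction i) (auto simp: mult.assoc)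
  then have "[(\<Sum>x\<in>V. trace_sign N (\<mu> * x ^ 3)) =
      (\<Sum>x | x \<in> V \<and> \<omega> * x = x. trace_sign N (\<mu> * x ^ 3))] (mod int 3)"
    using assms by (intro sum_cong_fixed_points) (auto simp: power_mult_distrib)
  moreover have "{x. x \<in> V \<and> \<omega> * x = x} = {0}" using assms by auto
  ultimately show ?thesis by (simp add: trace_sign_zero)
qed

text \<open>The square determines the sum up to sign, and its residue modulo \<open>3\<close> determines the sign.\<close>

lemma cube_sum:
  assumes N: "N = 2 * e" and \<mu>: "\<mu> \<in> L" "\<mu> \<noteq> 0"
  shows "(\<Sum>x\<in>L. trace_sign N (\<mu> * x ^ 3)) =
    (if \<exists>y\<in>L. \<mu> * y ^ 3 = 1 then (- 2) ^ (e + 1) else (- 2) ^ e)"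
proof -
  define S where "S = (\<Sum>x\<in>L. trace_sign N (\<mu> * x ^ 3))"
  define R where "R = {u. u \<in> L \<and> (\<forall>y\<in>L. trace_sign N ((\<mu>\<^sup>2 * u ^ 4 + \<mu> * u) * y\<^sup>2) = 1)}"
  obtain \<omega> where w: "\<omega> \<in> L" "\<omega> \<noteq> 0" "\<omega> \<noteq> 1" "\<omega> ^ 4 = \<omega>" "\<omega> ^ 3 = 1" "1 + \<omega> + \<omega>\<^sup>2 = 0"
    using exists_omega N by auto
  have R_eq: "R = {u \<in> L. u = 0 \<or> \<mu> * u ^ 3 = 1}"
  proof -
    have fac: "\<mu>\<^sup>2 * u ^ 4 + \<mu> * u = 0 \<longleftrightarrow> u = 0 \<or> \<mu> * u ^ 3 = 1" for u
    proof -
      have "\<mu>\<^sup>2 * u ^ 4 + \<mu> * u = \<mu> * u * (\<mu> * u ^ 3 + 1)" by algebra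
      then show ?thesis using \<mu> by (auto simp flip: c2(2))
    qed
    have nondeg: "(\<forall>y\<in>L. trace_sign N (z * y\<^sup>2) = 1) \<longleftrightarrow> z = 0" if "z \<in> L" for z
      using trace_sign_nondegenerate[OF that, of 1] by (auto simp: trace_sign_zero)
    have "u \<in> R \<longleftrightarrow> u \<in> L \<and> (u = 0 \<or> \<mu> * u ^ 3 = 1)" for u
    proof (cases "u \<in> L")
      case True
      then have "\<mu>\<^sup>2 * u ^ 4 + \<mu> * u \<in> L" using \<mu> by (intro L_closed)
      from nondeg[OF this] show ?thesis unfolding R_def using True fac by simp
    qed (simp add: R_def)
    then show ?thesis by auto
  qed
  have S2: "S\<^sup>2 = int (card L) * (\<Sum>u\<in>R. trace_sign N (\<mu> * u ^ 3))"
    unfolding S_def R_def using \<mu>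
    by (intro quadratic_sum_square two add_group_L cube_sign_add trace_sign_square bilinear_sign_add) auto
  have S3: "[S = 1] (mod 3)"
    unfolding S_def using w finite_L by (intro cube_sum_mod_3[of L \<omega>]) (auto intro: L_closed)
  \<comment> \<open>The absolute trace of 1 is \<open>N\<close>, which is even. So the sign is 1 on
    the whole radical, where \<open>\<mu> * u ^ 3\<close> is 0 or 1.\<close>
  have one: "trace_sign N (1 :: 'f) = 1"
    using N by (simp add: trace_sign_def ff_trace_def of_nat_parity)
  have "(\<Sum>u\<in>R. trace_sign N (\<mu> * u ^ 3)) = int (card R)"
  proof -
    have "(\<Sum>u\<in>R. trace_sign N (\<mu> * u ^ 3)) = (\<Sum>u\<in>R. 1)"
      by (rule sum.cong) (auto simp: R_eq one trace_sign_zero)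
    then show ?thesis by simp
  qed
  moreover have "card R = (if \<exists>y\<in>L. \<mu> * y ^ 3 = 1 then 4 else 1)"
  proof (cases "\<exists>y\<in>L. \<mu> * y ^ 3 = 1")
    case True
    then obtain y where y: "y \<in> L" "\<mu> * y ^ 3 = 1" by blast
    then have y0: "y \<noteq> 0" by auto
    \<comment> \<open>A nonzero radical is a line over the field of four elements.\<close>
    have "bij_betw (\<lambda>x. x * y) {x \<in> L. x ^ 4 = x} R"
    proof (rule bij_betwI[where g = "\<lambda>u. u * inverse y"])
      have eq4: "x ^ 4 = x \<longleftrightarrow> x = 0 \<or> x ^ 3 = 1" for x :: 'f
        by (simp add: eval_nat_numeral)
      show "(\<lambda>x. x * y) \<in> {x \<in> L. x ^ 4 = x} \<rightarrow> R"
        using y unfolding R_eq eq4 by (auto simp: power_mult_distrib L_closed)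
      have "\<mu> = inverse y ^ 3" using y y0 by (simp add: field_simps)
      then show "(\<lambda>u. u * inverse y) \<in> R \<rightarrow> {x \<in> L. x ^ 4 = x}"
        using y unfolding R_eq eq4
        by (auto simp: power_mult_distrib mult.commute intro!: L_closed subfield_inverse subfield_L)
    qed (use y0 in auto)
    then show ?thesis using True card_order_4 N by (auto dest: bij_betw_same_card)
  next
    case False
    then have "R = {0}" unfolding R_eq by (auto simp: L_closed)
    then show ?thesis using False by simp
  qed
  ultimately have "S\<^sup>2 = 4 ^ (if \<exists>y\<in>L. \<mu> * y ^ 3 = 1 then e + 1 else e)"
    using S2 card_L N by (auto simp: power_mult)
  from square_cong_one_mod_3[OF this S3] show ?thesis unfolding S_def by auto
qed

lemma sum_over_cubes:
  fixes f :: "'f \<Rightarrow> 'b::comm_semiring_1"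
  assumes "even N"
  shows "(\<Sum>x\<in>L - {0}. f (x ^ 3)) = 3 * (\<Sum>y\<in>(\<lambda>x. x ^ 3) ` (L - {0}). f y)"
proof -
  obtain \<omega> where w: "\<omega> \<in> L" "\<omega> \<noteq> 0" "\<omega> \<noteq> 1" "\<omega> ^ 4 = \<omega>" "\<omega> ^ 3 = 1" "1 + \<omega> + \<omega>\<^sup>2 = 0"
    using exists_omega assms by auto
  have "card {x \<in> L - {0}. x ^ 3 = y} = 3" if y: "y \<in> (\<lambda>x. x ^ 3) ` (L - {0})" for y
  proof -
    obtain u where u: "u \<in> L" "u \<noteq> 0" "y = u ^ 3" using y by auto
    have "{x \<in> L - {0}. x ^ 3 = y} = {u, \<omega> * u, \<omega>\<^sup>2 * u}"
    proof (intro equalityI subsetI)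
      fix x assume "x \<in> {x \<in> L - {0}. x ^ 3 = y}"
      then have "x ^ 3 = u ^ 3" using u by simp
      moreover have "x ^ 3 - u ^ 3 = (x - u) * (x - \<omega> * u) * (x - \<omega>\<^sup>2 * u)"
        using w(5,6) by algebra
      ultimately show "x \<in> {u, \<omega> * u, \<omega>\<^sup>2 * u}" by simp
    next
      fix x assume "x \<in> {u, \<omega> * u, \<omega>\<^sup>2 * u}"
      moreover have "(\<omega>\<^sup>2) ^ 3 = 1" using w(5) by (metis power_mult mult.commute power_one)
      ultimately show "x \<in> {x \<in> L - {0}. x ^ 3 = y}"
        using u w by (auto simp: power_mult_distrib L_closed)
    qed
    moreover have "\<omega>\<^sup>2 \<noteq> 1"
    proof
      assume "\<omega>\<^sup>2 = 1"
      then have "\<omega> ^ 3 = \<omega>" by (simp add: power3_eq_cube power2_eq_square)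
      then show False using w by simp
    qed
    moreover have "\<omega>\<^sup>2 \<noteq> \<omega>" using w by (simp add: power2_eq_square)
    ultimately show ?thesis using u w by auto
  qed
  then have "(\<Sum>x | x \<in> L - {0} \<and> x ^ 3 = y. f (x ^ 3)) = 3 * f y"
    if "y \<in> (\<lambda>x. x ^ 3) ` (L - {0})" for y
    using that by simp
  then show ?thesis
    using sum.image_gen[of "L - {0}" "\<lambda>x. f (x ^ 3)" "\<lambda>x. x ^ 3"] finite_L by (simp add: sum_distrib_left)
qed

end


section \<open>The sums over the kernel of the relative trace\<close>

text \<open>Transitivity of the trace: the numbers \<open>r * j + i\<close> with
  \<open>i < r\<close> and \<open>j < m\<close> enumerate the exponents below
  \<open>r * m\<close>.\<close>

lemma trace_sign_tower:
  assumes "(2 :: 'f::field) = 0"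
  shows "trace_sign (r * m) z = trace_sign r (ff_trace (2 ^ r) m (z :: 'f))"
proof -
  have "ff_trace 2 r (ff_trace (2 ^ r) m z) = (\<Sum>i<r. \<Sum>j<m. z ^ (2 ^ (r * j + i)))"
    unfolding ff_trace_def frobenius_sum[OF assms] by (simp add: power_add flip: power_mult)
  also have "\<dots> = (\<Sum>j<m. \<Sum>i<r. z ^ (2 ^ (r * j + i)))" by (rule sum.swap)
  also have "\<dots> = (\<Sum>j<m. \<Sum>i\<in>{j * r..<j * r + r}. z ^ (2 ^ i))"
  proof (rule sum.cong[OF refl])
    fix j
    have "(\<Sum>i\<in>{0 + j * r..<r + j * r}. z ^ (2 ^ i)) = (\<Sum>i\<in>{0..<r}. z ^ (2 ^ (i + j * r)))"
      by (rule sum.shift_bounds_nat_ivl)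
    then show "(\<Sum>i<r. z ^ (2 ^ (r * j + i))) = (\<Sum>i\<in>{j * r..<j * r + r}. z ^ (2 ^ i))"
      by (simp add: lessThan_atLeast0 add.commute mult.commute)
  qed
  also have "\<dots> = ff_trace 2 (r * m) z"
    unfolding ff_trace_def sum.nat_group by (simp add: mult.commute)
  finally show ?thesis by (simp add: trace_sign_def)
qed

lemma power_power_fixed: "(x :: 'a::monoid_mult) ^ a = x \<Longrightarrow> x ^ a ^ n = x"
  by (induction n) (simp_all add: power_mult)

text \<open>An element with only \<open>p\<close> conjugates contributes each of them
  \<open>l\<close> times; in characteristic two just the parity of \<open>l\<close> then
  matters.\<close>

lemma ff_trace_periodic:
  fixes u :: "'f::field"
  assumes "u ^ q ^ p = u"
  shows "ff_trace q (l * p) u = of_nat l * ff_trace q p u"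
  unfolding ff_trace_def
proof (rule sum_periodic)
  show "u ^ q ^ (i + p) = u ^ q ^ i" for i
    using assms by (simp add: power_add mult.commute[of "q ^ i"] power_mult)
qed

locale tower =
  fixes K k :: "'f::field set" and q r m :: nat
  assumes q: "q = 2 ^ r" and r_pos: "r > 0" and m_pos: "m > 0"
    and subfield_K: "is_subfield K" and card_K: "card K = q ^ m"
    and subfield_k: "is_subfield k" and card_k: "card k = q" and k_subset: "k \<subseteq> K"
begin

sublocale FK: binary_field K "r * m"
  by unfold_locales (use q r_pos m_pos subfield_K card_K in \<open>auto simp: power_mult\<close>)

sublocale Fk: binary_field k r
  by unfold_locales (use q r_pos subfield_k card_k in auto)

abbreviation tr :: "'f \<Rightarrow> 'f" where "tr \<equiv> ff_trace q m"
abbreviation \<chi> :: "'f \<Rightarrow> int" where "\<chi> \<equiv> trace_sign (r * m)"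
abbreviation \<psi> :: "'f \<Rightarrow> int" where "\<psi> \<equiv> trace_sign r"

definition H :: "'f set" where "H = {z \<in> K. tr z = 0}"
definition E :: "'f \<Rightarrow> int" where "E \<mu> = (\<Sum>u\<in>H. \<chi> (\<mu> * u ^ 3))"

lemma sign_eq: "\<chi> z = \<psi> (tr z)"
  unfolding q by (rule trace_sign_tower[OF FK.two])

lemma k_K: "z \<in> k \<Longrightarrow> z \<in> K"
  using k_subset by blast

lemma frob_add: "(x + y) ^ q = x ^ q + (y :: 'f) ^ q"
  unfolding q by (rule FK.frob_add)

lemma power_q_m: "x \<in> K \<Longrightarrow> x ^ q ^ m = x"
  using FK.power_card q by (simp add: power_mult)

lemma k_eq: "k = {z \<in> K. z ^ q = z}"
proof (rule card_subset_eq)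
  show "finite {z \<in> K. z ^ q = z}" using FK.finite_L by simp
  show "k \<subseteq> {z \<in> K. z ^ q = z}" using k_K Fk.power_card q by auto
  show "card k = card {z \<in> K. z ^ q = z}"
    using FK.card_fixed[OF q r_pos m_pos] card_k by simp
qed

lemma k_iff: "z \<in> k \<longleftrightarrow> z \<in> K \<and> z ^ q = z"
  using k_eq by auto

lemma H_image: "H = (\<lambda>x. x ^ q + x) ` K"
  unfolding H_def using FK.image_eq_trace_zero[OF q r_pos m_pos] by simp

lemma card_H: "card H = q ^ (m - 1)"
  unfolding H_def using FK.card_trace_zero[OF q r_pos m_pos] by simp

lemma H_K: "z \<in> H \<Longrightarrow> z \<in> K"
  by (simp add: H_def)

lemma tr_add: "tr (x + y) = tr x + tr y"
  by (rule FK.ff_trace_add[OF q])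

lemma add_group_H: "add_group H"
  unfolding add_group_def using FK.finite_L FK.L_closed
  by (auto simp: H_def tr_add) (use q in \<open>simp add: ff_trace_def zero_power\<close>)

lemma tr_power: "(tr z) ^ 2 ^ i = tr (z ^ 2 ^ i)"
  unfolding ff_trace_def FK.frob_sum by (simp add: mult.commute flip: power_mult)

lemma tr_in_k: assumes "z \<in> K" shows "tr z \<in> k"
proof -
  have "tr (z ^ q) + tr z = 0"
    using FK.ff_trace_coboundary[OF q, of m z] power_q_m[OF assms] by (simp add: tr_add FK.c2)
  then have "tr (z ^ q) = tr z" using FK.c2(2)[of "tr (z ^ q)" "tr z"] by simp
  then have "(tr z) ^ q = tr z" using tr_power[of z r] q by simp
  then show ?thesis using FK.ff_trace_image[OF assms] k_iff by blast
qed

lemma tr_scale: assumes "c \<in> k" shows "tr (c * z) = c * tr z"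
proof -
  have "c ^ q ^ i = c" for i using assms k_iff power_power_fixed by blast
  then show ?thesis unfolding ff_trace_def by (simp add: power_mult_distrib sum_distrib_left)
qed

lemma tr_k: assumes "z \<in> k" shows "tr z = of_nat m * z"
  using ff_trace_periodic[of z q 1 m] assms k_iff by (simp add: ff_trace_def)

lemma card_coboundary_preimage:
  assumes "D \<subseteq> H" shows "card {x \<in> K. x ^ q + x \<in> D} = q * card D"
proof -
  have "card {x \<in> K. x ^ q + x \<in> D} = card {x \<in> K. x ^ q + x = 0} * card D"
    using assms by (intro card_preimage FK.two FK.add_group_L) (auto simp: frob_add H_image)
  also have "{x \<in> K. x ^ q + x = 0} = k"
    using k_eq by (auto simp flip: FK.c2(2))
  finally show ?thesis using card_k by simp
qed

text \<open>For the trace form, the orthogonal complement of the trace-zero elements is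
  \<open>k\<close>. With \<open>y = t ^ q + t\<close>, the product \<open>z * y\<^sup>2\<close> has
  two parts; raising one to the power \<open>q\<close> gives both the common factor
  \<open>t ^ (2 * q)\<close>, with total coefficient \<open>z ^ q + z\<close>.\<close>

lemma trace_orthogonal_iff:
  assumes "z \<in> K" shows "(\<forall>y\<in>H. \<chi> (z * y\<^sup>2) = 1) \<longleftrightarrow> z \<in> k"
proof
  assume all: "\<forall>y\<in>H. \<chi> (z * y\<^sup>2) = 1"
  have "\<chi> ((z ^ q + z) * t ^ 2 ^ (r + 1)) = 1" if t: "t \<in> K" for t
  proof -
    have "t ^ q + t \<in> H" unfolding H_image using t by blast
    then have "1 = \<chi> (z * (t ^ q + t)\<^sup>2)" using all by simp
    also have "z * (t ^ q + t)\<^sup>2 = z * t ^ 2 ^ (r + 1) + z * t\<^sup>2"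
      using FK.frob_add[of "t ^ q" t 1] q
      by (simp add: distrib_left mult.commute[of 2] flip: power_mult)
    also have "\<chi> \<dots> = \<chi> (z * t ^ 2 ^ (r + 1)) * \<chi> (z * t\<^sup>2)"
      using assms t by (intro FK.trace_sign_add FK.L_closed)
    also have "\<chi> (z * t\<^sup>2) = \<chi> ((z * t\<^sup>2) ^ 2 ^ r)"
      using assms t by (intro FK.trace_sign_frob[symmetric] FK.L_closed)
    also have "(z * t\<^sup>2) ^ 2 ^ r = z ^ q * t ^ 2 ^ (r + 1)"
      by (simp add: power_mult_distrib q flip: power_mult)
    also have "\<chi> (z * t ^ 2 ^ (r + 1)) * \<chi> (z ^ q * t ^ 2 ^ (r + 1))
        = \<chi> ((z ^ q + z) * t ^ 2 ^ (r + 1))"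
      using assms t by (simp add: distrib_right FK.trace_sign_add FK.L_closed)
    finally show ?thesis by simp
  qed
  then have "z ^ q + z = 0"
    using assms by (intro FK.trace_sign_nondegenerate[where i = "r + 1"] FK.L_closed) auto
  then show "z \<in> k" using assms k_iff FK.c2(2)[of "z ^ q" z] by simp
next
  assume "z \<in> k"
  then have "\<chi> (z * y\<^sup>2) = 1" if "y \<in> H" for y
    using that tr_power[of y 1] by (simp add: sign_eq tr_scale H_def trace_sign_zero flip: tr_power)
  then show "\<forall>y\<in>H. \<chi> (z * y\<^sup>2) = 1" by blast
qed

text \<open>The radical on \<open>H\<close> of the polar form of \<open>\<mu> * u ^ 3\<close>: by
  \<open>trace_orthogonal_iff\<close>, \<open>u\<close> pairs trivially with \<open>H\<close>
  exactly when the coefficient of \<open>y\<^sup>2\<close> lies in \<open>k\<close>.\<close>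

definition Rad :: "'f \<Rightarrow> 'f set" where "Rad \<mu> = {u \<in> H. \<mu>\<^sup>2 * u ^ 4 + \<mu> * u \<in> k}"

text \<open>Membership in \<open>k\<close> is invariance under the power \<open>q\<close>. The
  expression is additive in \<open>u\<close> with coefficients in \<open>k\<close>, so its deviation
  from invariance is the same expression at \<open>u ^ q + u\<close>.\<close>

lemma Rad_condition:
  assumes "\<mu> \<in> k" "u \<in> K"
  shows "\<mu>\<^sup>2 * u ^ 4 + \<mu> * u \<in> k \<longleftrightarrow> \<mu>\<^sup>2 * (u ^ q + u) ^ 4 + \<mu> * (u ^ q + u) = 0"
proof -
  have \<mu>: "\<mu> ^ q = \<mu>" using assms k_iff by blast
  have "(\<mu>\<^sup>2 * u ^ 4 + \<mu> * u) ^ q + (\<mu>\<^sup>2 * u ^ 4 + \<mu> * u)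
      = \<mu>\<^sup>2 * ((u ^ q) ^ 4 + u ^ 4) + \<mu> * (u ^ q + u)"
    unfolding frob_add power_mult_distrib power_commutes
    by (simp add: algebra_simps flip: power_mult) (simp add: mult.commute[of _ q] power_mult \<mu>)
  also have "(u ^ q) ^ 4 + u ^ 4 = (u ^ q + u) ^ 4" using FK.frob_add[of "u ^ q" u 2] by simp
  finally have "(\<mu>\<^sup>2 * u ^ 4 + \<mu> * u) ^ q - (\<mu>\<^sup>2 * u ^ 4 + \<mu> * u)
      = \<mu>\<^sup>2 * (u ^ q + u) ^ 4 + \<mu> * (u ^ q + u)" unfolding FK.c2(2) .
  moreover have "\<mu>\<^sup>2 * u ^ 4 + \<mu> * u \<in> K" using assms k_K by (intro FK.L_closed) auto
  ultimately show ?thesis using k_iff by (metis eq_iff_diff_eq_0)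
qed

lemma Rad_iff:
  assumes "\<mu> \<in> k" "\<mu> \<noteq> 0"
  shows "u \<in> Rad \<mu> \<longleftrightarrow> u \<in> K \<and> tr u = 0 \<and> (u ^ q + u = 0 \<or> \<mu> * (u ^ q + u) ^ 3 = 1)"
proof -
  have fac: "\<mu>\<^sup>2 * d ^ 4 + \<mu> * d = 0 \<longleftrightarrow> d = 0 \<or> \<mu> * d ^ 3 = 1" for d
  proof -
    have "\<mu>\<^sup>2 * d ^ 4 + \<mu> * d = \<mu> * d * (\<mu> * d ^ 3 + 1)" by algebra
    then show ?thesis using assms by (auto simp flip: FK.c2(2))
  qed
  show ?thesis
  proof (cases "u \<in> K")
    case True
    then show ?thesis using Rad_condition[OF assms(1) True] fac by (simp add: Rad_def H_def)
  qed (simp add: Rad_def H_def)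
qed

lemma E_square:
  assumes "\<mu> \<in> k" shows "(E \<mu>)\<^sup>2 = int (q ^ (m - 1)) * (\<Sum>u\<in>Rad \<mu>. \<chi> (\<mu> * u ^ 3))"
proof -
  have "(E \<mu>)\<^sup>2 = int (card H) * (\<Sum>u | u \<in> H \<and> (\<forall>y\<in>H. \<chi> ((\<mu>\<^sup>2 * u ^ 4 + \<mu> * u) * y\<^sup>2) = 1). \<chi> (\<mu> * u ^ 3))"
    unfolding E_def using assms H_K k_K
    by (intro quadratic_sum_square FK.two add_group_H FK.cube_sign_add trace_sign_square FK.bilinear_sign_add) auto
  also have "{u. u \<in> H \<and> (\<forall>y\<in>H. \<chi> ((\<mu>\<^sup>2 * u ^ 4 + \<mu> * u) * y\<^sup>2) = 1)} = Rad \<mu>"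
  proof -
    have "\<mu>\<^sup>2 * u ^ 4 + \<mu> * u \<in> K" if "u \<in> H" for u using that assms H_K k_K by (intro FK.L_closed) auto
    then show ?thesis using trace_orthogonal_iff unfolding Rad_def by blast
  qed
  finally show ?thesis using card_H by simp
qed

lemma E_cube: assumes "\<nu> \<in> k" "\<nu> \<noteq> 0" shows "E (\<nu> ^ 3) = E 1"
proof -
  have "bij_betw (\<lambda>u. \<nu> * u) H H"
  proof (rule bij_betwI[where g = "\<lambda>u. inverse \<nu> * u"])
    have "inverse \<nu> \<in> k" using assms subfield_k by (simp add: subfield_inverse)
    then show "(\<lambda>u. inverse \<nu> * u) \<in> H \<rightarrow> H" using k_K by (auto simp: H_def tr_scale FK.L_closed)
    show "(\<lambda>u. \<nu> * u) \<in> H \<rightarrow> H" using assms k_K by (auto simp: H_def tr_scale FK.L_closed)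
  qed (use assms in auto)
  from sum.reindex_bij_betw[OF this, of "\<lambda>u. \<chi> (u ^ 3)"] show ?thesis
    unfolding E_def by (simp add: power_mult_distrib)
qed

lemma card_points:
  assumes \<beta>: "\<beta> \<in> K"
  shows "int (card {(x, y). x \<in> K \<and> y \<in> K \<and> y ^ q + y = \<beta> + (x ^ q + x) ^ 3})
    = int q ^ m + int q * (\<Sum>\<mu>\<in>k - {0}. \<psi> (\<mu> * tr \<beta>) * E \<mu>)"
proof -
  \<comment> \<open>There are \<open>q\<close> solutions or none, according to the trace of the
    right-hand side, and the characters of \<open>k\<close> detect trace zero.\<close>
  have inner: "int (card {y \<in> K. y ^ q + y = \<beta> + t ^ 3}) = (\<Sum>\<mu>\<in>k. \<psi> (\<mu> * tr \<beta>) * \<chi> (\<mu> * t ^ 3))"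
    if t: "t \<in> K" for t
  proof -
    have bt: "\<beta> + t ^ 3 \<in> K" using \<beta> t by (intro FK.L_closed)
    have "int (card {y \<in> K. y ^ q + y = \<beta> + t ^ 3}) = (if tr (\<beta> + t ^ 3) = 0 then int q else 0)"
    proof (cases "tr (\<beta> + t ^ 3) = 0")
      case True
      then have "{\<beta> + t ^ 3} \<subseteq> H" using bt by (simp add: H_def)
      from card_coboundary_preimage[OF this] show ?thesis using True by simp
    next
      case False
      then have "\<beta> + t ^ 3 \<notin> H" by (simp add: H_def)
      then have "{y \<in> K. y ^ q + y = \<beta> + t ^ 3} = {}" unfolding H_image by force
      then show ?thesis using False by (simp del: Collect_empty_eq)
    qed
    also have "\<dots> = (\<Sum>\<mu>\<in>k. \<psi> (tr (\<beta> + t ^ 3) * \<mu>))"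
      using Fk.sum_trace_sign[OF tr_in_k[OF bt]] card_k by simp
    also have "\<dots> = (\<Sum>\<mu>\<in>k. \<psi> (\<mu> * tr \<beta>) * \<chi> (\<mu> * t ^ 3))"
    proof (rule sum.cong[OF refl])
      fix \<mu> assume \<mu>: "\<mu> \<in> k"
      have "tr (\<beta> + t ^ 3) * \<mu> = \<mu> * tr \<beta> + \<mu> * tr (t ^ 3)" by (simp add: tr_add algebra_simps)
      moreover have "tr \<beta> \<in> k" "tr (t ^ 3) \<in> k" using \<beta> t by (auto intro: tr_in_k FK.L_closed)
      ultimately have "\<psi> (tr (\<beta> + t ^ 3) * \<mu>) = \<psi> (\<mu> * tr \<beta>) * \<psi> (\<mu> * tr (t ^ 3))"
        using \<mu> by (simp add: Fk.trace_sign_add Fk.L_closed)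
      then show "\<psi> (tr (\<beta> + t ^ 3) * \<mu>) = \<psi> (\<mu> * tr \<beta>) * \<chi> (\<mu> * t ^ 3)"
        using \<mu> by (simp add: sign_eq tr_scale)
    qed
    finally show ?thesis .
  qed
  have "{(x, y). x \<in> K \<and> y \<in> K \<and> y ^ q + y = \<beta> + (x ^ q + x) ^ 3}
      = (SIGMA x:K. {y \<in> K. y ^ q + y = \<beta> + (x ^ q + x) ^ 3})" by auto
  then have "int (card {(x, y). x \<in> K \<and> y \<in> K \<and> y ^ q + y = \<beta> + (x ^ q + x) ^ 3})
      = (\<Sum>x\<in>K. int (card {y \<in> K. y ^ q + y = \<beta> + (x ^ q + x) ^ 3}))"
    using FK.finite_L by simp
  also have "\<dots> = (\<Sum>t\<in>H. \<Sum>x | x \<in> K \<and> x ^ q + x = t. int (card {y \<in> K. y ^ q + y = \<beta> + (x ^ q + x) ^ 3}))"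
    unfolding H_image by (rule sum.image_gen[OF FK.finite_L])
  also have "\<dots> = (\<Sum>t\<in>H. int q * (\<Sum>\<mu>\<in>k. \<psi> (\<mu> * tr \<beta>) * \<chi> (\<mu> * t ^ 3)))"
  proof (rule sum.cong[OF refl])
    fix t assume t: "t \<in> H"
    then have "card {x \<in> K. x ^ q + x = t} = q" using card_coboundary_preimage[of "{t}"] by simp
    then show "(\<Sum>x | x \<in> K \<and> x ^ q + x = t. int (card {y \<in> K. y ^ q + y = \<beta> + (x ^ q + x) ^ 3}))
        = int q * (\<Sum>\<mu>\<in>k. \<psi> (\<mu> * tr \<beta>) * \<chi> (\<mu> * t ^ 3))"
      using inner[OF H_K[OF t]] by simp
  qed
  also have "\<dots> = int q * (\<Sum>\<mu>\<in>k. \<Sum>t\<in>H. \<psi> (\<mu> * tr \<beta>) * \<chi> (\<mu> * t ^ 3))"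
    by (subst sum.swap) (simp add: sum_distrib_left)
  also have "\<dots> = int q * (\<Sum>\<mu>\<in>k. \<psi> (\<mu> * tr \<beta>) * E \<mu>)"
    by (simp add: E_def sum_distrib_left)
  also have "(\<Sum>\<mu>\<in>k. \<psi> (\<mu> * tr \<beta>) * E \<mu>) = E 0 + (\<Sum>\<mu>\<in>k - {0}. \<psi> (\<mu> * tr \<beta>) * E \<mu>)"
    using sum.remove[OF Fk.finite_L Fk.L_closed(4), of "\<lambda>\<mu>. \<psi> (\<mu> * tr \<beta>) * E \<mu>"]
    by (simp add: trace_sign_zero)
  \<comment> \<open>The trivial character contributes \<open>q * q ^ (m - 1)\<close>, the main
    term.\<close>
  also have "E 0 = int q ^ (m - 1)" by (simp add: E_def trace_sign_zero card_H)
  finally show ?thesis using m_pos by (simp add: distrib_left flip: power_Suc)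
qed

lemma Rad_K: "u \<in> Rad \<mu> \<Longrightarrow> u \<in> K"
  by (simp add: Rad_def H_def)

lemma zero_in_Rad: "0 \<in> Rad \<mu>"
  using add_group_H Fk.L_closed by (simp add: Rad_def add_group_def)

lemma finite_Rad: "finite (Rad \<mu>)"
  using add_groupD(1)[OF add_group_H] by (simp add: Rad_def)

lemma add_group_Rad: assumes "\<mu> \<in> k" shows "add_group (Rad \<mu>)"
  unfolding add_group_def
proof (intro conjI ballI)
  fix x y assume xy: "x \<in> Rad \<mu>" "y \<in> Rad \<mu>"
  have "\<mu>\<^sup>2 * (x + y) ^ 4 + \<mu> * (x + y) = (\<mu>\<^sup>2 * x ^ 4 + \<mu> * x) + (\<mu>\<^sup>2 * y ^ 4 + \<mu> * y)"
    using FK.frob_add[of x y 2] by (simp add: algebra_simps)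
  then show "x + y \<in> Rad \<mu>"
    using xy add_group_H by (simp add: Rad_def add_groupD Fk.L_closed)
qed (simp_all add: zero_in_Rad finite_Rad)

end

text \<open>If \<open>r\<close> is even, \<open>H\<close> is invariant under the cube roots of unity, so that \<open>E\<close> is congruent
  to \<open>1\<close> modulo \<open>3\<close>; in particular it does not vanish, and its square determines it.\<close>

locale tower_even = tower K k q r m for K k :: "'f::field set" and q r m +
  assumes r_even: "even r"
begin

lemma E_cong_1: assumes "\<mu> \<in> k" shows "[E \<mu> = 1] (mod 3)"
proof -
  obtain \<omega> where w: "\<omega> \<in> k" "\<omega> \<noteq> 1" "\<omega> ^ 3 = 1" using Fk.exists_omega[OF r_even] by blast
  show ?thesis unfolding E_def
  proof (rule FK.cube_sum_mod_3[of H \<omega>])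
    show "\<omega> * x \<in> H" if "x \<in> H" for x using that w k_K by (simp add: H_def tr_scale FK.L_closed)
  qed (use w k_K add_groupD[OF add_group_H] H_K in auto)
qed

text \<open>The polar form vanishes on the radical, so the sign is a character there, with sum 0 or
  the order of the radical. The congruence modulo 3 excludes 0.\<close>

lemma E_square_card: assumes "\<mu> \<in> k" shows "(E \<mu>)\<^sup>2 = int (q ^ (m - 1)) * int (card (Rad \<mu>))"
proof -
  have "(\<Sum>u\<in>Rad \<mu>. \<chi> (\<mu> * u ^ 3)) = (if \<forall>u\<in>Rad \<mu>. \<chi> (\<mu> * u ^ 3) = 1 then int (card (Rad \<mu>)) else 0)"
  proof (rule sum_character[OF FK.two add_group_Rad[OF assms]])
    fix x y assume x: "x \<in> Rad \<mu>" and y: "y \<in> Rad \<mu>"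
    have "\<mu>\<^sup>2 * x ^ 4 + \<mu> * x \<in> K" using x assms Rad_K k_K by (intro FK.L_closed) auto
    then have "\<chi> ((\<mu>\<^sup>2 * x ^ 4 + \<mu> * x) * y\<^sup>2) = 1"
      using trace_orthogonal_iff x y unfolding Rad_def by blast
    then show "\<chi> (\<mu> * (x + y) ^ 3) = \<chi> (\<mu> * x ^ 3) * \<chi> (\<mu> * y ^ 3)"
      using FK.cube_sign_add[of \<mu> x y] x y assms Rad_K k_K by simp
  qed
  moreover have "E \<mu> \<noteq> 0" using E_cong_1[OF assms] by (auto simp: cong_def)
  then have "(E \<mu>)\<^sup>2 \<noteq> 0" by simp
  ultimately show ?thesis using E_square[OF assms] by (auto split: if_splits)
qed

lemma E_of_card_Rad:
  assumes "\<mu> \<in> k" "card (Rad \<mu>) = 4 ^ i * q ^ j" "m - 1 + j = 2 * t"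
  shows "E \<mu> = (- 2) ^ i * int q ^ t"
proof -
  have "(E \<mu>)\<^sup>2 = int (q ^ (m - 1 + j) * 4 ^ i)"
    using E_square_card[OF assms(1)] assms(2) by (simp add: power_add)
  also have "q ^ (m - 1 + j) = 4 ^ (r * t)"
  proof -
    have "q ^ (2 * t) = (2\<^sup>2) ^ (r * t)"
      unfolding q by (simp only: power_mult[symmetric] mult_ac)
    then show ?thesis unfolding assms(3) by simp
  qed
  finally have "(E \<mu>)\<^sup>2 = 4 ^ (r * t + i)" by (simp add: power_add)
  from square_cong_one_mod_3[OF this E_cong_1[OF assms(1)]]
  have "E \<mu> = (- 2) ^ i * ((- 2) ^ r) ^ t" by (simp add: power_add power_mult)
  also have "(- 2 :: int) ^ r = int q" using r_even q by simp
  finally show ?thesis .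
qed

lemma order_4_in_k: assumes "d \<in> K" "d ^ 4 = d" shows "d \<in> k"
proof -
  obtain s where s: "r = 2 * s" using r_even by (auto elim: evenE)
  have "q = 4 ^ s" unfolding q s by (simp add: power_mult)
  then show ?thesis using assms k_iff power_power_fixed[of d 4 s] by simp
qed

text \<open>Put \<open>d = u ^ q + u\<close>. The radical condition says \<open>d ^ 4 = d\<close>,
  and for even \<open>r\<close> this puts \<open>d\<close> into \<open>k\<close>, so the conjugates
  of \<open>u\<close> are \<open>u\<close> and \<open>u + d\<close>. For \<open>m = 2 * l\<close>
  the trace of \<open>u\<close> is \<open>l * d\<close>: it vanishes for even \<open>l\<close>,
  while for odd \<open>l\<close> it forces \<open>d = 0\<close>. For odd \<open>m\<close> the traces
  of \<open>d\<close> and \<open>u\<close> make both vanish.\<close>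

lemma card_Rad_1: "card (Rad 1) = (if odd m then 1 else if 4 dvd m then 4 * q else q)"
proof -
  have one: "1 \<in> k" by (rule Fk.L_closed)
  have Rad: "u \<in> Rad 1 \<longleftrightarrow> u \<in> K \<and> tr u = 0 \<and> (u ^ q + u) ^ 4 = u ^ q + u" for u
  proof -
    have "d = 0 \<or> d ^ 3 = 1 \<longleftrightarrow> d ^ 4 = d" for d :: 'f by (simp add: eval_nat_numeral)
    then show ?thesis using Rad_iff[OF one, of u] by simp
  qed
  have d: "u ^ q + u \<in> k" "tr (u ^ q + u) = 0" if "u \<in> K" "(u ^ q + u) ^ 4 = u ^ q + u" for u
    using that order_4_in_k[of "u ^ q + u"] H_image by (auto simp: FK.L_closed H_def)
  show ?thesis
  proof (cases "odd m")
    case True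
    have "u = 0" if "u \<in> Rad 1" for u
    proof -
      have u: "u \<in> K" "tr u = 0" "(u ^ q + u) ^ 4 = u ^ q + u" using that Rad by auto
      have "u ^ q + u = 0" using d[OF u(1,3)] tr_k True by (simp add: FK.of_nat_parity)
      then have "u \<in> k" using u k_iff FK.c2(2)[of "u ^ q" u] by simp
      then show "u = 0" using tr_k u True by (simp add: FK.of_nat_parity)
    qed
    then have "Rad 1 = {0}" using zero_in_Rad by blast
    then show ?thesis using True by simp
  next
    case False
    then obtain l where l: "m = l * 2" by (auto elim: evenE simp: mult.commute)
    have tr_u: "tr u = of_nat l * (u ^ q + u)" if "u \<in> K" "(u ^ q + u) ^ 4 = u ^ q + u" for u
    proof -
      have "(u ^ q + u) ^ q = u ^ q + u" using d[OF that] k_iff by blast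
      then have "(u ^ q) ^ q + u ^ q = u ^ q + u" by (simp add: frob_add)
      then have "u ^ q ^ 2 = u" by (simp add: power2_eq_square power_mult add.commute)
      from ff_trace_periodic[OF this, of l] show ?thesis unfolding l
        by (simp add: ff_trace_def eval_nat_numeral add.commute)
    qed
    show ?thesis
    proof (cases "even l")
      case True
      have "Rad 1 = {u \<in> K. u ^ q + u \<in> {x \<in> K. x ^ 4 = x}}"
        using Rad tr_u True by (auto simp: FK.of_nat_parity FK.L_closed)
      moreover have "{x \<in> K. x ^ 4 = x} \<subseteq> H"
        using order_4_in_k tr_k False by (auto simp: H_def FK.of_nat_parity)
      moreover have "card {x \<in> K. x ^ 4 = x} = 4" using r_even by (intro FK.card_order_4) simp
      moreover have "4 dvd m" using True l by (auto elim!: evenE)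
      ultimately show ?thesis using card_coboundary_preimage[of "{x \<in> K. x ^ 4 = x}"] False
        by (simp del: mem_Collect_eq)
    next
      case l_odd: False
      have "u \<in> Rad 1 \<longleftrightarrow> u \<in> k" for u
      proof
        assume "u \<in> Rad 1"
        then have u: "u \<in> K" "tr u = 0" "(u ^ q + u) ^ 4 = u ^ q + u" using Rad by auto
        then have "u ^ q + u = 0" using tr_u l_odd by (simp add: FK.of_nat_parity)
        then show "u \<in> k" using u k_iff FK.c2(2)[of "u ^ q" u] by simp
      next
        assume "u \<in> k"
        then show "u \<in> Rad 1"
          using Rad[of u] k_iff[of u] tr_k False by (simp add: FK.c2 FK.of_nat_parity)
      qed
      then have "Rad 1 = k" by blast
      moreover have "\<not> 4 dvd m" using l_odd l by (auto elim!: dvdE)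
      ultimately show ?thesis using card_k False by simp
    qed
  qed
qed

lemma q_cong_1: "[q = 1] (mod 3)"
proof -
  obtain s where s: "r = 2 * s" using r_even by (auto elim: evenE)
  have "[(4 :: nat) ^ s = 1 ^ s] (mod 3)" by (intro cong_pow) (simp add: cong_def)
  then show ?thesis unfolding q s by (simp add: power_mult)
qed

text \<open>By counting, the nonzero cubes of \<open>K\<close> are the solutions of
  \<open>z ^ n = 1\<close>, where \<open>3 * n = q ^ m - 1\<close>. As \<open>q\<close> is 1 modulo
  3, \<open>(q ^ m - 1) / (q - 1)\<close> is congruent to \<open>m\<close>; if 3 divides
  \<open>m\<close>, then \<open>q - 1\<close> divides \<open>n\<close>, so all nonzero elements of
  \<open>k\<close> qualify.\<close>

lemma cube_in_K:
  assumes "3 dvd m" "\<mu> \<in> k" "\<mu> \<noteq> 0" shows "\<exists>d\<in>K. \<mu> * d ^ 3 = 1"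
proof -
  have q1: "q > 1" using q r_pos one_less_power[of "2 :: nat" r] by simp
  define A where "A = (\<Sum>i<m. q ^ i)"
  have geo: "(q - 1) * (\<Sum>i<m. q ^ i) + 1 = q ^ m" for m
  proof -
    obtain p where p: "q = Suc p" using q1 by (cases q) auto
    show ?thesis unfolding p by (induction m) (auto simp: algebra_simps)
  qed
  have "[A = (\<Sum>i<m. 1)] (mod 3)" unfolding A_def
  proof (rule cong_sum)
    show "[q ^ i = 1] (mod 3)" for i using cong_pow[OF q_cong_1, of i] by simp
  qed
  then have "3 dvd A" using assms(1) cong_dvd_iff by simp blast
  then obtain B where B: "A = 3 * B" by blast
  define n where "n = (q - 1) * B"
  have n: "3 * n + 1 = q ^ m" using geo[of m] unfolding A_def[symmetric] B n_def by (simp add: mult_ac)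
  have n0: "n > 0"
  proof (rule ccontr)
    assume "\<not> n > 0"
    then have "q ^ m = 1" using n by simp
    then show False using q1 m_pos by simp
  qed
  define C where "C = (\<lambda>x. x ^ 3) ` (K - {0})"
  have fin_C: "finite C" unfolding C_def using FK.finite_L by simp
  have "(\<Sum>x\<in>K - {0}. 1 :: nat) = 3 * (\<Sum>y\<in>C. 1)"
    unfolding C_def using r_even by (intro FK.sum_over_cubes) simp
  moreover have "card (K - {0}) = 3 * n"
    using n card_K FK.finite_L FK.L_closed(4) by (simp add: card_Diff_singleton)
  ultimately have card_C: "card C = n" by simp
  define Z where "Z = {x :: 'f. x ^ (n + 1) = x}"
  have Z: "finite Z" "card Z \<le> n + 1" unfolding Z_def using card_power_fixed_le[of "n + 1"] n0 by auto
  have "C \<subseteq> Z - {0}"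
  proof
    fix z assume "z \<in> C"
    then obtain x where x: "x \<in> K" "x \<noteq> 0" "z = x ^ 3" unfolding C_def by auto
    have "x ^ (3 * n + 1) = x" using power_q_m[OF x(1)] n by simp
    then have "z ^ n * x = x" unfolding x(3) by (simp flip: power_mult)
    then show "z \<in> Z - {0}" using x unfolding Z_def by simp
  qed
  moreover have "card (Z - {0}) \<le> card C"
  proof -
    have "0 \<in> Z" unfolding Z_def by simp
    then show ?thesis using Z card_C by (simp add: card_Diff_singleton)
  qed
  ultimately have C_eq: "C = Z - {0}" using Z(1) by (intro card_seteq) auto
  have "\<mu> ^ (q - 1) = 1"
  proof -
    have "\<mu> * \<mu> ^ (q - 1) = \<mu>" using assms(2) k_iff q1 by (simp flip: power_Suc)
    then show ?thesis using assms(3) by simp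
  qed
  then have "\<mu> ^ n = 1" unfolding n_def by (simp add: power_mult)
  then have "inverse \<mu> \<in> Z - {0}" unfolding Z_def using assms(3) by (simp add: power_inverse)
  then have "inverse \<mu> \<in> C" using C_eq by blast
  then obtain x where "x \<in> K" "inverse \<mu> = x ^ 3" unfolding C_def by auto
  then show ?thesis using assms(3) by (metis right_inverse)
qed

lemma card_Rad_noncube:
  assumes \<mu>: "\<mu> \<in> k" "\<mu> \<noteq> 0" and noncube: "\<not> (\<exists>\<nu>\<in>k. \<nu> ^ 3 = \<mu>)"
  shows "card (Rad \<mu>) = (if 3 dvd m then 4 else 1) * (if odd m then 1 else q)"
proof -
  have \<mu>q: "\<mu> ^ q = \<mu>" using \<mu> k_iff by blast
  \<comment> \<open>If \<open>\<mu> * d ^ 3 = 1\<close>, this ratio is a cube root of unity, and not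
    1, since otherwise \<open>d\<close> would be in \<open>k\<close> and \<open>\<mu>\<close> a cube
    there. The conjugates of \<open>d\<close> are thus the
    \<open>\<theta> d ^ i * d\<close>.\<close>
  define \<theta> where "\<theta> d = d ^ q / d" for d :: 'f
  have \<theta>: "d ^ q = \<theta> d * d" "\<theta> d ^ 3 = 1" "1 + \<theta> d + (\<theta> d)\<^sup>2 = 0" "(\<theta> d) ^ q = \<theta> d" "d \<noteq> 0" "\<theta> d \<noteq> 1"
    if d: "d \<in> K" "\<mu> * d ^ 3 = 1" for d
  proof -
    show d0: "d \<noteq> 0" using d by auto
    show t: "d ^ q = \<theta> d * d" unfolding \<theta>_def using d0 by simp
    have "(\<mu> * d ^ 3) ^ q = 1" using d by simp
    then have "\<mu> * (d ^ q) ^ 3 = 1" by (simp add: power_mult_distrib \<mu>q mult.commute flip: power_mult)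
    then have "\<theta> d ^ 3 * (\<mu> * d ^ 3) = 1" unfolding t by (simp add: power_mult_distrib mult_ac)
    then show t3: "\<theta> d ^ 3 = 1" using d by simp
    show t1: "\<theta> d \<noteq> 1"
    proof
      assume "\<theta> d = 1"
      then have "d \<in> k" using t d k_iff by simp
      then have "inverse d \<in> k" using subfield_inverse[OF subfield_k] by blast
      moreover have "inverse d ^ 3 = \<mu>" using d d0 by (simp add: field_simps)
      ultimately show False using noncube by blast
    qed
    have "(\<theta> d - 1) * (1 + \<theta> d + (\<theta> d)\<^sup>2) = \<theta> d ^ 3 - 1" by algebra
    then show "1 + \<theta> d + (\<theta> d)\<^sup>2 = 0" using t3 t1 by simp
    have "\<theta> d \<in> K" unfolding \<theta>_def using d by (intro subfield_divide subfield_K FK.L_closed)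
    moreover have "\<theta> d ^ 4 = \<theta> d" using t3 by (simp add: eval_nat_numeral)
    ultimately show "(\<theta> d) ^ q = \<theta> d" using order_4_in_k k_iff by blast
  qed
  have iter: "d ^ q ^ i = \<theta> d ^ i * d" if "d \<in> K" "\<mu> * d ^ 3 = 1" for d i
  proof (induction i)
    case (Suc i)
    have "d ^ q ^ Suc i = (\<theta> d ^ i * d) ^ q" unfolding Suc[symmetric] by (simp add: mult.commute flip: power_mult)
    also have "\<dots> = (\<theta> d ^ q) ^ i * d ^ q" by (simp add: power_mult_distrib mult.commute flip: power_mult)
    also have "\<dots> = \<theta> d ^ Suc i * d" using \<theta>[OF that] by (simp add: mult_ac)
    finally show ?case .
  qed simp
  note Rad = Rad_iff[OF \<mu>]
  show ?thesis
  proof (cases "3 dvd m")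
    case False
    have none: "\<not> (\<mu> * d ^ 3 = 1)" if "d \<in> K" for d
    proof
      assume d: "\<mu> * d ^ 3 = 1"
      have "\<theta> d ^ m = 1" using iter[OF that d, of m] power_q_m[OF that] \<theta>(5)[OF that d] by simp
      moreover have "\<theta> d ^ m = \<theta> d ^ (m mod 3)"
      proof -
        have "\<theta> d ^ m = \<theta> d ^ (3 * (m div 3) + m mod 3)" by simp
        also have "\<dots> = \<theta> d ^ (m mod 3)" unfolding power_add power_mult \<theta>(2)[OF that d] by simp
        finally show ?thesis .
      qed
      moreover have "m mod 3 = 1 \<or> m mod 3 = 2" using False by (auto simp: dvd_eq_mod_eq_0)
      moreover have "(\<theta> d)\<^sup>2 \<noteq> 1"
      proof
        assume "(\<theta> d)\<^sup>2 = 1"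
        then show False using \<theta>(3,2)[OF that d] \<theta>(6)[OF that d] by (simp add: power3_eq_cube power2_eq_square)
      qed
      ultimately show False using \<theta>(6)[OF that d] by auto
    qed
    have "u \<in> Rad \<mu> \<longleftrightarrow> u \<in> k \<and> of_nat m * u = 0" for u
    proof
      assume "u \<in> Rad \<mu>"
      then have u: "u \<in> K" "tr u = 0" "u ^ q + u = 0" using Rad none by (auto simp: FK.L_closed)
      then have "u \<in> k" using k_iff FK.c2(2)[of "u ^ q" u] by simp
      then show "u \<in> k \<and> of_nat m * u = 0" using tr_k u by simp
    next
      assume "u \<in> k \<and> of_nat m * u = 0"
      then show "u \<in> Rad \<mu>" using Rad[of u] k_iff[of u] tr_k by (simp add: FK.c2)
    qed
    then have Rad_eq: "Rad \<mu> = {u \<in> k. of_nat m * u = 0}" by blast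
    show ?thesis
    proof (cases "odd m")
      case True
      then have "{u \<in> k. of_nat m * u = 0} = {0}"
        using Fk.L_closed(4) by (auto simp: FK.of_nat_parity)
      then show ?thesis using False True Rad_eq by simp
    next
      case m_even: False
      then have "{u \<in> k. of_nat m * u = 0} = k" by (auto simp: FK.of_nat_parity)
      then show ?thesis using False m_even Rad_eq card_k by simp
    qed
  next
    case True
    then obtain l where l: "m = l * 3" by (metis dvdE mult.commute)
    \<comment> \<open>The possible values of \<open>u ^ q + u\<close> on the radical; they form a
      line over the field of four elements.\<close>
    define D where "D = {d \<in> K. d = 0 \<or> \<mu> * d ^ 3 = 1}"
    obtain d0 where d0: "d0 \<in> K" "\<mu> * d0 ^ 3 = 1" using cube_in_K[OF True \<mu>] by blast
    have D4: "card D = 4"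
    proof -
      have eq4: "x ^ 4 = x \<longleftrightarrow> x = 0 \<or> x ^ 3 = 1" for x :: 'f by (simp add: eval_nat_numeral)
      have nz: "d0 \<noteq> 0" using d0 by auto
      have "bij_betw (\<lambda>x. x * d0) {x \<in> K. x ^ 4 = x} D"
      proof (rule bij_betwI[where g = "\<lambda>u. u * inverse d0"])
        show "(\<lambda>x. x * d0) \<in> {x \<in> K. x ^ 4 = x} \<rightarrow> D"
          using d0 unfolding D_def eq4 by (auto simp: power_mult_distrib FK.L_closed)
        have "\<mu> = inverse d0 ^ 3" using d0 nz by (simp add: field_simps)
        then show "(\<lambda>u. u * inverse d0) \<in> D \<rightarrow> {x \<in> K. x ^ 4 = x}"
          using d0 unfolding D_def eq4
          by (auto simp: power_mult_distrib mult.commute intro!: FK.L_closed subfield_inverse subfield_K)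
      qed (use nz in auto)
      then show ?thesis using FK.card_order_4 r_even by (auto dest: bij_betw_same_card)
    qed
    have cube_period: "d ^ q ^ 3 = d" if "d \<in> K" "\<mu> * d ^ 3 = 1" for d
      using iter[OF that, of 3] \<theta>(2)[OF that] by simp
    have tr_D: "tr d = 0" if "d \<in> D" for d
    proof (cases "d = 0")
      case False
      then have d: "d \<in> K" "\<mu> * d ^ 3 = 1" using that unfolding D_def by auto
      have "tr d = of_nat l * ff_trace q 3 d" unfolding l using ff_trace_periodic[OF cube_period[OF d]] .
      also have "ff_trace q 3 d = (1 + \<theta> d + (\<theta> d)\<^sup>2) * d"
        unfolding ff_trace_def iter[OF d] by (simp add: eval_nat_numeral algebra_simps)
      finally show ?thesis using \<theta>(3)[OF d] by simp
    next
      case True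
      then show ?thesis using add_groupD(2)[OF add_group_H] by (simp add: H_def)
    qed
    \<comment> \<open>With \<open>d = u ^ q + u\<close> the conjugates of \<open>u\<close> are
      \<open>u\<close>, \<open>u + d\<close> and \<open>u + d + d ^ q\<close>, of period 3 because
      \<open>d\<close> and its conjugates sum to 0. Together they give
      \<open>u + d ^ q\<close>.\<close>
    have tr_u: "tr u = of_nat l * (u + (u ^ q + u) ^ q)" if u: "u \<in> K" "u ^ q + u \<in> D" for u
    proof -
      define d where "d = u ^ q + u"
      have uq: "u ^ q = u + d" unfolding d_def by (simp add: algebra_simps FK.two)
      have uq2: "u ^ q ^ 2 = u + d + d ^ q"
        by (simp add: power2_eq_square power_mult uq frob_add)
      have dsum: "d + d ^ q + d ^ q ^ 2 = 0"
      proof (cases "d = 0")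
        case True
        then show ?thesis using q by (simp add: zero_power)
      next
        case False
        then have d: "d \<in> K" "\<mu> * d ^ 3 = 1" using u(2) unfolding D_def d_def by auto
        have "d + d ^ q + d ^ q ^ 2 = (1 + \<theta> d + (\<theta> d)\<^sup>2) * d"
          using iter[OF d, of 1] iter[OF d, of 2] by (simp add: algebra_simps)
        then show ?thesis using \<theta>(3)[OF d] by simp
      qed
      have "u ^ q ^ 3 = (u ^ q ^ 2) ^ q" by (simp add: eval_nat_numeral mult.assoc flip: power_mult)
      also have "\<dots> = (u + d) + d ^ q + d ^ q ^ 2"
        unfolding uq2 frob_add uq by (simp add: power2_eq_square power_mult)
      also have "\<dots> = u" using dsum by (simp add: add.assoc)
      finally have "tr u = of_nat l * ff_trace q 3 u" unfolding l by (rule ff_trace_periodic)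
      also have "ff_trace q 3 u = u + u ^ q + u ^ q ^ 2" by (simp add: ff_trace_def eval_nat_numeral)
      also have "\<dots> = u + (u + d) + (u + d + d ^ q)" unfolding uq2 uq ..
      also have "\<dots> = u + d ^ q + (u + u) + (d + d)" by (simp add: algebra_simps)
      also have "\<dots> = u + d ^ q" by (simp add: FK.c2)
      finally show ?thesis unfolding d_def .
    qed
    have Rad_D: "u \<in> Rad \<mu> \<longleftrightarrow> u \<in> K \<and> tr u = 0 \<and> u ^ q + u \<in> D" for u
      unfolding Rad[of u] D_def by (auto simp: FK.L_closed)
    show ?thesis
    proof (cases "odd m")
      case False
      then have "even l" using l by simp
      then have "Rad \<mu> = {u \<in> K. u ^ q + u \<in> D}" using Rad_D tr_u by (auto simp: FK.of_nat_parity)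
      moreover have "D \<subseteq> H" using tr_D unfolding H_def D_def by auto
      ultimately show ?thesis using card_coboundary_preimage[of D] D4 True False by simp
    next
      case m_odd: True
      then have "odd l" using l by simp
      \<comment> \<open>For odd \<open>l\<close> trace zero forces
        \<open>u = (u ^ q + u) ^ q\<close>, which lies in \<open>D\<close> again; conversely the
        elements of \<open>D\<close> have trace zero.\<close>
      have "Rad \<mu> = D"
      proof (intro equalityI subsetI)
        fix u assume "u \<in> Rad \<mu>"
        then have u: "u \<in> K" "tr u = 0" "u ^ q + u \<in> D" using Rad_D by auto
        then have "u + (u ^ q + u) ^ q = 0" using tr_u \<open>odd l\<close> by (simp add: FK.of_nat_parity)
        then have ud: "u = (u ^ q + u) ^ q" using FK.c2(2)[of u "(u ^ q + u) ^ q"] by simp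
        show "u \<in> D"
        proof (cases "u ^ q + u = 0")
          case True
          then show ?thesis using ud q u(1) unfolding D_def by (simp add: zero_power)
        next
          case False
          then have "\<mu> * (u ^ q + u) ^ 3 = 1" using u(3) unfolding D_def by blast
          then have "(\<mu> * (u ^ q + u) ^ 3) ^ q = 1" by simp
          moreover have "(\<mu> * e ^ 3) ^ q = \<mu> ^ q * (e ^ q) ^ 3" for e
            by (simp add: power_mult_distrib mult.commute flip: power_mult)
          ultimately have "\<mu> ^ q * ((u ^ q + u) ^ q) ^ 3 = 1" by simp
          then show ?thesis using \<mu>q ud[symmetric] u(1) unfolding D_def by simp
        qed
      next
        fix u assume u: "u \<in> D"
        have "u ^ q + u \<in> D"
        proof (cases "u = 0")
          case True
          then show ?thesis using q FK.L_closed(4) unfolding D_def by (simp add: zero_power)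
        next
          case False
          then have d: "u \<in> K" "\<mu> * u ^ 3 = 1" using u unfolding D_def by auto
          have "u ^ q + u = (1 + \<theta> u) * u" using \<theta>(1)[OF d] by (simp add: algebra_simps)
          also have "1 + \<theta> u = (\<theta> u)\<^sup>2" using \<theta>(3)[OF d] FK.c2(2)[of "1 + \<theta> u" "(\<theta> u)\<^sup>2"] by simp
          finally have eq: "u ^ q + u = (\<theta> u)\<^sup>2 * u" .
          have "\<mu> * (u ^ q + u) ^ 3 = (\<theta> u ^ 3)\<^sup>2 * (\<mu> * u ^ 3)"
            unfolding eq by (simp add: power_mult_distrib mult_ac flip: power_mult)
          also have "\<dots> = 1" unfolding \<theta>(2)[OF d] d(2) by simp
          finally show ?thesis using d(1) unfolding D_def by (auto intro: FK.L_closed)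
        qed
        then show "u \<in> Rad \<mu>" using Rad_D tr_D u unfolding D_def by blast
      qed
      then show ?thesis using D4 True m_odd by simp
    qed
  qed
qed

lemma E_value:
  assumes "\<mu> \<in> k" "\<mu> \<noteq> 0"
  shows "E \<mu> = (if if \<exists>\<nu>\<in>k. \<nu> ^ 3 = \<mu> then 4 dvd m else 3 dvd m then - 2 else 1) * int q ^ (m div 2)"
proof (cases "\<exists>\<nu>\<in>k. \<nu> ^ 3 = \<mu>")
  case True
  then obtain \<nu> where \<nu>: "\<nu> \<in> k" "\<nu> ^ 3 = \<mu>" by blast
  then have "E \<mu> = E 1" using E_cube[of \<nu>] assms by auto
  moreover have "card (Rad 1) = 4 ^ (if 4 dvd m then 1 else 0) * q ^ (if odd m then 0 else 1)"
    using card_Rad_1 by auto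
  then have "E 1 = (- 2) ^ (if 4 dvd m then 1 else 0) * int q ^ (m div 2)"
    using m_pos Fk.L_closed(5) by (intro E_of_card_Rad) (auto elim!: evenE oddE)
  ultimately show ?thesis using True by simp
next
  case False
  have "card (Rad \<mu>) = 4 ^ (if 3 dvd m then 1 else 0) * q ^ (if odd m then 0 else 1)"
    using card_Rad_noncube[OF assms False] by auto
  then have "E \<mu> = (- 2) ^ (if 3 dvd m then 1 else 0) * int q ^ (m div 2)"
    using m_pos assms by (intro E_of_card_Rad) (auto elim!: evenE oddE)
  then show ?thesis using False by simp
qed

end


section \<open>The second supplement to quadratic reciprocity\<close>

text \<open>For odd \<open>n\<close> this is the Jacobi symbol of 2 over \<open>n\<close>.\<close>

definition two_symbol :: "nat \<Rightarrow> int" where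
  "two_symbol n = (if n mod 8 \<in> {1, 7} then 1 else - 1)"

lemma two_symbol_mult:
  assumes "odd a" "odd b" shows "two_symbol (a * b) = two_symbol a * two_symbol b"
proof -
  have cases8: "n mod 8 = 1 \<or> n mod 8 = 3 \<or> n mod 8 = 5 \<or> n mod 8 = 7" if "odd n" for n :: nat
    using that by presburger
  have "a * b mod 8 = (a mod 8) * (b mod 8) mod 8" by (simp add: mod_mult_eq)
  then show ?thesis using cases8[OF assms(1)] cases8[OF assms(2)]
    unfolding two_symbol_def by (elim disjE) simp_all
qed

text \<open>The sign is \<open>(- 1) ^ (h * (h + 1) div 2)\<close>, of period 4 in
  \<open>h\<close>.\<close>

lemma prod_alternating:
  "(\<Prod>j\<in>{1..h}. (- 1) ^ j) = (if h mod 4 \<in> {0, 3} then 1 else - 1 :: int)"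
proof (induction h)
  case (Suc h)
  have "h mod 4 = 0 \<or> h mod 4 = 1 \<or> h mod 4 = 2 \<or> h mod 4 = 3" by presburger
  then have "(even h \<longleftrightarrow> h mod 4 = 0 \<or> h mod 4 = 2) \<and> Suc h mod 4 = (if h mod 4 = 3 then 0 else Suc (h mod 4))"
    by presburger
  then show ?case using Suc \<open>h mod 4 = 0 \<or> h mod 4 = 1 \<or> h mod 4 = 2 \<or> h mod 4 = 3\<close>
    by (auto simp: atLeastAtMostSuc_conv)
qed simp

text \<open>The numbers \<open>2, 4, \<dots>, p - 1\<close> are, up to sign and modulo \<open>p\<close>, the numbers
  \<open>1, \<dots>, (p - 1) / 2\<close>.\<close>

lemma two_power_half:
  assumes p: "prime p" "odd p"
  shows "[2 ^ (p div 2) = two_symbol p] (mod int p)"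
proof -
  define h where "h = p div 2"
  have p_eq: "p = 2 * h + 1" using p(2) unfolding h_def by simp
  \<comment> \<open>The even one among \<open>j\<close> and \<open>p - j\<close>, congruent to
    \<open>(- 1) ^ j * j\<close>.\<close>
  define e where "e j = (if even j then j else p - j)" for j
  have "inj_on e {1..h}" unfolding e_def p_eq by (rule inj_onI) (auto split: if_splits)
  moreover have "e ` {1..h} \<subseteq> (*) 2 ` {1..h}"
  proof
    fix y assume "y \<in> e ` {1..h}"
    then obtain j where j: "j \<in> {1..h}" "y = e j" by blast
    then have "even y" "1 \<le> y" "y \<le> 2 * h" unfolding e_def p_eq by auto
    then have "y = 2 * (y div 2)" "y div 2 \<in> {1..h}" by auto
    then show "y \<in> (*) 2 ` {1..h}" by blast
  qed
  moreover have "card ((*) 2 ` {1..h}) = h" by (simp add: card_image inj_on_def)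
  ultimately have e_image: "e ` {1..h} = (*) 2 ` {1..h}"
    by (intro card_subset_eq) (auto simp: card_image)
  have "int (\<Prod>j\<in>{1..h}. e j) = int (\<Prod>y\<in>e ` {1..h}. y)"
    using \<open>inj_on e {1..h}\<close> by (simp add: prod.reindex)
  also have "\<dots> = int (\<Prod>j\<in>{1..h}. 2 * j)"
    unfolding e_image by (subst prod.reindex) (auto simp: inj_on_def)
  also have "\<dots> = 2 ^ h * int (fact h)"
    by (simp add: prod.distrib fact_prod flip: of_nat_prod)
  finally have left: "(\<Prod>j\<in>{1..h}. int (e j)) = 2 ^ h * int (fact h)" by simp
  have "[(\<Prod>j\<in>{1..h}. int (e j)) = (\<Prod>j\<in>{1..h}. (- 1) ^ j * int j)] (mod int p)"
  proof (rule cong_prod)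
    fix j assume j: "j \<in> {1..h}"
    show "[int (e j) = (- 1) ^ j * int j] (mod int p)"
    proof (cases "even j")
      case False
      then have "int (e j) = - int j + int p" using j p_eq unfolding e_def by auto
      then show ?thesis using False by (simp add: cong_def)
    qed (simp add: e_def)
  qed
  also have "(\<Prod>j\<in>{1..h}. (- 1) ^ j * int j) = (\<Prod>j\<in>{1..h}. (- 1) ^ j) * int (fact h)"
    by (simp add: prod.distrib fact_prod)
  also have "(\<Prod>j\<in>{1..h}. (- 1 :: int) ^ j) = two_symbol p"
  proof -
    have "h mod 4 \<in> {0, 3} \<longleftrightarrow> p mod 8 \<in> {1, 7}" unfolding p_eq by (simp, presburger)
    then show ?thesis unfolding prod_alternating two_symbol_def by simp
  qed
  finally have "[2 ^ h * int (fact h) = two_symbol p * int (fact h)] (mod int p)" unfolding left .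
  moreover have "coprime (int (fact h)) (int p)"
  proof -
    have "\<not> p dvd fact h" using p(1) p_eq by (simp add: prime_dvd_fact_iff)
    then have "coprime p (fact h)" using p(1) by (rule prime_imp_coprime[rotated])
    then have "coprime (fact h) p" by (rule coprime_commute[THEN iffD1])
    then show ?thesis unfolding coprime_int_iff .
  qed
  ultimately show ?thesis using cong_mult_rcancel unfolding h_def by blast
qed

section \<open>Odd \<open>r\<close>\<close>

locale tower_odd = tower K k q r m for K k :: "'f::field set" and q r m +
  assumes r_odd: "odd r"
begin

text \<open>For odd \<open>r\<close> the number \<open>q\<close> is twice a power of 4, so the power
  \<open>q\<close> acts on the field of four elements as squaring.\<close>

lemma frob_order_4: assumes "d ^ 4 = d" shows "d ^ q = (d :: 'f)\<^sup>2"
proof -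
  obtain j where j: "r = 2 * j + 1" using r_odd by (auto elim: oddE)
  have "q = 4 ^ j * 2" unfolding q j by (simp add: power_mult power_add)
  then have "d ^ q = (d ^ 4 ^ j)\<^sup>2" by (simp only: power_mult)
  then show ?thesis using power_power_fixed[OF assms, of j] by simp
qed

lemma order_4_period: assumes "d ^ 4 = d" shows "(d\<^sup>2) ^ q = (d :: 'f)" "d ^ q ^ 2 = d"
proof -
  have "(d\<^sup>2) ^ q = (d ^ q)\<^sup>2" by (simp add: mult.commute flip: power_mult)
  also have "\<dots> = d ^ 4" unfolding frob_order_4[OF assms] by (simp flip: power_mult)
  finally show "(d\<^sup>2) ^ q = d" using assms by simp
  then show "d ^ q ^ 2 = d"
    by (simp only: power2_eq_square[of q] power_mult frob_order_4[OF assms])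
qed

lemma order_4_in_k: assumes "d \<in> k" "d ^ 4 = d" shows "d = 0 \<or> d = 1"
proof -
  have "d\<^sup>2 = d" using frob_order_4[OF assms(2)] assms(1) k_iff by simp
  then have "d * (d - 1) = 0" by (simp add: power2_eq_square right_diff_distrib)
  then show ?thesis by simp
qed

text \<open>For odd \<open>r\<close> the field \<open>k\<close> has no cube root of unity except 1,
  so cubing permutes \<open>k\<close>.\<close>

lemma E_eq_E_1: assumes "\<mu> \<in> k" "\<mu> \<noteq> 0" shows "E \<mu> = E 1"
proof -
  have "inj_on (\<lambda>x. x ^ 3) k"
  proof (rule inj_onI)
    fix x y assume xy: "x \<in> k" "y \<in> k" "x ^ 3 = y ^ 3"
    show "x = y"
    proof (cases "y = 0")
      case False
      have "(x / y) ^ 3 = 1" using xy False by (simp add: power_divide)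
      then have "(x / y) ^ 4 = x / y" by (simp add: eval_nat_numeral)
      moreover have "x / y \<in> k" using xy subfield_k by (intro subfield_divide)
      ultimately have "x / y = 0 \<or> x / y = 1" by (intro order_4_in_k)
      moreover have "x / y \<noteq> 0" using \<open>(x / y) ^ 3 = 1\<close> by auto
      ultimately show ?thesis using False by auto
    qed (use xy in auto)
  qed
  moreover have "(\<lambda>x. x ^ 3) ` k \<subseteq> k" by (auto intro: Fk.L_closed)
  ultimately have "(\<lambda>x. x ^ 3) ` k = k" using Fk.finite_L by (intro endo_inj_surj)
  then obtain \<nu> where "\<nu> \<in> k" "\<mu> = \<nu> ^ 3" using assms(1) by blast
  moreover from this have "\<nu> \<noteq> 0" using assms(2) by auto
  ultimately show ?thesis using E_cube by blast
qed

lemma order_4_condition: "(d :: 'f) = 0 \<or> 1 * d ^ 3 = 1 \<longleftrightarrow> d ^ 4 = d"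
  by (simp add: eval_nat_numeral)

text \<open>The radical is trivial. For \<open>d = u ^ q + u\<close> in the field of four elements,
  odd \<open>m\<close> gives \<open>d = d ^ q ^ m = d\<^sup>2\<close>, so \<open>d\<close> is in
  \<open>k\<close>. The trace is the identity on \<open>k\<close> for odd \<open>m\<close>, which
  makes \<open>d\<close> and then \<open>u\<close> vanish.\<close>

lemma E_square_odd_m: assumes "odd m" shows "(E 1)\<^sup>2 = int (q ^ (m - 1))"
proof -
  have one: "1 \<in> k" by (rule Fk.L_closed)
  have "u = 0" if "u \<in> Rad 1" for u
  proof -
    define d where "d = u ^ q + u"
    have u: "u \<in> K" "tr u = 0" "d ^ 4 = d"
      using that Rad_iff[OF one, of u] order_4_condition unfolding d_def by auto
    have dK: "d \<in> K" "tr d = 0" using u(1) H_image unfolding d_def by (auto simp: H_def FK.L_closed)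
    have dq: "d ^ q = d\<^sup>2" using frob_order_4[OF u(3)] .
    have "d ^ q ^ 2 = d" by (rule order_4_period(2)[OF u(3)])
    moreover obtain l where l: "m = 2 * l + 1" using assms by (auto elim: oddE)
    ultimately have "d ^ q ^ m = d ^ q"
      using power_power_fixed[of d "q ^ 2" l] by (simp add: power_mult mult.commute[of q])
    then have "d\<^sup>2 = d" using power_q_m[OF dK(1)] dq by simp
    then have "d \<in> k" using dq dK k_iff by simp
    then have "d = 0" using tr_k dK assms by (simp add: FK.of_nat_parity)
    then have "u \<in> k" using u k_iff FK.c2(2)[of "u ^ q" u] unfolding d_def by simp
    then show "u = 0" using tr_k u assms by (simp add: FK.of_nat_parity)
  qed
  then have "Rad 1 = {0}" using zero_in_Rad by blast
  then show ?thesis using E_square[OF one] by (simp add: trace_sign_zero)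
qed

text \<open>The automorphisms of \<open>K\<close> of prime order \<open>p\<close> act on \<open>H\<close>, which relates the sums for \<open>K\<close> and
  for the fixed field modulo \<open>p\<close>.\<close>

lemma E_cong_subfield:
  assumes p: "prime p" "odd p" and m: "m = d * p"
  obtains K' where "tower_odd K' k q r d" "[E 1 = tower.E K' q r d 1] (mod int p)"
proof -
  define K' where "K' = {x \<in> K. x ^ q ^ d = x}"
  have d: "d > 0" using m m_pos by (cases d) auto
  have qd: "q ^ d = 2 ^ (r * d)" unfolding q by (simp add: power_mult)
  have "is_subfield K'"
    unfolding is_subfield_def is_subring_def K'_def using subfield_K FK.L_closed
    by (auto simp: FK.c2(2) FK.frob_add qd power_mult_distrib subfield_inverse power_inverse)
  moreover have "card K' = q ^ d"
    unfolding K'_def using FK.card_fixed[OF qd, of p] prime_gt_0_nat[OF p(1)] r_pos d m by simp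
  moreover have "k \<subseteq> K'" unfolding K'_def using k_iff power_power_fixed by auto
  ultimately have tower: "tower_odd K' k q r d"
    using q r_pos d subfield_k card_k r_odd by unfold_locales auto
  interpret T: tower_odd K' k q r d by (rule tower)
  define \<sigma> where "\<sigma> x = x ^ q ^ d" for x :: 'f
  have iter: "(\<sigma> ^^ i) x = x ^ q ^ (d * i)" for i x
    by (induction i) (auto simp: \<sigma>_def power_add mult.commute simp flip: power_mult)
  have "[E 1 = (\<Sum>x | x \<in> H \<and> \<sigma> x = x. \<chi> (1 * x ^ 3))] (mod int p)"
    unfolding E_def
  proof (rule sum_cong_fixed_points[OF p(1)])
    show "finite H" using add_group_H by (rule add_groupD)
    fix x assume x: "x \<in> H"
    have "tr (\<sigma> x) = 0" unfolding \<sigma>_def qd using tr_power[of x "r * d"] x by (simp add: H_def zero_power)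
    then show "\<sigma> x \<in> H" using x by (simp add: H_def \<sigma>_def FK.L_closed)
    show "(\<sigma> ^^ p) x = x" unfolding iter using power_q_m[OF H_K[OF x]] m by metis
    have "\<sigma> x ^ 3 = (x ^ 3) ^ 2 ^ (r * d)" unfolding \<sigma>_def qd by (simp add: mult.commute flip: power_mult)
    then show "\<chi> (1 * \<sigma> x ^ 3) = \<chi> (1 * x ^ 3)"
      using FK.trace_sign_frob[of "x ^ 3"] x by (simp add: H_def FK.L_closed)
  qed
  also have "(\<Sum>x | x \<in> H \<and> \<sigma> x = x. \<chi> (1 * x ^ 3)) = T.E 1"
    unfolding T.E_def
  proof (rule sum.cong)
    \<comment> \<open>The degree \<open>p\<close> of \<open>K\<close> over \<open>K'\<close> is odd,
      so the two traces agree on \<open>K'\<close>.\<close>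
    have tr_K': "tr x = T.tr x" if "x \<in> K'" for x
    proof -
      have "x ^ q ^ d = x" using that unfolding K'_def by simp
      from ff_trace_periodic[OF this, of p] show ?thesis
        using p(2) unfolding m by (simp add: mult.commute FK.of_nat_parity)
    qed
    have "x \<in> H \<and> \<sigma> x = x \<longleftrightarrow> x \<in> K' \<and> tr x = 0" for x
      by (auto simp: H_def \<sigma>_def K'_def)
    moreover have "x \<in> T.H \<longleftrightarrow> x \<in> K' \<and> T.tr x = 0" for x by (simp add: T.H_def)
    ultimately show "{x. x \<in> H \<and> \<sigma> x = x} = T.H" using tr_K' by auto
    fix x assume "x \<in> T.H"
    then have "x ^ 3 \<in> K'" unfolding T.H_def by (auto intro: T.FK.L_closed)
    then show "\<chi> (1 * x ^ 3) = T.\<chi> (1 * x ^ 3)" by (simp add: sign_eq T.sign_eq tr_K')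
  qed
  finally show thesis using that tower by blast
qed

end

text \<open>One prime factor of \<open>m\<close> is removed at a time, so that the Galois action has
  prime order; the signs multiply like \<open>two_symbol\<close>.\<close>

lemma tower_odd_E_odd:
  assumes "tower_odd K k q r m" "odd m"
  shows "tower.E K q r m 1 = two_symbol m * int q ^ (m div 2)"
  using assms
proof (induction m arbitrary: K rule: less_induct)
  case (less m)
  interpret tower_odd K k q r m by (rule less.prems)
  show ?case
  proof (cases "m = 1")
    case True
    then have "card H = 1" using card_H by simp
    then have "H = {0}" using add_groupD(2)[OF add_group_H] by (metis card_1_singletonE singletonD)
    then have "E 1 = 1" by (simp add: E_def trace_sign_zero)
    moreover have "two_symbol m * int q ^ (m div 2) = 1" using True by (simp add: two_symbol_def)
    ultimately show ?thesis by simp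
  next
    case False
    then obtain p where p: "prime p" "p dvd m" using prime_factor_nat by blast
    then obtain d where d: "m = d * p" by (metis dvdE mult.commute)
    have odd_pd: "odd p" "odd d" using less.prems(2) d by auto
    have d_less: "d < m" using d m_pos prime_gt_1_nat[OF p(1)] by simp
    obtain K' where K': "tower_odd K' k q r d" "[E 1 = tower.E K' q r d 1] (mod int p)"
      using E_cong_subfield[OF p(1) odd_pd(1) d] by blast
    have IH: "tower.E K' q r d 1 = two_symbol d * int q ^ (d div 2)"
      using less.IH[OF d_less K'(1) odd_pd(2)] .
    \<comment> \<open>This is \<open>(d * p - 1) / 2 = (d - 1) / 2 + d * (p - 1) / 2\<close>; the
      second part yields an odd power of \<open>2 ^ ((p - 1) / 2)\<close>.\<close>
    have half: "m div 2 = d div 2 + d * (p div 2)"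
      using odd_pd unfolding d by (auto elim!: oddE simp: algebra_simps)
    have "(E 1)\<^sup>2 = (int q ^ (m div 2))\<^sup>2"
    proof -
      have "m - 1 = m div 2 * 2" using less.prems(2) by (auto elim: oddE)
      then show ?thesis using E_square_odd_m[OF less.prems(2)] by (simp add: power_mult)
    qed
    then have E_cases: "E 1 = 1 * int q ^ (m div 2) \<or> E 1 = - 1 * int q ^ (m div 2)"
      by (simp add: power2_eq_iff)
    then obtain \<sigma> :: int where \<sigma>: "\<sigma> = 1 \<or> \<sigma> = - 1" "E 1 = \<sigma> * int q ^ (m div 2)" by blast
    have "[int q ^ (d * (p div 2)) = two_symbol p] (mod int p)"
    proof -
      have "int q ^ (d * (p div 2)) = (2 ^ (p div 2)) ^ (r * d)"
        unfolding q by (simp add: mult_ac flip: power_mult)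
      also have "[\<dots> = two_symbol p ^ (r * d)] (mod int p)"
        by (rule cong_pow[OF two_power_half[OF p(1) odd_pd(1)]])
      also have "two_symbol p ^ (r * d) = two_symbol p"
        using r_odd odd_pd(2) by (simp add: two_symbol_def)
      finally show ?thesis .
    qed
    then have "[\<sigma> * (int q ^ (d div 2) * int q ^ (d * (p div 2)))
        = \<sigma> * (int q ^ (d div 2) * two_symbol p)] (mod int p)"
      by (intro cong_mult cong_refl)
    then have "[E 1 = (\<sigma> * two_symbol p) * int q ^ (d div 2)] (mod int p)"
      unfolding \<sigma>(2) half by (simp add: power_add mult_ac)
    then have "[two_symbol d * int q ^ (d div 2) = (\<sigma> * two_symbol p) * int q ^ (d div 2)] (mod int p)"
      using K'(2) unfolding IH by (metis cong_sym cong_trans)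
    moreover have "coprime (int q ^ (d div 2)) (int p)"
      using odd_pd(1) unfolding q by simp
    ultimately have "[two_symbol d = \<sigma> * two_symbol p] (mod int p)"
      using cong_mult_rcancel by blast
    then have dvd: "int p dvd two_symbol d - \<sigma> * two_symbol p" by (simp add: cong_iff_dvd_diff)
    have p3: "p > 2" using prime_ge_2_nat[OF p(1)] odd_pd(1) by (cases "p = 2") auto
    have vals: "two_symbol n = 1 \<or> two_symbol n = - 1" for n by (simp add: two_symbol_def)
    \<comment> \<open>Two signs differ by at most 2, so a difference divisible by
      \<open>p > 2\<close> is 0.\<close>
    have "\<bar>two_symbol d - \<sigma> * two_symbol p\<bar> \<le> 2" using vals[of d] vals[of p] \<sigma>(1) by auto
    then have "two_symbol d - \<sigma> * two_symbol p = 0"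
      using dvd_imp_le_int[OF _ dvd] p3 by force
    then have "\<sigma> = two_symbol d * two_symbol p" using vals[of d] vals[of p] \<sigma>(1) by auto
    then show ?thesis using \<sigma>(2) two_symbol_mult[OF odd_pd(2,1)] d by simp
  qed
qed

section \<open>Odd \<open>r\<close> and even \<open>m\<close>: isotropic subspaces\<close>

context tower_odd
begin

lemma full_sum: assumes m: "m = 2 * j"
  shows "(\<Sum>x\<in>K. \<chi> (1 * x ^ 3)) = - 2 * (- 1) ^ j * int q ^ j"
proof -
  have "(\<Sum>x\<in>K. \<chi> (1 * x ^ 3)) = (- 2) ^ (r * j + 1)"
  proof -
    have "\<exists>y\<in>K. 1 * y ^ 3 = 1" using FK.L_closed(5) by (intro bexI[of _ 1]) auto
    then show ?thesis using FK.cube_sum[of "r * j" 1] m FK.L_closed(5) by simp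
  qed
  also have "(- 2 :: int) ^ (r * j + 1) = - 2 * ((- 1) * 2) ^ (r * j)" by simp
  also have "((- 1 :: int) * 2) ^ (r * j) = ((- 1) ^ r) ^ j * (2 ^ r) ^ j"
    by (simp only: power_mult_distrib power_mult)
  finally show ?thesis using r_odd q by simp
qed

lemma full_sum_isotropic:
  assumes U: "add_group U" "U \<subseteq> K" and iso: "\<And>u. u \<in> U \<Longrightarrow> \<chi> (1 * u ^ 3) = 1"
  shows "(\<Sum>x\<in>K. \<chi> (1 * x ^ 3))
    = (\<Sum>x | x \<in> K \<and> (\<forall>u\<in>U. \<chi> ((1\<^sup>2 * u ^ 4 + 1 * u) * x\<^sup>2) = 1). \<chi> (1 * x ^ 3))"
proof (rule quadratic_sum_isotropic[OF FK.two FK.add_group_L U _ _ iso])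
  note one = FK.L_closed(5)
  show "\<chi> (1 * (x + y) ^ 3) = \<chi> (1 * x ^ 3) * \<chi> (1 * y ^ 3) * \<chi> ((1\<^sup>2 * y ^ 4 + 1 * y) * x\<^sup>2)"
    if "x \<in> K" "y \<in> K" for x y
    using FK.cube_sign_add[OF one that(2,1)] by (simp add: add.commute mult.commute)
  show "\<chi> ((1\<^sup>2 * (y + z) ^ 4 + 1 * (y + z)) * x\<^sup>2)
      = \<chi> ((1\<^sup>2 * y ^ 4 + 1 * y) * x\<^sup>2) * \<chi> ((1\<^sup>2 * z ^ 4 + 1 * z) * x\<^sup>2)"
    if "x \<in> K" "y \<in> U" "z \<in> U" for x y z
    using that U(2) by (intro FK.bilinear_sign_add' one) auto
qed

lemma sign_scale_square: "w \<in> k \<Longrightarrow> \<chi> (w * x\<^sup>2) = \<psi> (w * (tr x)\<^sup>2)"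
  using tr_power[of x 1] by (simp add: sign_eq tr_scale)

text \<open>The power \<open>q\<close> interchanges \<open>\<omega>\<close> and
  \<open>\<omega>\<^sup>2\<close>, whose sum is 1, so the trace is half the degree.\<close>

lemma exists_omega_K:
  assumes "even m" obtains \<omega> where "\<omega> \<in> K" "\<omega> ^ 4 = \<omega>" "\<omega> ^ 3 = 1" "\<omega> + \<omega>\<^sup>2 = 1"
    "tr \<omega> = of_nat (m div 2)"
proof -
  obtain \<omega> where w: "\<omega> \<in> K" "\<omega> ^ 4 = \<omega>" "\<omega> ^ 3 = 1" "1 + \<omega> + \<omega>\<^sup>2 = 0"
    using FK.exists_omega assms by auto
  then have sum1: "\<omega> + \<omega>\<^sup>2 = 1" using FK.c2(2)[of 1 "\<omega> + \<omega>\<^sup>2"] by (simp add: add.assoc)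
  have wq: "\<omega> ^ q = \<omega>\<^sup>2" by (rule frob_order_4[OF w(2)])
  have "\<omega> ^ q ^ 2 = \<omega>" by (rule order_4_period(2)[OF w(2)])
  from ff_trace_periodic[OF this, of "m div 2"] have "tr \<omega> = of_nat (m div 2) * ff_trace q 2 \<omega>"
    using assms by simp
  also have "ff_trace q 2 \<omega> = \<omega> + \<omega> ^ q" by (simp add: ff_trace_def eval_nat_numeral)
  finally have "tr \<omega> = of_nat (m div 2) * (\<omega> + \<omega> ^ q)" .
  then show thesis using that w sum1 wq by simp
qed

text \<open>For even \<open>m\<close> traces of elements of \<open>k\<close> vanish, so
  \<open>k\<close> is totally isotropic. Its orthogonal complement is given by trace 0 or 1, that
  is, by \<open>H\<close> and its translate by \<open>\<omega>\<close>. Both contribute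
  \<open>E 1\<close>, so the full sum is \<open>2 * E 1\<close>.\<close>

lemma E_half_odd: assumes m: "m = 2 * j" "odd j" shows "E 1 = int q ^ j"
proof -
  have m_even: "even m" using m by simp
  \<comment> \<open>The polar form is symmetric, which is hidden when it is collected at the square
    of one argument. This lets \<open>u\<close> and \<open>tr x\<close> change places.\<close>
  have sym: "\<psi> ((u ^ 4 + u) * t\<^sup>2) = \<psi> ((t ^ 4 + t) * u\<^sup>2)" if "u \<in> k" "t \<in> k" for u t
  proof -
    have "\<psi> ((x ^ 4 + x) * y\<^sup>2) = \<psi> (x\<^sup>2 * y) * \<psi> (x * y\<^sup>2)" if "x \<in> k" "y \<in> k" for x y
    proof -
      have "(x ^ 4 + x) * y\<^sup>2 = (x\<^sup>2 * y)\<^sup>2 + x * y\<^sup>2"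
        by (simp add: distrib_right power_mult_distrib flip: power_mult)
      then show ?thesis using that by (simp add: Fk.trace_sign_add Fk.trace_sign_power2 Fk.L_closed)
    qed
    from this[OF that] this[OF that(2,1)] show ?thesis by (simp add: mult.commute)
  qed
  have perp: "(\<forall>u\<in>k. \<chi> ((1\<^sup>2 * u ^ 4 + 1 * u) * x\<^sup>2) = 1) \<longleftrightarrow> tr x = 0 \<or> tr x = 1" if x: "x \<in> K" for x
  proof -
    have t: "tr x \<in> k" using x by (rule tr_in_k)
    have eq: "\<chi> ((1\<^sup>2 * u ^ 4 + 1 * u) * x\<^sup>2) = \<psi> (((tr x) ^ 4 + tr x) * u\<^sup>2)" if "u \<in> k" for u
      using that t sym by (simp add: sign_scale_square Fk.L_closed)
    show ?thesis
    proof
      assume "\<forall>u\<in>k. \<chi> ((1\<^sup>2 * u ^ 4 + 1 * u) * x\<^sup>2) = 1"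
      then have "(tr x) ^ 4 + tr x = 0"
        using t eq by (intro Fk.trace_sign_nondegenerate[where i = 1] Fk.L_closed) auto
      then show "tr x = 0 \<or> tr x = 1"
        using order_4_in_k[OF t] FK.c2(2)[of "(tr x) ^ 4" "tr x"] by simp
    next
      assume "tr x = 0 \<or> tr x = 1"
      then have "(tr x) ^ 4 + tr x = 0" by (auto simp: FK.two)
      then show "\<forall>u\<in>k. \<chi> ((1\<^sup>2 * u ^ 4 + 1 * u) * x\<^sup>2) = 1" using eq by (simp add: trace_sign_zero)
    qed
  qed
  have one: "\<chi> 1 = 1"
    using tr_k[of 1] Fk.L_closed(5) m_even by (simp add: sign_eq FK.of_nat_parity trace_sign_zero)
  obtain \<omega> where w: "\<omega> \<in> K" "\<omega> ^ 4 = \<omega>" "\<omega> ^ 3 = 1" "tr \<omega> = of_nat (m div 2)"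
    using exists_omega_K[OF m_even] by metis
  have tr_w: "tr \<omega> = 1" using w(4) m by (simp add: FK.of_nat_parity)
  \<comment> \<open>As \<open>\<omega> ^ 4 + \<omega> = 0\<close>, the element
    \<open>\<omega>\<close> pairs trivially with all of \<open>K\<close>, and
    \<open>\<omega> ^ 3 = 1\<close> has sign 1.\<close>
  have shift: "\<chi> (1 * (x + \<omega>) ^ 3) = \<chi> (1 * x ^ 3)" if "x \<in> K" for x
    using FK.cube_sign_add[OF FK.L_closed(5) w(1) that] one w
    by (simp add: add.commute FK.c2 trace_sign_zero)
  have "- 2 * (- 1) ^ j * int q ^ j = (\<Sum>x\<in>K. \<chi> (1 * x ^ 3))" using full_sum[OF m(1)] by simp
  also have "\<dots> = (\<Sum>x | x \<in> K \<and> (\<forall>u\<in>k. \<chi> ((1\<^sup>2 * u ^ 4 + 1 * u) * x\<^sup>2) = 1). \<chi> (1 * x ^ 3))"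
  proof (rule full_sum_isotropic[OF Fk.add_group_L k_subset])
    fix u assume "u \<in> k"
    then have "u ^ 3 \<in> k" by (rule Fk.L_closed)
    then show "\<chi> (1 * u ^ 3) = 1"
      using tr_k m_even by (simp add: sign_eq FK.of_nat_parity trace_sign_zero)
  qed
  also have "\<dots> = (\<Sum>x\<in>H \<union> {x \<in> K. tr x = 1}. \<chi> (1 * x ^ 3))"
    using perp by (intro sum.cong) (auto simp: H_def)
  also have "\<dots> = E 1 + (\<Sum>x | x \<in> K \<and> tr x = 1. \<chi> (1 * x ^ 3))"
    unfolding E_def using FK.finite_L by (intro sum.union_disjoint) (auto simp: H_def)
  also have "(\<Sum>x | x \<in> K \<and> tr x = 1. \<chi> (1 * x ^ 3)) = (\<Sum>x\<in>H. \<chi> (1 * (x + \<omega>) ^ 3))"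
  proof (rule sum.reindex_bij_betw[symmetric])
    have cancel: "x + \<omega> + \<omega> = x" for x by (simp add: add.assoc FK.c2)
    show "bij_betw (\<lambda>x. x + \<omega>) H {x. x \<in> K \<and> tr x = 1}"
      by (rule bij_betwI[where g = "\<lambda>x. x + \<omega>"])
         (use w(1) in \<open>auto simp: H_def tr_add tr_w cancel FK.L_closed FK.c2 FK.two\<close>)
  qed
  also have "\<dots> = E 1" unfolding E_def using shift by (intro sum.cong) (auto simp: H_def)
  finally show ?thesis using m(2) by simp
qed

text \<open>The conjugates of \<open>u\<close> are \<open>u\<close>, \<open>u + d\<close>, \<open>u + d + d\<^sup>2\<close> and \<open>u + d\<^sup>2\<close>.\<close>

lemma conjugates_order_4:
  assumes m: "m = 4 * i" and d: "d = u ^ q + u" "d ^ 4 = d"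
  shows "tr u = 0" "tr (u ^ 3) = of_nat i * (d + d\<^sup>2)"
proof -
  have dq: "d ^ q = d\<^sup>2" by (rule frob_order_4[OF d(2)])
  have d2q: "(d\<^sup>2) ^ q = d" by (rule order_4_period(1)[OF d(2)])
  have u1: "u ^ q = u + d" unfolding d(1) by (simp add: algebra_simps FK.two)
  have u2: "u ^ q ^ 2 = u + d + d\<^sup>2" by (simp add: power2_eq_square[of q] power_mult u1 frob_add dq)
  have "u ^ q ^ 3 = (u ^ q ^ 2) ^ q" by (simp add: eval_nat_numeral mult.assoc flip: power_mult)
  also have "\<dots> = u + d\<^sup>2 + (d + d)" unfolding u2 frob_add u1 dq d2q by (simp add: algebra_simps)
  finally have u3: "u ^ q ^ 3 = u + d\<^sup>2" by (simp add: FK.c2)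
  have "u ^ q ^ 4 = (u ^ q ^ 3) ^ q" by (simp add: eval_nat_numeral mult.assoc flip: power_mult)
  also have "\<dots> = u + (d + d)" unfolding u3 frob_add u1 d2q by (simp add: algebra_simps)
  finally have u4: "u ^ q ^ 4 = u" by (simp add: FK.c2)
  have m': "m = i * 4" using m by simp
  have "tr u = of_nat i * ff_trace q 4 u" unfolding m' by (rule ff_trace_periodic[OF u4])
  also have "ff_trace q 4 u = u + u ^ q + u ^ q ^ 2 + u ^ q ^ 3"
    by (simp add: ff_trace_def eval_nat_numeral)
  also have "\<dots> = 2 * (2 * u + d + d\<^sup>2)" unfolding u1 u2 u3 by (simp add: algebra_simps)
  finally show "tr u = 0" by (simp add: FK.two)
  have pow: "(u ^ 3) ^ q ^ n = (u ^ q ^ n) ^ 3" for n by (simp add: mult.commute flip: power_mult)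
  have "(u ^ 3) ^ q ^ 4 = u ^ 3" unfolding pow u4 ..
  from ff_trace_periodic[OF this, of i] have "tr (u ^ 3) = of_nat i * ff_trace q 4 (u ^ 3)" unfolding m' .
  also have "ff_trace q 4 (u ^ 3) = u ^ 3 + (u ^ q) ^ 3 + (u ^ q ^ 2) ^ 3 + (u ^ q ^ 3) ^ 3"
    unfolding ff_trace_def using pow[of 0] pow[of 1] pow[of 2] pow[of 3] by (simp add: eval_nat_numeral)
  also have "\<dots> = u ^ 3 + (u + d) ^ 3 + (u + d + d\<^sup>2) ^ 3 + (u + d\<^sup>2) ^ 3" unfolding u1 u2 u3 ..
  \<comment> \<open>Modulo 2 the cubes of the four conjugates add up to
    \<open>d ^ 4 + d ^ 5\<close>, which is \<open>d + d\<^sup>2\<close> because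
    \<open>d ^ 4 = d\<close>.\<close>
  also have "\<dots> = d ^ 4 + d * d ^ 4 + 2 * (2 * u ^ 3 + 3 * u\<^sup>2 * (d + d\<^sup>2) + 3 * u * (d\<^sup>2 + d ^ 3 + d ^ 4)
      + d ^ 3 + d ^ 4 + d ^ 5 + d ^ 6)"
    by algebra
  finally show "tr (u ^ 3) = of_nat i * (d + d\<^sup>2)" using d(2) by (simp add: FK.two power2_eq_square)
qed

text \<open>For even \<open>i\<close> the \<open>u\<close> with \<open>u ^ 4 + u\<close> in
  \<open>k\<close> form a totally isotropic subspace with orthogonal complement \<open>H\<close>, so
  \<open>E 1\<close> is the full sum. For odd \<open>i\<close> some radical element has sign -1, and
  translation by it negates the sum.\<close>

lemma E_half_even: assumes m: "m = 4 * i" shows "E 1 = (if even i then - 2 * int q ^ (2 * i) else 0)"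
proof (cases "even i")
  case True
  define U where "U = {u \<in> K. 1\<^sup>2 * u ^ 4 + 1 * u \<in> k}"
  note one = Fk.L_closed(5)
  have U: "add_group U"
    unfolding add_group_def
  proof (intro conjI ballI)
    fix x y assume xy: "x \<in> U" "y \<in> U"
    have "1\<^sup>2 * (x + y) ^ 4 + 1 * (x + y) = (1\<^sup>2 * x ^ 4 + 1 * x) + (1\<^sup>2 * y ^ 4 + 1 * y)"
      using FK.frob_add[of x y 2] by (simp add: algebra_simps)
    also have "\<dots> \<in> k" using xy unfolding U_def by (blast intro: Fk.L_closed(1))
    finally show "x + y \<in> U" using xy unfolding U_def by (auto intro: FK.L_closed)
  qed (use FK.finite_L FK.L_closed(4) Fk.L_closed(4) in \<open>auto simp: U_def\<close>)
  have "\<chi> (1 * u ^ 3) = 1" if "u \<in> U" for u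
  proof -
    have "(u ^ q + u) ^ 4 + (u ^ q + u) = 0"
      using that Rad_condition[OF one, of u] unfolding U_def by simp
    then have "(u ^ q + u) ^ 4 = u ^ q + u" using FK.c2(2)[of "(u ^ q + u) ^ 4" "u ^ q + u"] by simp
    then show ?thesis using conjugates_order_4(2)[OF m refl] True
      by (simp add: sign_eq FK.of_nat_parity trace_sign_zero)
  qed
  then have "(\<Sum>x\<in>K. \<chi> (1 * x ^ 3))
    = (\<Sum>x | x \<in> K \<and> (\<forall>u\<in>U. \<chi> ((1\<^sup>2 * u ^ 4 + 1 * u) * x\<^sup>2) = 1). \<chi> (1 * x ^ 3))"
    using U by (intro full_sum_isotropic) (auto simp: U_def)
  also have "{x. x \<in> K \<and> (\<forall>u\<in>U. \<chi> ((1\<^sup>2 * u ^ 4 + 1 * u) * x\<^sup>2) = 1)} = H"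
  proof (intro equalityI subsetI CollectI conjI ballI)
    fix x assume "x \<in> H"
    then show "x \<in> K" by (rule H_K)
    fix u assume "u \<in> U"
    then have "1\<^sup>2 * u ^ 4 + 1 * u \<in> k" unfolding U_def by blast
    from sign_scale_square[OF this, of x] show "\<chi> ((1\<^sup>2 * u ^ 4 + 1 * u) * x\<^sup>2) = 1"
      using \<open>x \<in> H\<close> by (simp add: H_def trace_sign_zero)
  next
    fix x assume x: "x \<in> {x. x \<in> K \<and> (\<forall>u\<in>U. \<chi> ((1\<^sup>2 * u ^ 4 + 1 * u) * x\<^sup>2) = 1)}"
    \<comment> \<open>Every \<open>w\<close> in \<open>k\<close> is \<open>u ^ 4 + u\<close> for
      some \<open>u\<close> in \<open>K\<close>, since its trace to the field of four elements is an
      even multiple of \<open>ff_trace 4 r w\<close>. So orthogonality to \<open>U\<close> tests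
      \<open>tr x\<close> against all of \<open>k\<close>.\<close>
    have "\<psi> ((tr x)\<^sup>2 * w ^ 2 ^ 0) = 1" if w: "w \<in> k" for w
    proof -
      have "w ^ 4 ^ r = w"
      proof -
        have "(4 :: nat) ^ r = q * q" unfolding q by (simp flip: power_mult_distrib)
        then show ?thesis using w k_iff by (simp add: power_mult)
      qed
      from ff_trace_periodic[OF this, of "2 * i"] have "ff_trace 4 (2 * i * r) w = 0"
        by (simp add: FK.of_nat_parity FK.two)
      then have "ff_trace 4 (r * (2 * i)) w = 0" by (simp only: mult.commute)
      then have "w \<in> (\<lambda>x. x ^ 4 + x) ` K"
        using FK.image_eq_trace_zero[of 4 2 "r * (2 * i)"] w k_K m m_pos r_pos by auto
      then obtain u where u: "u \<in> K" "w = 1\<^sup>2 * u ^ 4 + 1 * u" by auto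
      then have "u \<in> U" using w unfolding U_def by simp
      then have "\<chi> (w * x\<^sup>2) = 1" using x u(2) by blast
      then show ?thesis using sign_scale_square[OF w, of x] by (simp add: mult.commute)
    qed
    then have "(tr x)\<^sup>2 = 0"
      using x tr_in_k by (intro Fk.trace_sign_nondegenerate[where i = 0] Fk.L_closed) auto
    then show "x \<in> H" using x by (simp add: H_def)
  qed
  finally have "E 1 = - 2 * (- 1) ^ (2 * i) * int q ^ (2 * i)"
    unfolding E_def using full_sum[of "2 * i"] m by simp
  then show ?thesis using True by simp
next
  case False
  note one = Fk.L_closed(5)
  have m_even: "even m" using m by simp
  obtain \<omega> where w: "\<omega> \<in> K" "\<omega> ^ 4 = \<omega>" "\<omega> + \<omega>\<^sup>2 = 1" "tr \<omega> = of_nat (m div 2)"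
    using exists_omega_K[OF m_even] by metis
  have "tr \<omega> = 0" using w(4) m by (simp add: FK.two)
  then have "\<omega> \<in> H" using w(1) by (simp add: H_def)
  \<comment> \<open>This \<open>u\<close> is the radical element sought: its cube has trace
    \<open>\<omega> + \<omega>\<^sup>2 = 1\<close>, and 1 has sign -1 in \<open>k\<close> because
    \<open>r\<close> is odd.\<close>
  then obtain u where u: "u \<in> K" "\<omega> = u ^ q + u" unfolding H_image by blast
  have uH: "u \<in> H" using conjugates_order_4(1)[OF m u(2) w(2)] u(1) by (simp add: H_def)
  have "tr (u ^ 3) = 1"
    using conjugates_order_4(2)[OF m u(2) w(2)] w(3) False by (simp add: FK.of_nat_parity)
  then have "\<chi> (1 * u ^ 3) = \<psi> 1" by (simp add: sign_eq)
  also have "\<dots> = - 1" using r_odd by (simp add: trace_sign_def ff_trace_def FK.of_nat_parity)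
  finally have "\<chi> (1 * u ^ 3) = - 1" .
  moreover have "1\<^sup>2 * u ^ 4 + 1 * u \<in> k"
    using Rad_condition[OF one u(1)] w(2) unfolding u(2)[symmetric] by (simp add: FK.c2)
  ultimately have "\<chi> (1 * (x + u) ^ 3) = - \<chi> (1 * x ^ 3)" if "x \<in> H" for x
    using FK.cube_sign_add[OF FK.L_closed(5) u(1) H_K[OF that]]
      sign_scale_square[of "1\<^sup>2 * u ^ 4 + 1 * u" x] that
    by (simp add: add.commute H_def trace_sign_zero)
  then have "(\<Sum>x\<in>H. \<chi> (1 * (x + u) ^ 3)) = - E 1"
    unfolding E_def by (simp add: sum_negf)
  moreover have "(\<Sum>x\<in>H. \<chi> (1 * (x + u) ^ 3)) = E 1"
    unfolding E_def by (rule sum_shift[OF FK.two add_group_H uH])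
  ultimately show ?thesis using False by simp
qed

end


section \<open>Summation over the characters and the final formulas\<close>

context tower_even
begin

text \<open>\<open>E\<close> has the noncube value everywhere plus the difference
  \<open>ec - en\<close> on cubes. A sum over cubes is a third of one over all nonzero
  \<open>x\<close>; the factor 3 avoids the division.\<close>

lemma sum_E:
  assumes c: "c \<in> k" and t: "t = m div 2"
    and e: "ec = (if 4 dvd m then - 2 else 1)" "en = (if 3 dvd m then - 2 else 1)"
  shows "3 * (\<Sum>\<mu>\<in>k - {0}. \<psi> (\<mu> * c) * E \<mu>) = int q ^ t *
    (3 * en * ((\<Sum>\<mu>\<in>k. \<psi> (c * \<mu>)) - 1) + (ec - en) * ((\<Sum>x\<in>k. \<psi> (c * x ^ 3)) - 1))"
proof -
  define C where "C = (\<lambda>x. x ^ 3) ` (k - {0})"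
  have C: "C \<subseteq> k - {0}" unfolding C_def by (auto intro: Fk.L_closed)
  have fin: "finite (k - {0})" using Fk.finite_L by simp
  have remove0: "(\<Sum>x\<in>k. f x) - f 0 = (\<Sum>x\<in>k - {0}. f x)" for f :: "'f \<Rightarrow> int"
    using sum.remove[OF Fk.finite_L Fk.L_closed(4), of f] by simp
  have E: "E \<mu> = int q ^ t * en + (if \<mu> \<in> C then int q ^ t * (ec - en) else 0)" if "\<mu> \<in> k - {0}" for \<mu>
  proof -
    have "(\<exists>\<nu>\<in>k. \<nu> ^ 3 = \<mu>) \<longleftrightarrow> \<mu> \<in> C" using that unfolding C_def by auto
    then show ?thesis using E_value[of \<mu>] that unfolding t e by (simp add: algebra_simps)
  qed
  have "(\<Sum>\<mu>\<in>k - {0}. \<psi> (\<mu> * c) * E \<mu>) = (\<Sum>\<mu>\<in>k - {0}. int q ^ t * en * \<psi> (\<mu> * c)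
      + (if \<mu> \<in> C then int q ^ t * (ec - en) * \<psi> (\<mu> * c) else 0))"
    using E by (intro sum.cong) (auto simp: algebra_simps)
  also have "\<dots> = int q ^ t * en * (\<Sum>\<mu>\<in>k - {0}. \<psi> (\<mu> * c))
      + (\<Sum>\<mu>\<in>(k - {0}) \<inter> C. int q ^ t * (ec - en) * \<psi> (\<mu> * c))"
    using sum.inter_restrict[OF fin, of "\<lambda>\<mu>. int q ^ t * (ec - en) * \<psi> (\<mu> * c)" C]
    by (simp add: sum.distrib sum_distrib_left)
  also have "(k - {0}) \<inter> C = C" using C by blast
  also have "(\<Sum>\<mu>\<in>C. int q ^ t * (ec - en) * \<psi> (\<mu> * c)) = int q ^ t * (ec - en) * (\<Sum>\<mu>\<in>C. \<psi> (\<mu> * c))"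
    by (simp add: sum_distrib_left)
  finally have sum: "(\<Sum>\<mu>\<in>k - {0}. \<psi> (\<mu> * c) * E \<mu>)
    = int q ^ t * en * (\<Sum>\<mu>\<in>k - {0}. \<psi> (\<mu> * c)) + int q ^ t * (ec - en) * (\<Sum>\<mu>\<in>C. \<psi> (\<mu> * c))" .
  have "3 * (\<Sum>\<mu>\<in>C. \<psi> (\<mu> * c)) = (\<Sum>x\<in>k - {0}. \<psi> (c * x ^ 3))"
    using Fk.sum_over_cubes[OF r_even, of "\<lambda>\<mu>. \<psi> (\<mu> * c)"] unfolding C_def by (simp add: mult.commute)
  also have "\<dots> = (\<Sum>x\<in>k. \<psi> (c * x ^ 3)) - 1"
    using remove0[of "\<lambda>x. \<psi> (c * x ^ 3)"] by (simp add: trace_sign_zero)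
  finally have cubes: "3 * (\<Sum>\<mu>\<in>C. \<psi> (\<mu> * c)) = (\<Sum>x\<in>k. \<psi> (c * x ^ 3)) - 1" .
  have all: "(\<Sum>\<mu>\<in>k - {0}. \<psi> (\<mu> * c)) = (\<Sum>\<mu>\<in>k. \<psi> (c * \<mu>)) - 1"
    using remove0[of "\<lambda>\<mu>. \<psi> (\<mu> * c)"] by (simp add: trace_sign_zero mult.commute)
  have "3 * (\<Sum>\<mu>\<in>k - {0}. \<psi> (\<mu> * c) * E \<mu>) = int q ^ t * (3 * en * (\<Sum>\<mu>\<in>k - {0}. \<psi> (\<mu> * c))
      + (ec - en) * (3 * (\<Sum>\<mu>\<in>C. \<psi> (\<mu> * c))))"
    unfolding sum by (simp add: algebra_simps)
  then show ?thesis unfolding cubes all .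
qed

text \<open>The weights reflect that one third of the nonzero elements of \<open>k\<close> are
  cubes.\<close>

lemma sum_E_zero:
  "3 * (\<Sum>\<mu>\<in>k - {0}. \<psi> (\<mu> * 0) * E \<mu>) = int q ^ (m div 2) * (int q - 1) *
    (2 * (if 3 dvd m then - 2 else 1) + (if 4 dvd m then - 2 else 1))"
  using sum_E[OF Fk.L_closed(4) refl refl refl] card_k by (simp add: trace_sign_zero algebra_simps)

text \<open>For nonzero \<open>c\<close> the linear character sum vanishes, and \<open>T\<close> is
  the cubic sum over \<open>k\<close> given by \<open>cube_sum\<close>.\<close>

lemma sum_E_nonzero:
  assumes c: "c \<in> k" "c \<noteq> 0"
    and T: "T = (if \<exists>y\<in>k. c * y ^ 3 = 1 then - 2 else 1) * (- 2) ^ (r div 2)"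
    and e: "ec = (if 4 dvd m then - 2 else 1)" "en = (if 3 dvd m then - 2 else 1)"
  shows "3 * (\<Sum>\<mu>\<in>k - {0}. \<psi> (\<mu> * c) * E \<mu>) =
    int q ^ (m div 2) * ((ec - en) * (T - 1) - 3 * en)"
proof -
  have "(\<Sum>x\<in>k. \<psi> (c * x ^ 3)) = T"
    using Fk.cube_sum[of "r div 2" c] r_even c unfolding T by simp
  then show ?thesis using sum_E[OF c(1) refl e] Fk.sum_trace_sign[OF c(1)] c(2) by simp
qed

end

context tower_odd
begin

lemma E_1_value:
  "E 1 = (if odd m then two_symbol m else if 8 dvd m then - 2 else if 4 dvd m then 0 else 1)
    * int q ^ (m div 2)"
proof (cases "odd m")
  case True
  then show ?thesis using tower_odd_E_odd[OF tower_odd_axioms] by simp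
next
  case False
  then obtain j where j: "m = 2 * j" by (auto elim: evenE)
  show ?thesis
  proof (cases "odd j")
    case True
    then have "\<not> 4 dvd m" "\<not> 8 dvd m" using j by presburger+
    then show ?thesis using E_half_odd[OF j True] j by simp
  next
    case False
    then obtain i where i: "m = 4 * i" using j by (auto elim: evenE)
    then have "8 dvd m \<longleftrightarrow> even i" by presburger
    then show ?thesis using E_half_even[OF i] i by auto
  qed
qed

lemma sum_E_zero: "(\<Sum>\<mu>\<in>k - {0}. \<psi> (\<mu> * 0) * E \<mu>) = (int q - 1) * E 1"
proof -
  have "(\<Sum>\<mu>\<in>k - {0}. \<psi> (\<mu> * 0) * E \<mu>) = (\<Sum>\<mu>\<in>k - {0}. E 1)"
    using E_eq_E_1 by (intro sum.cong) (auto simp: trace_sign_zero)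
  also have "\<dots> = int (q - 1) * E 1"
    using card_k Fk.finite_L Fk.L_closed(4) by (simp add: card_Diff_singleton)
  finally show ?thesis using q by (simp add: of_nat_diff)
qed

end

text \<open>Nonzero cubes and their inverses form the same set; this matches the subgroup with the
  solvability condition in \<open>cube_sum\<close>.\<close>

lemma cyclic_subgroup_cube_iff:
  assumes \<gamma>: "primitive_element k \<gamma>" and k: "is_subfield k" and c: "c \<in> k" "c \<noteq> 0"
  shows "c \<in> cyclic_subgroup (\<gamma> ^ 3) \<longleftrightarrow> (\<exists>y\<in>k. c * y ^ 3 = 1)"
proof -
  have units: "cyclic_subgroup \<gamma> = k - {0}" using \<gamma> unfolding primitive_element_def .
  have cube: "(\<gamma> ^ 3) powi i = (\<gamma> powi i) ^ 3" for i
    by (simp add: power3_eq_cube power_int_mult_distrib)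
  show ?thesis
  proof
    assume "c \<in> cyclic_subgroup (\<gamma> ^ 3)"
    then obtain i where i: "c = (\<gamma> powi i) ^ 3" unfolding cyclic_subgroup_def cube by blast
    have "\<gamma> powi i \<in> k - {0}" using units unfolding cyclic_subgroup_def by blast
    then have "inverse (\<gamma> powi i) \<in> k" using k by (simp add: subfield_inverse)
    moreover have "c * inverse (\<gamma> powi i) ^ 3 = 1" using i c(2) by (simp add: power_inverse)
    ultimately show "\<exists>y\<in>k. c * y ^ 3 = 1" by blast
  next
    assume "\<exists>y\<in>k. c * y ^ 3 = 1"
    then obtain y where y: "y \<in> k" "c * y ^ 3 = 1" by blast
    then have "y \<noteq> 0" by auto
    then have "inverse y \<in> cyclic_subgroup \<gamma>" unfolding units using y k by (simp add: subfield_inverse)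
    then obtain i where i: "inverse y = \<gamma> powi i" unfolding cyclic_subgroup_def by blast
    have "c = inverse y ^ 3" using y \<open>y \<noteq> 0\<close> by (simp add: field_simps)
    then show "c \<in> cyclic_subgroup (\<gamma> ^ 3)" unfolding i cyclic_subgroup_def cube[symmetric] by blast
  qed
qed

text \<open>\<open>X = q ^ (m div 2 + 1)\<close> is the common factor of all cases of the theorem;
  only the exponent \<open>(m + 3) / 2\<close> brings a further \<open>sqrt q\<close>.\<close>

lemma powr_half_exponents:
  assumes "q > 0" and X: "X = real q * real q ^ (m div 2)"
  shows "odd m \<Longrightarrow> real q powr ((real m + 1) / 2) = X"
    and "even m \<Longrightarrow> real q powr ((real m + 2) / 2) = X"
    and "even m \<Longrightarrow> real q powr ((real m + 3) / 2) = X * sqrt (real q)"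
proof -
  have X: "X = real q powr real (m div 2 + 1)"
    unfolding X using assms(1) by (subst powr_realpow) auto
  show "real q powr ((real m + 1) / 2) = X" if "odd m"
    unfolding X using that by (intro arg_cong[of _ _ "(powr) (real q)"]) (auto elim!: oddE)
  have even: "(real m + 2) / 2 = real (m div 2 + 1)" if "even m" using that by (auto elim: evenE)
  show "real q powr ((real m + 2) / 2) = X" if "even m" unfolding X even[OF that] ..
  have "(real m + 3) / 2 = (real m + 2) / 2 + 1 / 2" by simp
  then show "real q powr ((real m + 3) / 2) = X * sqrt (real q)" if "even m"
    unfolding X using even[OF that] assms(1) by (simp only: powr_add powr_half_sqrt of_nat_0_le_iff)
qed

theorem theorem3p4:
  fixes k K :: "'f::field set" and q r m s :: nat and a b c \<beta> \<gamma> :: 'f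
  assumes q: "q = 2 ^ r"
    and m: "m \<ge> 1"
    and K: "is_subfield K" "card K = q ^ m"
    and k: "is_subfield k" "card k = q" "k \<subseteq> K"
    and ab: "a \<in> k" "b \<in> k" "a \<noteq> b"
    and \<gamma>: "primitive_element k \<gamma>"
    and \<beta>: "\<beta> \<in> K"
    and c: "c = ff_trace q m \<beta>"
    and s: "s = r div 2"
  shows
   "(\<forall>F. is_curve_field q K a b 0 F \<longrightarrow>
      (let D = real (card (rational_places K F)) - (real q ^ m + 1) in
        (odd r \<longrightarrow>
          (m mod 8 = 0 \<longrightarrow> D = - 2 * (real q - 1) * real q powr ((real m + 2) / 2)) \<and>
          (m mod 8 \<in> {1, 7} \<longrightarrow> D = (real q - 1) * real q powr ((real m + 1) / 2)) \<and>
          (m mod 8 \<in> {2, 6} \<longrightarrow> D = (real q - 1) * real q powr ((real m + 2) / 2)) \<and>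
          (m mod 8 \<in> {3, 5} \<longrightarrow> D = - (real q - 1) * real q powr ((real m + 1) / 2)) \<and>
          (m mod 8 = 4 \<longrightarrow> D = 0)) \<and>
        (even r \<longrightarrow>
          (m mod 12 = 0 \<longrightarrow> D = - 2 * (real q - 1) * real q powr ((real m + 2) / 2)) \<and>
          (m mod 12 \<in> {1, 5, 7, 11} \<longrightarrow> D = (real q - 1) * real q powr ((real m + 1) / 2)) \<and>
          (m mod 12 \<in> {2, 10} \<longrightarrow> D = (real q - 1) * real q powr ((real m + 2) / 2)) \<and>
          (m mod 12 \<in> {3, 9} \<longrightarrow> D = - (real q - 1) * real q powr ((real m + 1) / 2)) \<and>
          (m mod 12 \<in> {4, 8} \<longrightarrow> D = 0) \<and>
          (m mod 12 = 6 \<longrightarrow> D = - (real q - 1) * real q powr ((real m + 2) / 2))))) \<and>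
    (even r \<and> c \<noteq> 0 \<longrightarrow>
      (\<forall>F. is_curve_field q K a b \<beta> F \<longrightarrow>
        (let D = real (card (rational_places K F)) - (real q ^ m + 1);
             C = cyclic_subgroup (\<gamma> ^ 3) in
          (m mod 12 = 0 \<longrightarrow>
            D = (if c \<in> C then 2 * real q powr ((real m + 2) / 2)
                 else 2 * real q powr ((real m + 2) / 2))) \<and>
          (m mod 12 \<in> {1, 5, 7, 11} \<longrightarrow>
            D = (if c \<in> C then - (real q powr ((real m + 1) / 2))
                 else - (real q powr ((real m + 1) / 2)))) \<and>
          (m mod 12 \<in> {2, 10} \<longrightarrow>
            D = (if c \<in> C then - (real q powr ((real m + 2) / 2))
                 else - (real q powr ((real m + 2) / 2)))) \<and>
          (m mod 12 \<in> {3, 9} \<longrightarrow>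
            D = (if c \<in> C then (1 - (- 1) ^ s * 2 * sqrt (real q)) * real q powr ((real m + 1) / 2)
                 else (1 + (- 1) ^ s * sqrt (real q)) * real q powr ((real m + 1) / 2))) \<and>
          (m mod 12 \<in> {4, 8} \<longrightarrow>
            D = (if c \<in> C then (- 1) ^ s * 2 * real q powr ((real m + 3) / 2)
                 else (- 1) ^ (s + 1) * real q powr ((real m + 3) / 2))) \<and>
          (m mod 12 = 6 \<longrightarrow>
            D = (if c \<in> C then (1 - (- 1) ^ s * 2 * sqrt (real q)) * real q powr ((real m + 2) / 2)
                 else (1 + (- 1) ^ s * sqrt (real q)) * real q powr ((real m + 2) / 2))))))"
proof -
  have finite_k: "finite k" using k(2) q by (simp add: card_ge_0_finite)
  have "{0, 1} \<subseteq> k" using subfield_subring[OF k(1)] by (simp add: subring_zero subring_one)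
  from card_mono[OF finite_k this] have r_pos: "r > 0" using k(2) q by (cases r) auto
  interpret tower K k q r m
    using q r_pos m K k by unfold_locales auto
  define X where "X = real q * real q ^ (m div 2)"
  have q_pos: "q > 0" using q by simp
  note pw = powr_half_exponents[OF q_pos X_def]
  have D_eq: "real (card (rational_places K F)) - (real q ^ m + 1)
      = real q * real_of_int (\<Sum>\<mu>\<in>k - {0}. \<psi> (\<mu> * tr \<beta>') * E \<mu>)"
    if "\<beta>' \<in> K" "is_curve_field q K a b \<beta>' F" for \<beta>' F
  proof -
    have "int (card (rational_places K F)) = 1 + (int q ^ m + int q * (\<Sum>\<mu>\<in>k - {0}. \<psi> (\<mu> * tr \<beta>') * E \<mu>))"
      unfolding card_places_curve[OF q r_pos K(1) FK.finite_L k ab that] using card_points[OF that(1)] by simp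
    then have "real_of_int (int (card (rational_places K F)))
      = real_of_int (1 + (int q ^ m + int q * (\<Sum>\<mu>\<in>k - {0}. \<psi> (\<mu> * tr \<beta>') * E \<mu>)))" by simp
    then show ?thesis by simp
  qed
  define D where "D F = real (card (rational_places K F)) - (real q ^ m + 1)" for F
  have D_zero: "D F = real q * real_of_int (\<Sum>\<mu>\<in>k - {0}. \<psi> (\<mu> * 0) * E \<mu>)"
    if "is_curve_field q K a b 0 F" for F
  proof -
    have "tr 0 = 0" using add_groupD(2)[OF add_group_H] by (simp add: H_def)
    then show ?thesis unfolding D_def using D_eq[OF FK.L_closed(4) that] by simp
  qed
  have odd_case: "D F = (real q - 1) * (if odd m then real_of_int (two_symbol m)
      else if 8 dvd m then - 2 else if 4 dvd m then 0 else 1) * X"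
    if F: "is_curve_field q K a b 0 F" and "odd r" for F
  proof -
    interpret tower_odd K k q r m using \<open>odd r\<close> by unfold_locales
    show ?thesis unfolding D_zero[OF F] sum_E_zero E_1_value X_def by simp
  qed
  have even_case: "D F = (real q - 1) *
      (2 * (if 3 dvd m then - 2 else 1) + (if 4 dvd m then - 2 else 1)) * X / 3"
    if F: "is_curve_field q K a b 0 F" and "even r" for F
  proof -
    interpret tower_even K k q r m using \<open>even r\<close> by unfold_locales
    have "3 * D F = real q * real_of_int (3 * (\<Sum>\<mu>\<in>k - {0}. \<psi> (\<mu> * 0) * E \<mu>))"
      unfolding D_zero[OF F] by simp
    then show ?thesis unfolding sum_E_zero X_def by (auto simp: algebra_simps)
  qed
  \<comment> \<open>The cubic sum over \<open>k\<close> as a real number: for even \<open>r\<close>,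
    \<open>(- 2) ^ s\<close> is \<open>(- 1) ^ s * sqrt q\<close>.\<close>
  define T where "T = (if c \<in> cyclic_subgroup (\<gamma> ^ 3) then - 2 else 1) * (- 1) ^ s * sqrt (real q)"
  have nonzero_case: "D F = X * (((if 4 dvd m then - 2 else 1) - (if 3 dvd m then - 2 else 1)) * (T - 1)
      - 3 * (if 3 dvd m then - 2 else 1)) / 3"
    if F: "is_curve_field q K a b \<beta> F" and r: "even r" and c0: "c \<noteq> 0" for F
  proof -
    interpret tower_even K k q r m using r by unfold_locales
    have ck: "c \<in> k" using tr_in_k[OF \<beta>] unfolding c .
    have "real q = (2 ^ s)\<^sup>2" unfolding q s using r by (simp flip: power_mult)
    then have sqrt_q: "sqrt (real q) = 2 ^ s" by simp
    have T_eq: "real_of_int ((if \<exists>y\<in>k. c * y ^ 3 = 1 then - 2 else 1) * (- 2) ^ (r div 2)) = T"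
      unfolding T_def sqrt_q cyclic_subgroup_cube_iff[OF \<gamma> k(1) ck c0] s
      by (simp flip: power_mult_distrib)
    have "real_of_int (3 * (\<Sum>\<mu>\<in>k - {0}. \<psi> (\<mu> * c) * E \<mu>)) = real q ^ (m div 2) *
       (((if 4 dvd m then - 2 else 1) - (if 3 dvd m then - 2 else 1)) * (T - 1) - 3 * (if 3 dvd m then - 2 else 1))"
      unfolding sum_E_nonzero[OF ck c0 refl refl refl] T_eq[symmetric] by simp
    then have "3 * D F = X * (((if 4 dvd m then - 2 else 1) - (if 3 dvd m then - 2 else 1)) * (T - 1)
        - 3 * (if 3 dvd m then - 2 else 1))"
      unfolding D_def D_eq[OF \<beta> F] X_def c by simp
    then show ?thesis by (simp only: eq_divide_eq_numeral1 mult.commute) simp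
  qed
  \<comment> \<open>The premises on \<open>r\<close> let the simplifier pick the modulus that
    belongs to the case at hand.\<close>
  have mod12: "3 dvd m \<longleftrightarrow> 3 dvd m mod 12" "4 dvd m \<longleftrightarrow> 4 dvd m mod 12" "even m \<longleftrightarrow> even (m mod 12)"
    if "even r"
    by (simp_all add: dvd_mod_iff)
  have mod8: "8 dvd m \<longleftrightarrow> 8 dvd m mod 8" "4 dvd m \<longleftrightarrow> 4 dvd m mod 8" "even m \<longleftrightarrow> even (m mod 8)"
    if "odd r"
    by (simp_all add: dvd_mod_iff)
  show ?thesis
    unfolding Let_def D_def[symmetric]
    by (intro conjI allI impI; (elim conjE)?; (elim insertE emptyE)?;
        simp add: odd_case even_case nonzero_case mod8 mod12 pw T_def two_symbol_def;
        (simp add: field_simps)?)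
qed

end
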